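(* Let $n\in\mathbb{N}$ and let $K\subset\mathbb{R}^n$ be an isotropic unconditional convex body with cone probability measure $\mu_K$ on $\partial K$. Then, for every $\theta\in\mathbb{R}^n$, $$\|\langle\cdot,\theta\rangle\|_{L^{\psi_2}(\mu_K)}\le 3\sqrt{n}\,\|\theta\|_\infty.$$
   Context: A convex body in $\mathbb{R}^n$ is a compact convex set with non-empty interior; $|\cdot|$ denotes $n$-dimensional Lebesgue measure (for sets), $\langle\cdot,\cdot\rangle$ the standard scalar product, $\mathbb{S}^{n-1}$ the Euclidean unit sphere, and $\|\theta\|_\infty=\max_i|\theta_i|$. A convex body $K$ is isotropic if $|K|=1$, its barycenter is at the origin, and there is a constant $L_K$ such that $\int_K\langle x,\theta\rangle^2\,dx=L_K^2$ for all $\theta\in\mathbb{S}^{n-1}$. $K$ is unconditional if it is symmetric with respect to all $n$ coordinate hyperplanes. The cone probability measure $\mu_K$ on $\partial K$ is $\mu_K(B)=|\{rx:x\in B,\ 0\le r\le 1\}|/|K|$ for Borel sets $B\subset\partial K$. For a probability measure $\mu$ and a measurable real function $f$, the $\psi_2$-norm is the Luxemburg norm associated with $\psi_2(x)=\exp(x^2)-1$: $$\|f\|_{L^{\psi_2}(\mu)}=\inf\Bigl\{\lambda>0:\int\bigl(\exp\bigl((|f|/\lambda)^2\bigr)-1\bigr)\,d\mu\le 1\Bigr\}.$$ *)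

theory Defs
  imports "HOL-Analysis.Analysis"
begin

definition convex_body :: "'a::euclidean_space set \<Rightarrow> bool" where
  "convex_body K \<longleftrightarrow> compact K \<and> convex K \<and> interior K \<noteq> {}"

definition barycenter :: "'a::euclidean_space set \<Rightarrow> 'a" where
  "barycenter K = (1 / measure lebesgue K) *\<^sub>R (LINT x:K|lebesgue. x)"

definition isotropic :: "'a::euclidean_space set \<Rightarrow> bool" where
  "isotropic K \<longleftrightarrow> convex_body K \<and> measure lebesgue K = 1 \<and> barycenter K = 0 \<and>
     (\<exists>L::real. \<forall>\<theta>\<in>sphere 0 1. (LINT x:K|lebesgue. (x \<bullet> \<theta>)\<^sup>2) = L\<^sup>2)"

definition coord_reflection :: "'n \<Rightarrow> real ^ 'n \<Rightarrow> real ^ 'n" where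
  "coord_reflection i x = (\<chi> j. if j = i then - x $ j else x $ j)"

definition unconditional :: "(real ^ 'n) set \<Rightarrow> bool" where
  "unconditional K \<longleftrightarrow> (\<forall>i. coord_reflection i ` K = K)"

(* measure_of returns the null measure when the given set function is not countably additive on
   the Borel sets of the boundary.  This does not happen for a convex body with the origin in its
   interior: the cones over disjoint sets then meet only in the origin. *)
definition cone_measure :: "'a::euclidean_space set \<Rightarrow> 'a measure" where
  "cone_measure K = measure_of (frontier K) (sets (restrict_space borel (frontier K)))
     (\<lambda>B. emeasure lebesgue {r *\<^sub>R x | r x. x \<in> B \<and> 0 \<le> r \<and> r \<le> 1} / emeasure lebesgue K)"

(* Extended-valued: the norm is infinite if no scale is admissible, and the nonnegative integral
   makes a scale with divergent integral inadmissible. *)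
definition psi2_norm :: "'a measure \<Rightarrow> ('a \<Rightarrow> real) \<Rightarrow> ennreal" where
  "psi2_norm M f =
     (INF c\<in>{c::real. c > 0 \<and> (\<integral>\<^sup>+x. ennreal (exp ((\<bar>f x\<bar> / c)\<^sup>2) - 1) \<partial>M) \<le> 1}. ennreal c)"

end

theory Submission
  imports Defs "HOL-Probability.Distributions" "HOL-Computational_Algebra.Formal_Power_Series"
begin

text \<open>
  The even moments of a linear functional under the cone measure are compared with those of
  independent exponential variables, and the exponential series in the definition of the norm is
  summed. The proof follows the approach of Bobkov and Nazarov to unconditional bodies.

  Let \<open>n\<close> be the dimension and \<open>D\<close> the part of \<open>K\<close> in the nonnegative orthant, with its uniform
  distribution. By unconditionality, only the monomials with even exponents contribute to the
  integral of \<open>(x \<bullet> \<theta>) ^ (2 * k)\<close> over \<open>K\<close>; their integrals are nonnegative, so for an upper bound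
  each component of \<open>\<theta>\<close> may be replaced by \<open>infnorm \<theta>\<close>. What remains are the even monomials of a
  random point of \<open>D\<close>, and these are controlled by the probability that \<open>x\<^sub>i \<ge> a\<^sub>i\<close> for all \<open>i\<close>.

  This tail probability is at most \<open>(1 - (4 / 5) (\<Sum>a\<^sub>i) / n) ^ n\<close> (\<open>tail_le\<close>), with the base
  replaced by 0 where it is negative. By the Brunn-Minkowski inequality, needed only for
  down-closed subsets of the orthant (\<open>brunn_minkowski_down_set\<close>), its \<open>n\<close>-th root is concave
  along rays, hence lies below its tangent at the origin. The slope of the tangent is governed by
  the densities of the coordinates at 0. A coordinate has density at least 4/5 near 0 if its
  second moment is at most 1/2 (\<open>slab_lower_bound\<close>), and the second moments are indeed at most
  1/2: they all coincide, each is at most twice the square of the mean (\<open>second_moment_le\<close>), and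
  the product of the means is the volume of a box contained in \<open>D\<close> (\<open>prod_expectation_le\<close>), hence
  at most \<open>2 ^ (- n)\<close>.

  Multiplying the random point by an independent Gamma variable turns the tail bound into the tail
  of independent exponential variables. Comparing moments gives the bound for the integral of
  \<open>(x \<bullet> \<theta>) ^ (2 * k)\<close> over \<open>K\<close> (\<open>even_part_moment_le\<close>, \<open>isotropic_unconditional_moment_le\<close>).
  Passing from Lebesgue measure on \<open>K\<close> to the cone measure multiplies the integral of a
  homogeneous function of degree \<open>p\<close> by \<open>1 + p / n\<close> (\<open>nn_integral_cone_homogeneous\<close>). At the scale
  \<open>3 * sqrt n * infnorm \<theta>\<close> the \<open>k\<close>-th term of the exponential series is then at most
  \<open>((2 * k) choose k) * (25 / 144) ^ k\<close>, and these numbers sum to at most 1 over \<open>k \<ge> 1\<close>.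
\<close>

section \<open>The Prekopa-Leindler inequality for decreasing functions\<close>

text \<open>
  On the half line a down-closed set is an interval starting at 0, so the one-dimensional
  Brunn-Minkowski inequality reduces to adding the lengths of two such intervals.
\<close>

lemma down_set_combination_real:
  fixes A B C :: "real set"
  assumes t: "0 < t" "t < 1"
    and A: "A \<subseteq> {0..R}" "0 \<in> A" "\<And>x y. y \<in> A \<Longrightarrow> 0 \<le> x \<Longrightarrow> x \<le> y \<Longrightarrow> x \<in> A"
    and B: "B \<subseteq> {0..R}" "0 \<in> B" "\<And>x y. y \<in> B \<Longrightarrow> 0 \<le> x \<Longrightarrow> x \<le> y \<Longrightarrow> x \<in> B"
    and C: "C \<in> sets borel" "\<And>x y. x \<in> A \<Longrightarrow> y \<in> B \<Longrightarrow> (1 - t) * x + t * y \<in> C"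
  shows "ennreal (1 - t) * emeasure lborel A + ennreal t * emeasure lborel B \<le> emeasure lborel C"
proof -
  have bdd: "bdd_above A" "bdd_above B"
    using A(1) B(1) by (meson bdd_above_Icc bdd_above_mono)+
  define p where "p = Sup A"
  define q where "q = Sup B"
  have Ap: "A \<subseteq> {0..p}" and Bq: "B \<subseteq> {0..q}"
    using A(1) B(1) cSup_upper[OF _ bdd(1)] cSup_upper[OF _ bdd(2)] by (auto simp: p_def q_def)
  have p0: "0 \<le> p" "0 \<le> q" using A(2) B(2) Ap Bq by auto
  have Alt: "x \<in> A" if x: "0 \<le> x" "x < p \<or> x = 0" for x
  proof (cases "x = 0")
    case False
    then obtain a where "a \<in> A" "x < a"
      using x False less_cSupE[of x A] A(2) unfolding p_def by blast
    then show ?thesis using A(3)[of a x] x by auto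
  qed (use A in auto)
  have Blt: "x \<in> B" if x: "0 \<le> x" "x < q \<or> x = 0" for x
  proof (cases "x = 0")
    case False
    then obtain a where "a \<in> B" "x < a"
      using x False less_cSupE[of x B] B(2) unfolding q_def by blast
    then show ?thesis using B(3)[of a x] x by auto
  qed (use B in auto)
  define r where "r = (1 - t) * p + t * q"
  have r0: "0 \<le> r" using p0 t by (simp add: r_def)
  have sub: "{0..<r} \<subseteq> C"
  proof
    fix z assume z: "z \<in> {0..<r}"
    then have rp: "0 < r" "0 \<le> z" "z < r" by auto
    have "z * u / r < u \<or> z * u / r = 0" if "0 \<le> u" for u
      using rp that mult_strict_right_mono[of z r u]
      by (cases "u = 0") (simp_all add: pos_divide_less_eq mult.commute)
    note this[OF p0(1)] this[OF p0(2)]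
    then have "z * p / r \<in> A" "z * q / r \<in> B"
      using Alt Blt rp p0 by auto
    then have "(1 - t) * (z * p / r) + t * (z * q / r) \<in> C" by (rule C(2))
    moreover have "(1 - t) * (z * p / r) + t * (z * q / r) = z * ((1 - t) * p + t * q) / r"
      by (simp add: field_simps add_divide_distrib diff_divide_distrib)
    then have "(1 - t) * (z * p / r) + t * (z * q / r) = z"
      using rp by (simp add: r_def[symmetric])
    ultimately show "z \<in> C" by simp
  qed
  have "emeasure lborel A \<le> ennreal p" "emeasure lborel B \<le> ennreal q"
    using emeasure_mono[OF Ap, of lborel] emeasure_mono[OF Bq, of lborel] p0 by auto
  then have "ennreal (1 - t) * emeasure lborel A + ennreal t * emeasure lborel B
      \<le> ennreal (1 - t) * ennreal p + ennreal t * ennreal q"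
    by (intro add_mono mult_left_mono) auto
  also have "\<dots> = ennreal r"
    using t p0 by (simp add: r_def ennreal_mult' ennreal_plus)
  also have "\<dots> = emeasure lborel {0..<r}" using r0 by simp
  also have "\<dots> \<le> emeasure lborel C" using sub C(1) by (intro emeasure_mono) auto
  finally show ?thesis .
qed

text \<open>
  The two layer-cake statements are matched to their use below: exact for a function with values
  in \<open>[0, 1]\<close>, and only a lower bound, with closed level sets, for an extended-valued function
  that may exceed 1.
\<close>

lemma nn_integral_layer_cake_01:
  fixes f :: "real \<Rightarrow> real"
  assumes [measurable]: "f \<in> borel_measurable borel" and f: "\<And>x. 0 \<le> f x" "\<And>x. f x \<le> 1"
  shows "(\<integral>\<^sup>+x. ennreal (f x) \<partial>lborel)
     = (\<integral>\<^sup>+s. indicator {0<..<1} s * emeasure lborel {x. s < f x} \<partial>lborel)"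
proof -
  have 1: "(\<integral>\<^sup>+s. indicator {0<..<1} s * indicator {x. s < f x} x \<partial>lborel) = ennreal (f x)" for x
  proof -
    have "(\<integral>\<^sup>+s. indicator {0<..<1} s * indicator {x. s < f x} x \<partial>lborel)
      = (\<integral>\<^sup>+s. indicator {0<..<f x} s \<partial>lborel)"
      using f(2)[of x] by (intro nn_integral_cong) (auto split: split_indicator)
    then show ?thesis using f(1)[of x] by simp
  qed
  have "(\<integral>\<^sup>+x. ennreal (f x) \<partial>lborel)
     = (\<integral>\<^sup>+x. (\<integral>\<^sup>+s. indicator {0<..<1} s * indicator {x. s < f x} x \<partial>lborel) \<partial>lborel)"
    by (simp add: 1)
  also have "\<dots> = (\<integral>\<^sup>+s. (\<integral>\<^sup>+x. indicator {0<..<1} s * indicator {x. s < f x} x \<partial>lborel) \<partial>lborel)"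
    by (rule lborel_pair.Fubini') simp
  also have "\<dots> = (\<integral>\<^sup>+s. indicator {0<..<1} s * emeasure lborel {x. s < f x} \<partial>lborel)"
    by (intro nn_integral_cong) (simp add: nn_integral_cmult)
  finally show ?thesis .
qed

lemma layer_cake_01_le_nn_integral:
  fixes h :: "real \<Rightarrow> ennreal"
  assumes [measurable]: "h \<in> borel_measurable borel"
  shows "(\<integral>\<^sup>+s. indicator {0<..<1} s * emeasure lborel {x. ennreal s \<le> h x} \<partial>lborel)
     \<le> (\<integral>\<^sup>+x. h x \<partial>lborel)"
proof -
  have 1: "(\<integral>\<^sup>+s. indicator {0<..<1} s * indicator {x. ennreal s \<le> h x} x \<partial>lborel) \<le> h x" for x
  proof (cases "h x")
    case (real r)
    have "(\<integral>\<^sup>+s. indicator {0<..<1} s * indicator {x. ennreal s \<le> h x} x \<partial>lborel)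
      \<le> (\<integral>\<^sup>+s. indicator {0..r} s \<partial>lborel)"
      using real by (intro nn_integral_mono) (auto split: split_indicator)
    then show ?thesis using real by simp
  qed simp
  have "(\<integral>\<^sup>+s. indicator {0<..<1} s * emeasure lborel {x. ennreal s \<le> h x} \<partial>lborel)
     = (\<integral>\<^sup>+s. (\<integral>\<^sup>+x. indicator {0<..<1} s * indicator {x. ennreal s \<le> h x} x \<partial>lborel) \<partial>lborel)"
    by (intro nn_integral_cong) (simp add: nn_integral_cmult)
  also have "\<dots> = (\<integral>\<^sup>+x. (\<integral>\<^sup>+s. indicator {0<..<1} s * indicator {x. ennreal s \<le> h x} x \<partial>lborel) \<partial>lborel)"
    by (rule lborel_pair.Fubini') simp
  also have "\<dots> \<le> (\<integral>\<^sup>+x. h x \<partial>lborel)" by (intro nn_integral_mono 1)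
  finally show ?thesis .
qed

lemma weighted_am_gm:
  fixes u v t :: real
  assumes "0 < t" "t < 1" "0 \<le> u" "0 \<le> v"
  shows "u powr (1 - t) * v powr t \<le> (1 - t) * u + t * v"
  using Youngs_inequality_0[of "1 - t" t u v] assms by (cases "u = 0 \<or> v = 0") auto

text \<open>
  After dividing \<open>f\<close> and \<open>g\<close> by their maxima, which they attain at 0, both have nonempty level
  sets at exactly the heights in \<open>(0, 1)\<close>. At such a height the level sets obey the
  one-dimensional Brunn-Minkowski inequality; integrating over the heights gives an arithmetic
  mean of the two integrals, which dominates the geometric mean.
\<close>

lemma prekopa_leindler_real:
  fixes f g :: "real \<Rightarrow> real" and h :: "real \<Rightarrow> ennreal"
  assumes t: "0 < t" "t < 1"
    and [measurable]: "f \<in> borel_measurable borel" "g \<in> borel_measurable borel" "h \<in> borel_measurable borel"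
    and f: "\<And>x. 0 \<le> f x" "\<And>x. x \<notin> {0..R} \<Longrightarrow> f x = 0" "\<And>x y. 0 \<le> x \<Longrightarrow> x \<le> y \<Longrightarrow> f y \<le> f x"
    and g: "\<And>x. 0 \<le> g x" "\<And>x. x \<notin> {0..R} \<Longrightarrow> g x = 0" "\<And>x y. 0 \<le> x \<Longrightarrow> x \<le> y \<Longrightarrow> g y \<le> g x"
    and h: "\<And>x y. 0 \<le> x \<Longrightarrow> 0 \<le> y \<Longrightarrow> ennreal (f x powr (1 - t) * g y powr t) \<le> h ((1 - t) * x + t * y)"
    and a: "0 \<le> a" "(\<integral>\<^sup>+x. ennreal (f x) \<partial>lborel) = ennreal a"
    and b: "0 \<le> b" "(\<integral>\<^sup>+x. ennreal (g x) \<partial>lborel) = ennreal b"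
  shows "ennreal (a powr (1 - t) * b powr t) \<le> (\<integral>\<^sup>+x. h x \<partial>lborel)"
proof -
  have fle: "f x \<le> f 0" for x using f(1)[of 0] f(2)[of x] f(3)[of 0 x] by (cases "x \<in> {0..R}") auto
  have gle: "g x \<le> g 0" for x using g(1)[of 0] g(2)[of x] g(3)[of 0 x] by (cases "x \<in> {0..R}") auto
  show ?thesis
  proof (cases "f 0 = 0 \<or> g 0 = 0")
    case True
    then have "(\<forall>x. f x = 0) \<or> (\<forall>x. g x = 0)"
      using fle gle f(1) g(1) by (metis order_antisym)
    then have "a = 0 \<or> b = 0" using a b by auto
    then show ?thesis by auto
  next
    case False
    then have f0: "0 < f 0" and g0: "0 < g 0" using f(1)[of 0] g(1)[of 0] by auto
    \<comment> \<open>The height of the geometric mean of \<open>f\<close> and \<open>g\<close> at the origin; after division by it, the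
      relevant levels of \<open>h\<close> are those below 1.\<close>
    define m where "m = f 0 powr (1 - t) * g 0 powr t"
    have m: "0 < m" using f0 g0 by (simp add: m_def)
    define f1 where "f1 x = f x / f 0" for x
    define g1 where "g1 x = g x / g 0" for x
    define h1 where "h1 x = h x * ennreal (1 / m)" for x
    have [measurable]: "f1 \<in> borel_measurable borel" "g1 \<in> borel_measurable borel" "h1 \<in>
        borel_measurable borel"
      unfolding f1_def g1_def h1_def by measurable
    have If: "(\<integral>\<^sup>+x. ennreal (f1 x) \<partial>lborel) = ennreal (a / f 0)"
    proof -
      have "(\<integral>\<^sup>+x. ennreal (f1 x) \<partial>lborel) = (\<integral>\<^sup>+x. ennreal (f x) * ennreal (1 / f 0) \<partial>lborel)"
        using f f0 by (intro nn_integral_cong) (simp add: f1_def ennreal_mult'[symmetric])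
      then show ?thesis using a f0 by (simp add: nn_integral_multc ennreal_mult'[symmetric])
    qed
    have Ig: "(\<integral>\<^sup>+x. ennreal (g1 x) \<partial>lborel) = ennreal (b / g 0)"
    proof -
      have "(\<integral>\<^sup>+x. ennreal (g1 x) \<partial>lborel) = (\<integral>\<^sup>+x. ennreal (g x) * ennreal (1 / g 0) \<partial>lborel)"
        using g g0 by (intro nn_integral_cong) (simp add: g1_def ennreal_mult'[symmetric])
      then show ?thesis using b g0 by (simp add: nn_integral_multc ennreal_mult'[symmetric])
    qed
    have lev: "ennreal (1 - t) * emeasure lborel {x. s < f1 x} + ennreal t * emeasure lborel {x. s < g1 x}
        \<le> emeasure lborel {x. ennreal s \<le> h1 x}" if s: "0 < s" "s < 1" for s
    proof (rule down_set_combination_real[OF t, where R = R])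
      show "{x. s < f1 x} \<subseteq> {0..R}"
        using s f(2) by (fastforce simp: f1_def)
      show "{x. s < g1 x} \<subseteq> {0..R}"
        using s g(2) by (fastforce simp: g1_def)
      show "0 \<in> {x. s < f1 x}" "0 \<in> {x. s < g1 x}" using s f0 g0 by (auto simp: f1_def g1_def)
      show "x \<in> {x. s < f1 x}" if "y \<in> {x. s < f1 x}" "0 \<le> x" "x \<le> y" for x y
        using that f(3)[of x y] f0 by (auto simp: f1_def field_simps)
      show "x \<in> {x. s < g1 x}" if "y \<in> {x. s < g1 x}" "0 \<le> x" "x \<le> y" for x y
        using that g(3)[of x y] g0 by (auto simp: g1_def field_simps)
      show "{x. ennreal s \<le> h1 x} \<in> sets borel" by measurable
      fix x y assume "x \<in> {x. s < f1 x}" "y \<in> {x. s < g1 x}"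
      then have xy: "s < f1 x" "s < g1 y" by auto
      have "f x \<noteq> 0" "g y \<noteq> 0" using xy s by (auto simp: f1_def g1_def)
      then have "x \<in> {0..R}" "y \<in> {0..R}" using f(2) g(2) by blast+
      then have h': "ennreal (f x powr (1 - t) * g y powr t) \<le> h ((1 - t) * x + t * y)"
        by (intro h) auto
      have "s = s powr (1 - t) * s powr t" using s by (simp add: powr_add[symmetric])
      also have "\<dots> \<le> f1 x powr (1 - t) * g1 y powr t"
        using xy s t by (intro mult_mono powr_mono2) auto
      also have "\<dots> = f x powr (1 - t) * g y powr t * (1 / m)"
        using f(1)[of x] g(1)[of y] f0 g0 by (simp add: f1_def g1_def m_def powr_divide)
      finally have "ennreal s \<le> ennreal (f x powr (1 - t) * g y powr t) * ennreal (1 / m)"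
        using m by (simp add: ennreal_mult'[symmetric] ennreal_leI)
      also have "\<dots> \<le> h1 ((1 - t) * x + t * y)"
        unfolding h1_def by (intro mult_right_mono h') auto
      finally show "(1 - t) * x + t * y \<in> {x. ennreal s \<le> h1 x}" by simp
    qed
    have "ennreal ((1 - t) * (a / f 0) + t * (b / g 0))
        = ennreal (1 - t) * ennreal (a / f 0) + ennreal t * ennreal (b / g 0)"
      using a b f0 g0 t by (simp add: ennreal_mult'[symmetric] ennreal_plus[symmetric] del: ennreal_plus)
    also have "\<dots> = (\<integral>\<^sup>+s. indicator {0<..<1} s * (ennreal (1 - t) * emeasure lborel {x. s < f1 x}
          + ennreal t * emeasure lborel {x. s < g1 x}) \<partial>lborel)"
    proof -
      have [measurable]: "(\<lambda>s. emeasure lborel {x. s < f1 x}) \<in> borel_measurable borel"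
        "(\<lambda>s. emeasure lborel {x. s < g1 x}) \<in> borel_measurable borel"
        by measurable
      have "(\<integral>\<^sup>+s. indicator {0<..<1} s * (ennreal (1 - t) * emeasure lborel {x. s < f1 x}
          + ennreal t * emeasure lborel {x. s < g1 x}) \<partial>lborel)
        = (\<integral>\<^sup>+s. ennreal (1 - t) * (indicator {0<..<1} s * emeasure lborel {x. s < f1 x})
          + ennreal t * (indicator {0<..<1} s * emeasure lborel {x. s < g1 x}) \<partial>lborel)"
        by (intro nn_integral_cong) (simp add: algebra_simps)
      also have "\<dots> = ennreal (1 - t) * (\<integral>\<^sup>+s. indicator {0<..<1} s * emeasure lborel {x. s < f1 x} \<partial>lborel)
          + ennreal t * (\<integral>\<^sup>+s. indicator {0<..<1} s * emeasure lborel {x. s < g1 x} \<partial>lborel)"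
        by (simp add: nn_integral_add nn_integral_cmult)
      also have "(\<integral>\<^sup>+s. indicator {0<..<1} s * emeasure lborel {x. s < f1 x} \<partial>lborel) = ennreal (a / f 0)"
        using f(1) f0 fle by (subst nn_integral_layer_cake_01[symmetric]) (auto simp: If, auto simp: f1_def)
      also have "(\<integral>\<^sup>+s. indicator {0<..<1} s * emeasure lborel {x. s < g1 x} \<partial>lborel) = ennreal (b / g 0)"
        using g(1) g0 gle by (subst nn_integral_layer_cake_01[symmetric]) (auto simp: Ig, auto simp: g1_def)
      finally show ?thesis ..
    qed
    also have "\<dots> \<le> (\<integral>\<^sup>+s. indicator {0<..<1} s * emeasure lborel {x. ennreal s \<le> h1 x} \<partial>lborel)"
      using lev by (intro nn_integral_mono) (auto split: split_indicator)
    also have "\<dots> \<le> (\<integral>\<^sup>+x. h1 x \<partial>lborel)" by (rule layer_cake_01_le_nn_integral) simp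
    also have "\<dots> = (\<integral>\<^sup>+x. h x \<partial>lborel) * ennreal (1 / m)"
      unfolding h1_def by (rule nn_integral_multc) simp
    finally have key: "ennreal ((1 - t) * (a / f 0) + t * (b / g 0)) \<le> (\<integral>\<^sup>+x. h x \<partial>lborel) * ennreal
        (1 / m)" .
    have "ennreal (a powr (1 - t) * b powr t)
        = ennreal m * ennreal ((a / f 0) powr (1 - t) * (b / g 0) powr t)"
      using a b f0 g0 m by (simp add: m_def powr_divide ennreal_mult'[symmetric])
    also have "\<dots> \<le> ennreal m * ennreal ((1 - t) * (a / f 0) + t * (b / g 0))"
      using a b f0 g0 t by (intro mult_left_mono ennreal_leI weighted_am_gm) auto
    also have "\<dots> \<le> ennreal m * ((\<integral>\<^sup>+x. h x \<partial>lborel) * ennreal (1 / m))"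
      by (intro mult_left_mono key) simp
    also have "\<dots> = (ennreal m * ennreal (1 / m)) * (\<integral>\<^sup>+x. h x \<partial>lborel)" by (simp only: ac_simps)
    also have "ennreal m * ennreal (1 / m) = 1" using m by (simp add: ennreal_mult'[symmetric])
    finally show ?thesis by simp
  qed
qed

text \<open>
  The class is closed under taking sections and under integrating out a coordinate, which is what
  the induction on the index set needs. The support in a fixed cube keeps all section integrals
  finite.
\<close>

definition corner_function :: "'i set \<Rightarrow> real \<Rightarrow> (('i \<Rightarrow> real) \<Rightarrow> real) \<Rightarrow> bool" where
  "corner_function I R f \<longleftrightarrow>
     f \<in> borel_measurable (Pi\<^sub>M I (\<lambda>_. lborel)) \<and>
     (\<forall>x\<in>extensional I. 0 \<le> f x \<and> (f x \<noteq> 0 \<longrightarrow> (\<forall>i\<in>I. x i \<in> {0..R}))) \<and>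
     (\<forall>x\<in>extensional I. \<forall>y\<in>extensional I. (\<forall>i\<in>I. 0 \<le> x i \<and> x i \<le> y i) \<longrightarrow> f y \<le> f x)"

lemma corner_function_section:
  assumes "corner_function (insert i I) R f" "i \<notin> I" "0 \<le> s"
  shows "corner_function I R (\<lambda>x. f (x(i := s)))"
proof -
  have [measurable]: "f \<in> borel_measurable (Pi\<^sub>M (insert i I) (\<lambda>_. lborel))"
    using assms by (simp add: corner_function_def)
  have ext: "x(i := s) \<in> extensional (insert i I)" if "x \<in> extensional I" for x
    using that by (auto simp: extensional_def)
  have "(\<lambda>x. f (x(i := s))) \<in> borel_measurable (Pi\<^sub>M I (\<lambda>_. lborel))"
    by measurable
  moreover have "0 \<le> f (x(i := s)) \<and> (f (x(i := s)) \<noteq> 0 \<longrightarrow> (\<forall>j\<in>I. x j \<in> {0..R}))"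
    if "x \<in> extensional I" for x
  proof -
    have *: "0 \<le> f (x(i := s)) \<and> (f (x(i := s)) \<noteq> 0 \<longrightarrow> (\<forall>j\<in>insert i I. (x(i := s)) j \<in> {0..R}))"
      using assms(1) ext[OF that] unfolding corner_function_def by blast
    have "x j \<in> {0..R}" if "f (x(i := s)) \<noteq> 0" "j \<in> I" for j
    proof -
      have "(x(i := s)) j \<in> {0..R}" using * that by blast
      moreover have "(x(i := s)) j = x j" using that assms(2) by auto
      ultimately show ?thesis by simp
    qed
    then show ?thesis using * by blast
  qed
  moreover have "f (y(i := s)) \<le> f (x(i := s))"
    if "x \<in> extensional I" "y \<in> extensional I" "\<forall>j\<in>I. 0 \<le> x j \<and> x j \<le> y j" for x y
  proof -
    have "\<forall>j\<in>insert i I. 0 \<le> (x(i := s)) j \<and> (x(i := s)) j \<le> (y(i := s)) j"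
      using that assms by auto
    then show ?thesis
      using assms(1) ext that(1,2) unfolding corner_function_def by blast
  qed
  ultimately show ?thesis unfolding corner_function_def by blast
qed

interpretation lborel_product: product_sigma_finite "\<lambda>_::'i. lborel :: real measure"
  by standard

lemma corner_function_integral_finite:
  assumes "corner_function I R f" "finite I"
  shows "(\<integral>\<^sup>+x. ennreal (f x) \<partial>Pi\<^sub>M I (\<lambda>_. lborel)) < \<infinity>"
proof -
  define z where "z = (\<lambda>i\<in>I. 0::real)"
  have "(\<integral>\<^sup>+x. ennreal (f x) \<partial>Pi\<^sub>M I (\<lambda>_. lborel))
      \<le> (\<integral>\<^sup>+x. ennreal (f z) * (\<Prod>i\<in>I. indicator {0..R} (x i)) \<partial>Pi\<^sub>M I (\<lambda>_. lborel))"
  proof (intro nn_integral_mono)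
    fix x assume "x \<in> space (Pi\<^sub>M I (\<lambda>_. lborel::real measure))"
    then have x: "x \<in> extensional I" by (simp add: space_PiM PiE_def)
    have z: "z \<in> extensional I" by (simp add: z_def)
    show "ennreal (f x) \<le> ennreal (f z) * (\<Prod>i\<in>I. indicator {0..R} (x i))"
    proof (cases "f x = 0")
      case False
      then have *: "\<forall>i\<in>I. x i \<in> {0..R}" using assms(1) x unfolding corner_function_def by blast
      then have "\<forall>i\<in>I. 0 \<le> z i \<and> z i \<le> x i" by (auto simp: z_def)
      then have "f x \<le> f z" using assms(1) x z unfolding corner_function_def by blast
      moreover have "(\<Prod>i\<in>I. indicator {0..R} (x i)) = (1::ennreal)"
        using * by (intro prod.neutral) (auto simp: indicator_def)
      ultimately show ?thesis by (simp add: ennreal_leI)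
    qed simp
  qed
  also have "\<dots> = ennreal (f z) * (\<integral>\<^sup>+x. (\<Prod>i\<in>I. indicator {0..R} (x i)) \<partial>Pi\<^sub>M I (\<lambda>_. lborel))"
    by (rule nn_integral_cmult) measurable
  also have "(\<integral>\<^sup>+x. (\<Prod>i\<in>I. indicator {0..R} (x i)) \<partial>Pi\<^sub>M I (\<lambda>_. lborel))
      = (\<Prod>i\<in>I. \<integral>\<^sup>+x. indicator {0..R} x \<partial>lborel)"
    using assms(2) by (intro lborel_product.product_nn_integral_prod) auto
  also have "ennreal (f z) * \<dots> < \<infinity>"
    by (simp add: ennreal_mult_less_top power_less_top_ennreal emeasure_lborel_Icc_eq)
  finally show ?thesis .
qed

text \<open>
  Induction on the index set. The section integrals in the new coordinate are decreasing functions
  on the half line, and by the induction hypothesis they satisfy the hypothesis of the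
  one-dimensional inequality.
\<close>

theorem prekopa_leindler_corner:
  assumes "finite I" and t: "0 < t" "t < 1"
    and "corner_function I R f" "corner_function I R g"
    and "h \<in> borel_measurable (Pi\<^sub>M I (\<lambda>_. lborel))"
    and "\<And>x y. x \<in> extensional I \<Longrightarrow> y \<in> extensional I \<Longrightarrow> (\<And>i. i \<in> I \<Longrightarrow> 0 \<le> x i \<and> 0 \<le> y i) \<Longrightarrow>
       ennreal (f x powr (1 - t) * g y powr t) \<le> h (\<lambda>i\<in>I. (1 - t) * x i + t * y i)"
    and "0 \<le> a" "(\<integral>\<^sup>+x. ennreal (f x) \<partial>Pi\<^sub>M I (\<lambda>_. lborel)) = ennreal a"
    and "0 \<le> b" "(\<integral>\<^sup>+x. ennreal (g x) \<partial>Pi\<^sub>M I (\<lambda>_. lborel)) = ennreal b"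
  shows "ennreal (a powr (1 - t) * b powr t) \<le> (\<integral>\<^sup>+x. h x \<partial>Pi\<^sub>M I (\<lambda>_. lborel))"
  using assms(1,4-)
proof (induction I arbitrary: f g h a b rule: finite_induct)
  case empty
  let ?u = "\<lambda>_. undefined"
  have u: "?u \<in> extensional {}" by simp
  have "0 \<le> f ?u" "0 \<le> g ?u"
    using empty(1,2) u unfolding corner_function_def by blast+
  then have "a = f ?u" "b = g ?u"
    using empty by (simp_all add: PiM_empty nn_integral_count_space_finite)
  then show ?case using empty(4)[OF u u] by (simp add: PiM_empty nn_integral_count_space_finite
      restrict_def)
next
  case (insert i I)
  note i = insert.hyps
  note cf = insert.prems(1) and cg = insert.prems(2)
  have [measurable]: "f \<in> borel_measurable (Pi\<^sub>M (insert i I) (\<lambda>_. lborel))"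
     "g \<in> borel_measurable (Pi\<^sub>M (insert i I) (\<lambda>_. lborel))"
     "h \<in> borel_measurable (Pi\<^sub>M (insert i I) (\<lambda>_. lborel))"
    using insert.prems(1-3) by (simp_all add: corner_function_def)
  interpret PI: sigma_finite_measure "Pi\<^sub>M I (\<lambda>_. lborel :: real measure)"
    by (rule lborel_product.sigma_finite[OF i(1)])
  define F where "F f s = enn2real (\<integral>\<^sup>+x. ennreal (f (x(i := s))) \<partial>Pi\<^sub>M I (\<lambda>_. lborel))"
    for f :: "('a \<Rightarrow> real) \<Rightarrow> real" and s
  have F_meas: "F f \<in> borel_measurable borel"
    if [measurable]: "f \<in> borel_measurable (Pi\<^sub>M (insert i I) (\<lambda>_. lborel))" for f
    unfolding F_def by measurable
  have zero: "f (x(i := s)) = 0"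
    if "corner_function (insert i I) R f" "x \<in> extensional I" "s \<notin> {0..R}" for f x s
  proof -
    have "x(i := s) \<in> extensional (insert i I)" using that by (auto simp: extensional_def)
    then have "f (x(i := s)) \<noteq> 0 \<longrightarrow> (\<forall>j\<in>insert i I. (x(i := s)) j \<in> {0..R})"
      using that(1) unfolding corner_function_def by blast
    then show ?thesis using that(3) by fastforce
  qed
  have ext: "x \<in> space (Pi\<^sub>M I (\<lambda>_. lborel :: real measure)) \<longleftrightarrow> x \<in> extensional I" for x
    by (simp add: space_PiM PiE_def)
  have F_zero: "F f s = 0" and eF_zero: "(\<integral>\<^sup>+x. ennreal (f (x(i := s))) \<partial>Pi\<^sub>M I (\<lambda>_. lborel)) = 0"
    if "corner_function (insert i I) R f" "s \<notin> {0..R}" for f s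
  proof -
    have "(\<integral>\<^sup>+x. ennreal (f (x(i := s))) \<partial>Pi\<^sub>M I (\<lambda>_. lborel))
        = (\<integral>\<^sup>+x. 0 \<partial>Pi\<^sub>M I (\<lambda>_. lborel :: real measure))"
      by (rule nn_integral_cong) (use zero[OF that(1) _ that(2)] ext in auto)
    then show "(\<integral>\<^sup>+x. ennreal (f (x(i := s))) \<partial>Pi\<^sub>M I (\<lambda>_. lborel)) = 0" "F f s = 0"
      by (simp_all add: F_def)
  qed
  have F_eq: "(\<integral>\<^sup>+x. ennreal (f (x(i := s))) \<partial>Pi\<^sub>M I (\<lambda>_. lborel)) = ennreal (F f s)"
    if "corner_function (insert i I) R f" for f s
  proof (cases "s \<in> {0..R}")
    case True
    then have "corner_function I R (\<lambda>x. f (x(i := s)))"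
      using corner_function_section[OF that i(2)] by simp
    from corner_function_integral_finite[OF this i(1)] show ?thesis by (simp add: F_def)
  qed (simp add: F_zero eF_zero that)
  have F_mono: "F f s' \<le> F f s" if f: "corner_function (insert i I) R f" "0 \<le> s" "s \<le> s'" for f s s'
  proof -
    have "(\<integral>\<^sup>+x. ennreal (f (x(i := s'))) \<partial>Pi\<^sub>M I (\<lambda>_. lborel))
       \<le> (\<integral>\<^sup>+x. ennreal (f (x(i := s))) \<partial>Pi\<^sub>M I (\<lambda>_. lborel))"
    proof (intro nn_integral_mono ennreal_leI)
      fix x assume "x \<in> space (Pi\<^sub>M I (\<lambda>_. lborel :: real measure))"
      then have e: "x(i := r) \<in> extensional (insert i I)" for r
        unfolding ext by (auto simp: extensional_def)
      show "f (x(i := s')) \<le> f (x(i := s))"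
      proof (cases "f (x(i := s')) = 0")
        case True then show ?thesis using f(1) e unfolding corner_function_def by metis
      next
        case False
        then have "\<forall>j\<in>insert i I. (x(i := s')) j \<in> {0..R}"
          using f(1) e unfolding corner_function_def by blast
        then have "\<forall>j\<in>insert i I. 0 \<le> (x(i := s)) j \<and> (x(i := s)) j \<le> (x(i := s')) j"
          using f(2,3) by fastforce
        then show ?thesis using f(1) e unfolding corner_function_def by blast
      qed
    qed
    then show ?thesis unfolding F_eq[OF f(1)]
      by (simp add: F_def)
  qed
  have Fint: "(\<integral>\<^sup>+s. ennreal (F f s) \<partial>lborel) = (\<integral>\<^sup>+x. ennreal (f x) \<partial>Pi\<^sub>M (insert i I) (\<lambda>_. lborel))"
    if f: "corner_function (insert i I) R f" for f
  proof -
    have [measurable]: "f \<in> borel_measurable (Pi\<^sub>M (insert i I) (\<lambda>_. lborel))"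
      using f by (simp add: corner_function_def)
    show ?thesis using i by (subst lborel_product.product_nn_integral_insert_rev) (auto simp: F_eq[OF f])
  qed
  have "ennreal (a powr (1 - t) * b powr t)
      \<le> (\<integral>\<^sup>+s. (\<integral>\<^sup>+x. h (x(i := s)) \<partial>Pi\<^sub>M I (\<lambda>_. lborel)) \<partial>lborel)"
  proof (rule prekopa_leindler_real[OF t, where f = "F f" and g = "F g" and R = R])
    show "F f \<in> borel_measurable borel" "F g \<in> borel_measurable borel" by (rule F_meas, simp)+
    show "(\<lambda>s. \<integral>\<^sup>+x. h (x(i := s)) \<partial>Pi\<^sub>M I (\<lambda>_. lborel)) \<in> borel_measurable borel"
      by measurable
    show "0 \<le> F f s" "0 \<le> F g s" for s by (simp_all add: F_def)
    show "F f s = 0" "F g s = 0" if "s \<notin> {0..R}" for s using F_zero cf cg that by blast+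
    show "F f s' \<le> F f s" "F g s' \<le> F g s" if "0 \<le> s" "s \<le> s'" for s s'
      using F_mono cf cg that by blast+
    show "(\<integral>\<^sup>+s. ennreal (F f s) \<partial>lborel) = ennreal a" "(\<integral>\<^sup>+s. ennreal (F g s) \<partial>lborel) = ennreal b"
      using Fint cf cg insert.prems by auto
    show "0 \<le> a" "0 \<le> b" using insert.prems by auto
    fix s s' :: real assume s: "0 \<le> s" "0 \<le> s'"
    show "ennreal (F f s powr (1 - t) * F g s' powr t)
        \<le> (\<integral>\<^sup>+x. h (x(i := (1 - t) * s + t * s')) \<partial>Pi\<^sub>M I (\<lambda>_. lborel))"
    proof (rule insert.IH[OF corner_function_section[OF cf i(2) s(1)] corner_function_section[OF cg
        i(2) s(2)]])
      show "(\<lambda>x. h (x(i := (1 - t) * s + t * s'))) \<in> borel_measurable (Pi\<^sub>M I (\<lambda>_. lborel))"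
        by measurable
      show "0 \<le> F f s" "0 \<le> F g s'" by (simp_all add: F_def)
      show "(\<integral>\<^sup>+x. ennreal (f (x(i := s))) \<partial>Pi\<^sub>M I (\<lambda>_. lborel)) = ennreal (F f s)"
        "(\<integral>\<^sup>+x. ennreal (g (x(i := s'))) \<partial>Pi\<^sub>M I (\<lambda>_. lborel)) = ennreal (F g s')"
        using F_eq cf cg by auto
      fix x y :: "'a \<Rightarrow> real"
      assume xy: "x \<in> extensional I" "y \<in> extensional I" "\<And>j. j \<in> I \<Longrightarrow> 0 \<le> x j \<and> 0 \<le> y j"
      have "ennreal (f (x(i := s)) powr (1 - t) * g (y(i := s')) powr t)
        \<le> h (\<lambda>j\<in>insert i I. (1 - t) * (x(i := s)) j + t * (y(i := s')) j)"
        using xy s by (intro insert.prems(4)) (auto simp: extensional_def)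
      also have "(\<lambda>j\<in>insert i I. (1 - t) * (x(i := s)) j + t * (y(i := s')) j)
        = (\<lambda>j\<in>I. (1 - t) * x j + t * y j)(i := (1 - t) * s + t * s')"
        using i by (auto simp: fun_eq_iff)
      finally show "ennreal (f (x(i := s)) powr (1 - t) * g (y(i := s')) powr t)
        \<le> h ((\<lambda>j\<in>I. (1 - t) * x j + t * y j)(i := (1 - t) * s + t * s'))" .
    qed
  qed
  also have "\<dots> = (\<integral>\<^sup>+x. h x \<partial>Pi\<^sub>M (insert i I) (\<lambda>_. lborel))"
    using i by (subst lborel_product.product_nn_integral_insert_rev) auto
  finally show ?case .
qed

section \<open>The Brunn-Minkowski inequality for down-sets\<close>

definition down_set :: "'a::euclidean_space set \<Rightarrow> bool" where
  "down_set A \<longleftrightarrow> A \<in> sets borel \<and> bounded A \<and> (\<forall>x\<in>A. \<forall>b\<in>Basis. 0 \<le> x \<bullet> b) \<and>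
     (\<forall>y\<in>A. \<forall>x. (\<forall>b\<in>Basis. 0 \<le> x \<bullet> b \<and> x \<bullet> b \<le> y \<bullet> b) \<longrightarrow> x \<in> A)"

lemma nn_integral_lborel_scaleR:
  fixes f :: "'a::euclidean_space \<Rightarrow> ennreal"
  assumes [measurable]: "f \<in> borel_measurable borel" and c: "0 < c"
  shows "(\<integral>\<^sup>+x. f x \<partial>lborel) = ennreal (c ^ DIM('a)) * (\<integral>\<^sup>+x. f (c *\<^sub>R x) \<partial>lborel)"
proof -
  have "(\<integral>\<^sup>+x. f x \<partial>lborel) = (\<integral>\<^sup>+x. f x \<partial>density (distr lborel borel (\<lambda>x. 0 + c *\<^sub>R x)) (\<lambda>_. ennreal
      (\<bar>c\<bar> ^ DIM('a))))"
    using lborel_affine[of c "0::'a"] c by simp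
  also have "\<dots> = (\<integral>\<^sup>+x. ennreal (c ^ DIM('a)) * f x \<partial>distr lborel borel (\<lambda>x. 0 + c *\<^sub>R x))"
    using c by (subst nn_integral_density) auto
  also have "\<dots> = (\<integral>\<^sup>+x. ennreal (c ^ DIM('a)) * f (c *\<^sub>R x) \<partial>lborel)"
    by (subst nn_integral_distr) auto
  also have "\<dots> = ennreal (c ^ DIM('a)) * (\<integral>\<^sup>+x. f (c *\<^sub>R x) \<partial>lborel)"
    by (rule nn_integral_cmult) measurable
  finally show ?thesis .
qed

lemma borel_scaleR_image:
  fixes A :: "'a::euclidean_space set"
  assumes [measurable]: "A \<in> sets borel" and c: "0 < c"
  shows "(*\<^sub>R) c ` A \<in> sets borel"
proof -
  have "(*\<^sub>R) c ` A = (\<lambda>x. (1 / c) *\<^sub>R x) -` A \<inter> space borel"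
    using c by (auto simp: image_iff intro!: bexI[of _ "(1 / c) *\<^sub>R _"])
  also have "\<dots> \<in> sets borel" by (rule measurable_sets[of _ borel borel]) auto
  finally show ?thesis .
qed

lemma emeasure_lborel_scaleR_image:
  fixes A :: "'a::euclidean_space set"
  assumes [measurable]: "A \<in> sets borel" and c: "0 < c"
  shows "emeasure lborel ((*\<^sub>R) c ` A) = ennreal (c ^ DIM('a)) * emeasure lborel A"
proof -
  have [measurable]: "(*\<^sub>R) c ` A \<in> sets borel" by (rule borel_scaleR_image[OF assms])
  have "emeasure lborel ((*\<^sub>R) c ` A) = (\<integral>\<^sup>+x. indicator ((*\<^sub>R) c ` A) x \<partial>lborel)" by simp
  also have "\<dots> = ennreal (c ^ DIM('a)) * (\<integral>\<^sup>+x. indicator ((*\<^sub>R) c ` A) (c *\<^sub>R x) \<partial>lborel)"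
    by (rule nn_integral_lborel_scaleR[OF _ c]) measurable
  also have "(\<lambda>x. indicator ((*\<^sub>R) c ` A) (c *\<^sub>R x)) = (indicator A :: 'a \<Rightarrow> ennreal)"
    using c by (auto simp: fun_eq_iff indicator_def image_iff)
  finally show ?thesis by simp
qed

lemma down_set_scaleR:
  assumes "down_set A" "0 < c"
  shows "down_set ((*\<^sub>R) c ` A)"
proof -
  have "x \<in> (*\<^sub>R) c ` A" if "y \<in> A" "\<forall>b\<in>Basis. 0 \<le> x \<bullet> b \<and> x \<bullet> b \<le> (c *\<^sub>R y) \<bullet> b" for x y
  proof -
    have "\<forall>b\<in>Basis. 0 \<le> ((1 / c) *\<^sub>R x) \<bullet> b \<and> ((1 / c) *\<^sub>R x) \<bullet> b \<le> y \<bullet> b"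
      using that(2) assms(2) by (auto simp: field_simps)
    then have "(1 / c) *\<^sub>R x \<in> A" using assms(1) that(1) unfolding down_set_def by blast
    moreover have "x = c *\<^sub>R ((1 / c) *\<^sub>R x)" using assms(2) by simp
    ultimately show ?thesis by blast
  qed
  moreover have "bounded ((*\<^sub>R) c ` A)" using assms by (intro bounded_scaling) (simp add: down_set_def)
  moreover have "(*\<^sub>R) c ` A \<in> sets borel" using assms
      by (intro borel_scaleR_image) (simp_all add: down_set_def)
  moreover have "\<forall>x\<in>(*\<^sub>R) c ` A. \<forall>b\<in>Basis. 0 \<le> x \<bullet> b"
    using assms by (simp add: down_set_def)
  ultimately show ?thesis unfolding down_set_def by blast
qed

text \<open>
  The multiplicative form of Brunn-Minkowski: Prekopa-Leindler for indicator functions,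
  transported along the identification of the space with the product of its coordinate lines.
\<close>

lemma down_set_emeasure_powr:
  fixes A B C :: "'a::euclidean_space set"
  assumes t: "0 < t" "t < 1" and A: "down_set A" and B: "down_set B" and C: "C \<in> sets borel"
    and sum: "\<And>x y. x \<in> A \<Longrightarrow> y \<in> B \<Longrightarrow> (1 - t) *\<^sub>R x + t *\<^sub>R y \<in> C"
    and a: "0 \<le> a" "emeasure lborel A = ennreal a"
    and b: "0 \<le> b" "emeasure lborel B = ennreal b"
  shows "ennreal (a powr (1 - t) * b powr t) \<le> emeasure lborel C"
proof -
  let ?v = "\<lambda>f. \<Sum>b\<in>Basis. f b *\<^sub>R b :: 'a"
  let ?P = "\<Pi>\<^sub>M b\<in>(Basis :: 'a set). (lborel :: real measure)"
  have [measurable]: "A \<in> sets borel" "B \<in> sets borel" "C \<in> sets borel"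
    using A B C by (auto simp: down_set_def)
  have vm [measurable]: "?v \<in> ?P \<rightarrow>\<^sub>M borel" by measurable
  have vol: "(\<integral>\<^sup>+x. indicator X (?v x) \<partial>?P) = emeasure lborel X" if [measurable]: "X \<in> sets borel" for X
  proof -
    have "emeasure lborel X = (\<integral>\<^sup>+x. indicator X x \<partial>lborel)" by simp
    also have "\<dots> = (\<integral>\<^sup>+x. indicator X x \<partial>distr ?P borel ?v)" by (simp only: lborel_eq[symmetric])
    also have "\<dots> = (\<integral>\<^sup>+x. indicator X (?v x) \<partial>?P)" by (rule nn_integral_distr) auto
    finally show ?thesis ..
  qed
  obtain R1 R2 where R12: "\<And>x. x \<in> A \<Longrightarrow> norm x \<le> R1" "\<And>x. x \<in> B \<Longrightarrow> norm x \<le> R2"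
    using A B unfolding down_set_def bounded_iff by metis
  define R where "R = max R1 R2"
  have cf: "corner_function Basis R (\<lambda>x. indicator X (?v x))"
    if X: "down_set X" "\<And>x. x \<in> X \<Longrightarrow> norm x \<le> R" for X
    unfolding corner_function_def
  proof (intro conjI ballI impI)
    have [measurable]: "X \<in> sets borel" using X by (simp add: down_set_def)
    show "(\<lambda>x. indicator X (?v x) :: real) \<in> borel_measurable ?P" by measurable
    fix x :: "'a \<Rightarrow> real"
    show "0 \<le> (indicator X (?v x) :: real)" by simp
    show "x b \<in> {0..R}" if "indicator X (?v x) \<noteq> (0::real)" "b \<in> Basis" for b
    proof -
      have v: "?v x \<in> X" using that by (auto simp: indicator_def split: if_splits)
      have "x b = ?v x \<bullet> b" using that by (simp add: inner_sum_left_Basis)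
      moreover have "0 \<le> ?v x \<bullet> b" using v X(1) that unfolding down_set_def by blast
      moreover have "?v x \<bullet> b \<le> R"
        using X(2)[OF v] Basis_le_norm[OF that(2), of "?v x"] by linarith
      ultimately show ?thesis by simp
    qed
    fix y :: "'a \<Rightarrow> real"
    assume "\<forall>b\<in>Basis. 0 \<le> x b \<and> x b \<le> y b"
    then have "\<forall>b\<in>Basis. 0 \<le> ?v x \<bullet> b \<and> ?v x \<bullet> b \<le> ?v y \<bullet> b"
      by (simp add: inner_sum_left_Basis)
    then have "?v y \<in> X \<Longrightarrow> ?v x \<in> X" using X(1) unfolding down_set_def by blast
    then show "(indicator X (?v y) :: real) \<le> indicator X (?v x)" by (auto simp: indicator_def)
  qed
  have en: "(\<integral>\<^sup>+x. ennreal (indicator X (?v x)) \<partial>?P) = emeasure lborel X" if "X \<in> sets borel" for X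
    using vol[OF that] by (simp add: ennreal_indicator)
  have "ennreal (a powr (1 - t) * b powr t) \<le> (\<integral>\<^sup>+x. indicator C (?v x) \<partial>?P)"
  proof (rule prekopa_leindler_corner[OF finite_Basis t cf[OF A] cf[OF B] _ _ a(1) _ b(1)])
    show "norm x \<le> R" if "x \<in> A" for x using R12(1)[OF that] by (simp add: R_def)
    show "norm x \<le> R" if "x \<in> B" for x using R12(2)[OF that] by (simp add: R_def)
    show "(\<lambda>x. indicator C (?v x) :: ennreal) \<in> borel_measurable ?P" by measurable
    show "(\<integral>\<^sup>+x. ennreal (indicator A (?v x)) \<partial>?P) = ennreal a"
      "(\<integral>\<^sup>+x. ennreal (indicator B (?v x)) \<partial>?P) = ennreal b" using a b by (auto simp: en)
    fix x y :: "'a \<Rightarrow> real"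
    have "?v (\<lambda>i\<in>Basis. (1 - t) * x i + t * y i) = (1 - t) *\<^sub>R ?v x + t *\<^sub>R ?v y"
      by (simp add: scaleR_sum_right scaleR_left_distrib sum.distrib)
    then show "ennreal (indicator A (?v x) powr (1 - t) * indicator B (?v y) powr t)
        \<le> indicator C (?v (\<lambda>i\<in>Basis. (1 - t) * x i + t * y i))"
      using sum[of "?v x" "?v y"] by (auto simp: indicator_def)
  qed
  then show ?thesis by (simp add: vol)
qed

text \<open>
  The exponent \<open>1/n\<close> comes from homogeneity: the multiplicative form is applied to the copies of
  \<open>A\<close> and \<open>B\<close> scaled to volume 1, with the weight adjusted to the scaling.
\<close>

theorem brunn_minkowski_down_set:
  fixes A B C :: "'a::euclidean_space set"
  assumes t: "0 < t" "t < 1" and A: "down_set A" and B: "down_set B" and C: "C \<in> sets borel"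
    and sum: "\<And>x y. x \<in> A \<Longrightarrow> y \<in> B \<Longrightarrow> (1 - t) *\<^sub>R x + t *\<^sub>R y \<in> C"
    and a: "0 < a" "emeasure lborel A = ennreal (a ^ DIM('a))"
    and b: "0 < b" "emeasure lborel B = ennreal (b ^ DIM('a))"
  shows "ennreal (((1 - t) * a + t * b) ^ DIM('a)) \<le> emeasure lborel C"
proof -
  define r where "r = (1 - t) * a + t * b"
  have r: "0 < r" using a b t by (simp add: r_def add_pos_pos)
  \<comment> \<open>The weight that turns the combination of the normalized sets into a multiple of the given
    combination.\<close>
  define s where "s = t * b / r"
  have s1: "1 - s = (1 - t) * a / r" using r by (simp add: s_def r_def field_simps)
  have s: "0 < s" "s < 1"
  proof -
    show "0 < s" using t b r by (simp add: s_def)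
    have "0 < 1 - s" unfolding s1 using t a r by simp
    then show "s < 1" by simp
  qed
  have Am: "A \<in> sets borel" "B \<in> sets borel" using A B by (auto simp: down_set_def)
  have "ennreal (1 powr (1 - s) * 1 powr s) \<le> emeasure lborel ((*\<^sub>R) (1 / r) ` C)"
  proof (rule down_set_emeasure_powr[OF s, of "(*\<^sub>R) (1 / a) ` A" "(*\<^sub>R) (1 / b) ` B"])
    show "down_set ((*\<^sub>R) (1 / a) ` A)" "down_set ((*\<^sub>R) (1 / b) ` B)"
      using A B a b by (auto intro!: down_set_scaleR)
    show "(*\<^sub>R) (1 / r) ` C \<in> sets borel" using C r by (intro borel_scaleR_image) auto
    show "emeasure lborel ((*\<^sub>R) (1 / a) ` A) = ennreal 1" "emeasure lborel ((*\<^sub>R) (1 / b) ` B) = ennreal 1"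
      using a b Am by (simp_all add: emeasure_lborel_scaleR_image ennreal_mult'[symmetric]
          power_mult_distrib[symmetric])
    fix x y assume "x \<in> (*\<^sub>R) (1 / a) ` A" "y \<in> (*\<^sub>R) (1 / b) ` B"
    then obtain x' y' where x': "x' \<in> A" "x = (1 / a) *\<^sub>R x'" and y': "y' \<in> B" "y = (1 / b) *\<^sub>R y'" by blast
    have "(1 - s) *\<^sub>R x + s *\<^sub>R y = (1 / r) *\<^sub>R ((1 - t) *\<^sub>R x' + t *\<^sub>R y')"
      using a b unfolding x' y' s1 by (simp add: s_def scaleR_right_distrib)
    then show "(1 - s) *\<^sub>R x + s *\<^sub>R y \<in> (*\<^sub>R) (1 / r) ` C" using sum[OF x'(1) y'(1)] by blast
  qed auto
  then have "1 \<le> ennreal ((1 / r) ^ DIM('a)) * emeasure lborel C"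
    using r C by (simp add: emeasure_lborel_scaleR_image)
  then have "ennreal (r ^ DIM('a)) * 1 \<le> ennreal (r ^ DIM('a)) * (ennreal ((1 / r) ^ DIM('a)) *
      emeasure lborel C)"
    by (rule mult_left_mono) simp
  also have "\<dots> = emeasure lborel C"
    using r by (simp add: mult.assoc[symmetric] ennreal_mult'[symmetric] power_mult_distrib[symmetric])
  finally show ?thesis by (simp add: r_def)
qed

section \<open>Tails and means of the uniform distribution on a convex corner\<close>

lemma borel_measurable_vec_nth' [measurable]: "(\<lambda>x::real^'n. x $ i) \<in> borel_measurable borel"
  by (intro borel_measurable_continuous_onI continuous_intros)

lemma borel_upper_orthant [measurable]: "{x::real^'n. \<forall>i. a $ i \<le> x $ i} \<in> sets borel"
  by (intro borel_closed closed_Collect_all closed_Collect_le continuous_intros)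

text \<open>
  A convex corner is what an unconditional convex body leaves in the nonnegative orthant.
\<close>

locale convex_corner =
  fixes D :: "(real ^ 'n) set"
  assumes compact: "compact D" and convex: "convex D"
    and nonneg: "x \<in> D \<Longrightarrow> 0 \<le> x $ i"
    and down: "y \<in> D \<Longrightarrow> (\<And>i. 0 \<le> x $ i \<and> x $ i \<le> y $ i) \<Longrightarrow> x \<in> D"
    and emeasure_nonzero: "emeasure lborel D \<noteq> 0"
begin

definition U :: "(real ^ 'n) measure" where "U = uniform_measure lborel D"

definition tail :: "real ^ 'n \<Rightarrow> real" where "tail a = measure U {x. \<forall>i. a $ i \<le> x $ i}"

lemma D_borel [measurable]: "D \<in> sets borel"
  using compact by (intro borel_compact)

lemma emeasure_D_finite: "emeasure lborel D < \<infinity>"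
  using compact by (rule emeasure_compact_finite)

sublocale prob_space U
  unfolding U_def using emeasure_nonzero emeasure_D_finite
  by (intro prob_space_uniform_measure) (auto simp: less_top)

lemma sets_U [simp, measurable_cong]: "sets U = sets borel"
  by (simp add: U_def)

lemma space_U [simp]: "space U = UNIV"
  by (simp add: U_def)

lemma AE_U: "AE x in U. x \<in> D"
  unfolding U_def by (rule AE_uniform_measureI) auto

lemma measure_pos: "0 < measure lborel D"
  using emeasure_nonzero emeasure_D_finite
  by (simp add: emeasure_eq_ennreal_measure less_top zero_less_measure_iff)

lemma emeasure_D: "emeasure lborel D = ennreal (measure lborel D)"
  using emeasure_D_finite by (simp add: emeasure_eq_ennreal_measure less_top)

lemma measure_U: "A \<in> sets borel \<Longrightarrow> measure U A = measure lborel (D \<inter> A) / measure lborel D"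
  unfolding U_def using emeasure_nonzero emeasure_D_finite
  by (subst measure_uniform_measure) (auto simp: less_top)

lemma emeasure_lborel_D_Int:
  "A \<in> sets borel \<Longrightarrow> emeasure lborel (D \<inter> A) = ennreal (measure U A * measure lborel D)"
proof -
  assume A: "A \<in> sets borel"
  have "emeasure lborel (D \<inter> A) \<le> emeasure lborel D" using A by (intro emeasure_mono) auto
  then have "emeasure lborel (D \<inter> A) < \<infinity>" using emeasure_D_finite by (rule le_less_trans)
  then show ?thesis using measure_pos A
    by (simp add: measure_U emeasure_eq_ennreal_measure less_top)
qed

lemma ball_Basis_vec: "(\<forall>b\<in>Basis. P (x \<bullet> b) (y \<bullet> b)) \<longleftrightarrow> (\<forall>i. P (x $ i) (y $ i))" for x y :: "real ^ 'n"
  by (auto simp: Basis_vec_def inner_axis)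

lemma down_setI:
  fixes A :: "(real ^ 'n) set"
  assumes "A \<in> sets borel" "bounded A" "\<And>x i. x \<in> A \<Longrightarrow> 0 \<le> x $ i"
    and "\<And>x y. y \<in> A \<Longrightarrow> (\<And>i. 0 \<le> x $ i \<and> x $ i \<le> y $ i) \<Longrightarrow> x \<in> A"
  shows "down_set A"
  unfolding down_set_def ball_Basis_vec[of "\<lambda>u v. 0 \<le> u \<and> u \<le> v"]
    ball_Basis_vec[of "\<lambda>u v. 0 \<le> u"] using assms by blast

text \<open>
  The part of the corner above \<open>a\<close>, moved back to the origin, is again a down-set; this is how
  Brunn-Minkowski for down-sets becomes a statement about tails.
\<close>

lemma shifted_corner:
  assumes "\<And>i. 0 \<le> a $ i"
  defines "B \<equiv> {y. (\<forall>i. 0 \<le> y $ i) \<and> a + y \<in> D}"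
  shows "down_set B" "emeasure lborel B = ennreal (tail a * measure lborel D)"
proof -
  have Beq: "B = (\<lambda>y. a + y) -` (D \<inter> {x. \<forall>i. a $ i \<le> x $ i})"
    by (auto simp: B_def)
  have Bm: "B \<in> sets borel"
  proof -
    have "(\<lambda>y. a + y) -` (D \<inter> {x. \<forall>i. a $ i \<le> x $ i}) \<inter> space borel \<in> sets borel"
      by (rule measurable_sets[of _ borel borel]) measurable
    then show ?thesis by (simp add: Beq)
  qed
  show "down_set B"
  proof (rule down_setI[OF Bm])
    have "B \<subseteq> D" 
    proof
      fix y assume "y \<in> B"
      then show "y \<in> D" using assms(1) by (intro down[of "a + y" y]) (auto simp: B_def)
    qed
    then show "bounded B" using compact compact_imp_bounded bounded_subset by blast
    show "0 \<le> x $ i" if "x \<in> B" for x i using that by (simp add: B_def)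
    fix x y assume y: "y \<in> B" and xy: "\<And>i. 0 \<le> x $ i \<and> x $ i \<le> y $ i"
    then have "a + x \<in> D" using assms(1) by (intro down[of "a + y" "a + x"]) (auto simp: B_def)
    then show "x \<in> B" using xy by (simp add: B_def)
  qed
  have "emeasure lborel (D \<inter> {x. \<forall>i. a $ i \<le> x $ i})
      = emeasure (distr lborel borel ((+) a)) (D \<inter> {x. \<forall>i. a $ i \<le> x $ i})"
    by (simp only: lborel_distr_plus)
  also have "\<dots> = emeasure lborel B"
    by (subst emeasure_distr) (auto simp: Beq)
  finally show "emeasure lborel B = ennreal (tail a * measure lborel D)"
    unfolding tail_def by (subst (asm) emeasure_lborel_D_Int) auto
qed

lemma tail_nonneg: "0 \<le> tail a" by (simp add: tail_def)

text \<open>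
  Along a ray, the \<open>n\<close>-th root of the tail is concave: by convexity of the corner, the part above
  \<open>t a\<close>, moved back to the origin, contains the combination with weights \<open>1 - t\<close> and \<open>t\<close> of the
  whole corner and of the part above \<open>a\<close> moved back to the origin.
\<close>

lemma tail_concave_root:
  assumes a: "\<And>i. 0 \<le> a $ i" and t: "0 < t" "t < 1"
    and u: "0 < u" "u ^ CARD('n) = tail a"
  shows "((1 - t) + t * u) ^ CARD('n) \<le> tail (t *\<^sub>R a)"
proof -
  define d where "d = root CARD('n) (measure lborel D)"
  have n: "0 < CARD('n)" by simp
  have d: "0 < d" "d ^ CARD('n) = measure lborel D"
    using measure_pos by (auto simp: d_def real_root_pow_pos2[OF n])
  let ?S = "\<lambda>a. {y. (\<forall>i. 0 \<le> y $ i) \<and> a + y \<in> D}"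
  have S0: "?S 0 = D" using nonneg by auto
  have dS: "down_set (?S a)" "down_set D" "down_set (?S (t *\<^sub>R a))"
    using shifted_corner(1)[of a] shifted_corner(1)[of 0] shifted_corner(1)[of "t *\<^sub>R a"] a t S0 by auto
  have "ennreal (((1 - t) * d + t * (d * u)) ^ DIM(real^'n)) \<le> emeasure lborel (?S (t *\<^sub>R a))"
  proof (rule brunn_minkowski_down_set[OF t dS(2,1)])
    show "?S (t *\<^sub>R a) \<in> sets borel" using dS(3) unfolding down_set_def by blast
    show "0 < d" "0 < d * u" using d u by auto
    show "emeasure lborel D = ennreal (d ^ DIM(real^'n))" using d by (simp add: emeasure_D)
    show "emeasure lborel (?S a) = ennreal ((d * u) ^ DIM(real^'n))"
      using shifted_corner(2)[of a] a d u by (simp add: power_mult_distrib mult.commute)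
    fix x y assume x: "x \<in> D" and y: "y \<in> ?S a"
    have "(1 - t) *\<^sub>R x + t *\<^sub>R (a + y) \<in> D"
      using x y t convex by (intro convexD) auto
    then have "t *\<^sub>R a + ((1 - t) *\<^sub>R x + t *\<^sub>R y) \<in> D" by (simp add: algebra_simps)
    then show "(1 - t) *\<^sub>R x + t *\<^sub>R y \<in> ?S (t *\<^sub>R a)"
      using x y t nonneg by auto
  qed
  also have "\<dots> = ennreal (tail (t *\<^sub>R a) * d ^ CARD('n))"
    using shifted_corner(2)[of "t *\<^sub>R a"] a t d by simp
  finally have "((1 - t) * d + t * (d * u)) ^ CARD('n) \<le> tail (t *\<^sub>R a) * d ^ CARD('n)"
    using d tail_nonneg by (simp add: ennreal_le_iff)
  also have "(1 - t) * d + t * (d * u) = ((1 - t) + t * u) * d" by (simp add: algebra_simps)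
  finally show ?thesis using d measure_pos by (simp add: power_mult_distrib)
qed

lemma tail_powr:
  assumes a: "\<And>i. 0 \<le> a $ i" and t: "0 < t" "t < 1"
  shows "tail a powr t \<le> tail (t *\<^sub>R a)"
proof (cases "tail a = 0")
  case False
  then have ta: "0 < tail a" using tail_nonneg[of a] by simp
  define u where "u = root CARD('n) (tail a)"
  have n: "0 < CARD('n)" by simp
  have u: "0 < u" "u ^ CARD('n) = tail a"
    using ta by (auto simp: u_def real_root_pow_pos2[OF n])
  have "tail a powr t = (u powr t) ^ CARD('n)"
    using u by (simp add: u(2)[symmetric] powr_realpow[symmetric] powr_powr mult.commute)
  also have "u powr t \<le> (1 - t) + t * u"
    using weighted_am_gm[of t 1 u] t u by simp
  then have "(u powr t) ^ CARD('n) \<le> ((1 - t) + t * u) ^ CARD('n)" by (rule power_mono) simp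
  also have "\<dots> \<le> tail (t *\<^sub>R a)" by (rule tail_concave_root[OF a t u])
  finally show ?thesis .
qed (simp add: tail_nonneg)

lemma tail_axis: "0 \<le> s \<Longrightarrow> tail (axis i s) = measure U {x. s \<le> x $ i}"
  unfolding tail_def
proof (rule finite_measure_eq_AE)
  show "0 \<le> s \<Longrightarrow> AE x in U. (x \<in> {x. \<forall>j. axis i s $ j \<le> x $ j}) = (x \<in> {x. s \<le> x $ i})"
    using AE_U by eventually_elim (auto simp: axis_def nonneg)
  show "0 \<le> s \<Longrightarrow> {x. s \<le> x $ i} \<in> sets U" by simp
qed auto

text \<open>
  Log-concavity of the survival function of one coordinate, together with its value 1 at 0: both
  factors on the right are at least the corresponding power of the left side, with exponents that
  add up to 1.
\<close>

lemma tail_axis_submultiplicative: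
  assumes "0 \<le> s" "0 \<le> t"
  shows "measure U {x. s + t \<le> x $ i} \<le> measure U {x. s \<le> x $ i} * measure U {x. t \<le> x $ i}"
proof (cases "s = 0 \<or> t = 0")
  case True
  have "measure U {x. 0 \<le> x $ i} = 1"
    using AE_U by (intro prob_eq_1[THEN iffD2]) (auto simp: nonneg)
  then show ?thesis using True by auto
next
  case False
  then have st: "0 < s" "0 < t" using assms by auto
  let ?G = "\<lambda>s. measure U {x. s \<le> x $ i}"
  have *: "?G (s + t) powr (r / (s + t)) \<le> ?G r" if r: "0 < r" "r < s + t" for r
  proof -
    have ax: "(r / (s + t)) *\<^sub>R axis i (s + t) = axis i r"
      using r by (auto simp: vec_eq_iff axis_def)
    have "tail (axis i (s + t)) powr (r / (s + t)) \<le> tail ((r / (s + t)) *\<^sub>R axis i (s + t))"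
      using st r by (intro tail_powr) (auto simp: axis_def)
    then show ?thesis unfolding ax using st r by (simp add: tail_axis)
  qed
  have "?G (s + t) = ?G (s + t) powr (s / (s + t)) * ?G (s + t) powr (t / (s + t))"
    using st by (simp add: powr_add[symmetric] add_divide_distrib[symmetric])
  also have "\<dots> \<le> ?G s * ?G t"
    using st by (intro mult_mono *) auto
  finally show ?thesis .
qed

text \<open>
  With \<open>G\<close> the survival function of the coordinate, the second moment is twice the double integral
  of \<open>G (s + t)\<close>, and the first moment is the integral of \<open>G\<close>; submultiplicativity of \<open>G\<close>
  separates the double integral. The exponential distribution is the extremal case.
\<close>

lemma second_moment_le:
  "(\<integral>\<^sup>+x. ennreal ((x $ i)\<^sup>2) \<partial>U) \<le> 2 * (\<integral>\<^sup>+x. ennreal (x $ i) \<partial>U)\<^sup>2"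
proof -
  let ?I = "\<lambda>s. indicator {0..} s :: ennreal"
  let ?G = "\<lambda>s. emeasure U {x. s \<le> x $ i}"
  have sub: "?G (s + t) \<le> ?G s * ?G t" if "0 \<le> s" "0 \<le> t" for s t
    using tail_axis_submultiplicative[OF that, of i]
    by (simp add: emeasure_eq_measure ennreal_mult'[symmetric] ennreal_leI)
  have Gm [measurable]: "?G \<in> borel_measurable borel" by measurable
  have inner: "(\<integral>\<^sup>+t. ?I t * indicator {x. s + t \<le> x $ i} x \<partial>lborel) = ennreal (max 0 (x $ i - s))" for s x
  proof -
    have "(\<integral>\<^sup>+t. ?I t * indicator {x. s + t \<le> x $ i} x \<partial>lborel)
        = (\<integral>\<^sup>+t. indicator {0..x $ i - s} t \<partial>lborel)"
      by (intro nn_integral_cong) (auto split: split_indicator)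
    then show ?thesis by (simp add: emeasure_lborel_Icc_eq max_def)
  qed
  have first: "(\<integral>\<^sup>+x. ennreal (x $ i) \<partial>U) = (\<integral>\<^sup>+s. ?I s * ?G s \<partial>lborel)"
  proof -
    have "(\<integral>\<^sup>+x. ennreal (x $ i) \<partial>U) = (\<integral>\<^sup>+x. (\<integral>\<^sup>+t. ?I t * indicator {x. 0 + t \<le> x $ i} x \<partial>lborel) \<partial>U)"
      unfolding inner by (intro nn_integral_cong) (simp add: max_def ennreal_neg)
    also have "\<dots> = (\<integral>\<^sup>+t. (\<integral>\<^sup>+x. ?I t * indicator {x. 0 + t \<le> x $ i} x \<partial>U) \<partial>lborel)"
      by (rule pair_sigma_finite.Fubini') (auto intro!: pair_sigma_finite.intro
          sigma_finite_measure_axioms lborel.sigma_finite_measure_axioms)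
    also have "\<dots> = (\<integral>\<^sup>+s. ?I s * ?G s \<partial>lborel)"
      by (intro nn_integral_cong) (simp add: nn_integral_cmult)
    finally show ?thesis .
  qed
  have "(\<integral>\<^sup>+s. ?I s * ennreal (max 0 (x $ i - s)) \<partial>lborel) = ennreal ((x $ i)\<^sup>2 / 2)" if "0 \<le> x $ i" for x
  proof -
    have "(\<integral>\<^sup>+s. ?I s * ennreal (max 0 (x $ i - s)) \<partial>lborel)
       = (\<integral>\<^sup>+s. ennreal (x $ i - s) * indicator {0..x $ i} s \<partial>lborel)"
      by (intro nn_integral_cong) (auto split: split_indicator simp: max_def)
    also have "\<dots> = ennreal ((x $ i * x $ i - (x $ i)\<^sup>2 / 2) - (x $ i * 0 - 0\<^sup>2 / 2))"
      using that by (intro nn_integral_FTC_Icc) (auto intro!: derivative_eq_intros)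
    finally show ?thesis by (simp add: power2_eq_square)
  qed
  then have "(\<integral>\<^sup>+x. ennreal ((x $ i)\<^sup>2 / 2) \<partial>U)
      = (\<integral>\<^sup>+x. (\<integral>\<^sup>+s. ?I s * ennreal (max 0 (x $ i - s)) \<partial>lborel) \<partial>U)"
    using AE_U by (intro nn_integral_cong_AE) (auto simp: nonneg)
  also have "\<dots> = (\<integral>\<^sup>+s. (\<integral>\<^sup>+x. ?I s * ennreal (max 0 (x $ i - s)) \<partial>U) \<partial>lborel)"
    by (rule pair_sigma_finite.Fubini') (auto intro!: pair_sigma_finite.intro
        sigma_finite_measure_axioms lborel.sigma_finite_measure_axioms)
  also have "\<dots> = (\<integral>\<^sup>+s. ?I s * (\<integral>\<^sup>+x. (\<integral>\<^sup>+t. ?I t * indicator {x. s + t \<le> x $ i} x \<partial>lborel) \<partial>U) \<partial>lborel)"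
    unfolding inner by (intro nn_integral_cong nn_integral_cmult) measurable
  also have "\<dots> = (\<integral>\<^sup>+s. ?I s * (\<integral>\<^sup>+t. ?I t * ?G (s + t) \<partial>lborel) \<partial>lborel)"
  proof (intro nn_integral_cong)
    fix s :: real
    have "(\<integral>\<^sup>+x. (\<integral>\<^sup>+t. ?I t * indicator {x. s + t \<le> x $ i} x \<partial>lborel) \<partial>U)
        = (\<integral>\<^sup>+t. (\<integral>\<^sup>+x. ?I t * indicator {x. s + t \<le> x $ i} x \<partial>U) \<partial>lborel)"
      by (rule pair_sigma_finite.Fubini') (auto intro!: pair_sigma_finite.intro
          sigma_finite_measure_axioms lborel.sigma_finite_measure_axioms)
    also have "\<dots> = (\<integral>\<^sup>+t. ?I t * ?G (s + t) \<partial>lborel)"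
      by (intro nn_integral_cong) (simp add: nn_integral_cmult)
    finally show "?I s * (\<integral>\<^sup>+x. (\<integral>\<^sup>+t. ?I t * indicator {x. s + t \<le> x $ i} x \<partial>lborel) \<partial>U)
      = ?I s * (\<integral>\<^sup>+t. ?I t * ?G (s + t) \<partial>lborel)" by simp
  qed
  also have "\<dots> \<le> (\<integral>\<^sup>+s. ?I s * (\<integral>\<^sup>+t. ?G s * (?I t * ?G t) \<partial>lborel) \<partial>lborel)"
    using sub by (intro nn_integral_mono) (auto split: split_indicator intro!: nn_integral_mono)
  also have "\<dots> = (\<integral>\<^sup>+s. (?I s * ?G s) * (\<integral>\<^sup>+t. ?I t * ?G t \<partial>lborel) \<partial>lborel)"
    by (intro nn_integral_cong) (simp add: nn_integral_cmult mult.assoc)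
  also have "\<dots> = (\<integral>\<^sup>+t. ?I t * ?G t \<partial>lborel)\<^sup>2"
    by (simp add: nn_integral_multc power2_eq_square)
  finally have half: "(\<integral>\<^sup>+x. ennreal ((x $ i)\<^sup>2 / 2) \<partial>U) \<le> (\<integral>\<^sup>+x. ennreal (x $ i) \<partial>U)\<^sup>2"
    by (simp add: first)
  have "(\<integral>\<^sup>+x. ennreal ((x $ i)\<^sup>2) \<partial>U) = (\<integral>\<^sup>+x. 2 * ennreal ((x $ i)\<^sup>2 / 2) \<partial>U)"
    by (intro nn_integral_cong) (simp add: ennreal_mult'[symmetric] flip: ennreal_numeral)
  also have "\<dots> = 2 * (\<integral>\<^sup>+x. ennreal ((x $ i)\<^sup>2 / 2) \<partial>U)" by (simp add: nn_integral_cmult)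
  finally show ?thesis using half by (simp add: mult_left_mono)
qed

end

section \<open>Slabs at the coordinate hyperplanes and the tail bound\<close>

text \<open>
  A crude form of the second Bonferroni inequality, with a uniform bound for the pairwise
  intersections; the quadratic error is harmless because it is used with sets of measure \<open>O(t)\<close>
  and pairwise intersections of measure \<open>O(t\<^sup>2)\<close>.
\<close>

lemma (in finite_measure) bonferroni_lower:
  assumes "finite S" "\<And>i. i \<in> S \<Longrightarrow> A i \<in> sets M" "0 \<le> e"
    and "\<And>i j. i \<in> S \<Longrightarrow> j \<in> S \<Longrightarrow> i \<noteq> j \<Longrightarrow> measure M (A i \<inter> A j) \<le> e"
  shows "(\<Sum>i\<in>S. measure M (A i)) - (real (card S))\<^sup>2 * e \<le> measure M (\<Union>i\<in>S. A i)"
  using assms(1,2,4)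
proof (induction S rule: finite_induct)
  case (insert i S)
  let ?B = "\<Union>j\<in>S. A j"
  have sets: "A i \<in> sets M" "?B \<in> sets M" "\<And>j. j \<in> S \<Longrightarrow> A j \<in> sets M"
    using insert by auto
  have "measure M (A i \<inter> ?B) = measure M (\<Union>j\<in>S. A i \<inter> A j)" by (rule arg_cong[of _ _ "measure M"]) auto
  also have "\<dots> \<le> (\<Sum>j\<in>S. measure M (A i \<inter> A j))"
    using sets insert.hyps by (intro finite_measure_subadditive_finite) auto
  also have "\<dots> \<le> (\<Sum>j\<in>S. e)"
    using insert.hyps by (intro sum_mono insert.prems) auto
  finally have int: "measure M (A i \<inter> ?B) \<le> real (card S) * e" by simp
  have "measure M (A i \<union> ?B) = measure M (A i) + measure M ?B - measure M (A i \<inter> ?B)"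
    using sets by (intro measure_Un3) (auto simp: fmeasurable_eq_sets)
  moreover have "(\<Sum>j\<in>S. measure M (A j)) - (real (card S))\<^sup>2 * e \<le> measure M ?B"
    using insert.prems by (intro insert.IH) auto
  moreover have "(real (card S))\<^sup>2 * e + real (card S) * e \<le> (real (card (insert i S)))\<^sup>2 * e"
    using insert.hyps assms(3) by (simp add: power2_eq_square algebra_simps)
  ultimately show ?case using insert.hyps int by simp
qed simp

context convex_corner
begin

lemma bounded_coordinates: obtains R where "1 \<le> R" "\<And>x i. x \<in> D \<Longrightarrow> x $ i \<le> R"
proof -
  obtain R where R: "\<And>x. x \<in> D \<Longrightarrow> norm x \<le> R"
    using compact compact_imp_bounded bounded_iff by metis
  have "x $ i \<le> max 1 R" if "x \<in> D" for x i
    using R[OF that] component_le_norm_cart[of x i] by linarith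
  then show ?thesis using that[of "max 1 R"] by simp
qed

lemma integrable_coordinate: "integrable U (\<lambda>x. x $ i)"
proof -
  obtain R where R: "\<And>x i. x \<in> D \<Longrightarrow> x $ i \<le> R" using bounded_coordinates by blast
  show ?thesis
  proof (rule integrable_const_bound[of _ R])
    show "AE x in U. norm (x $ i) \<le> R" using AE_U by eventually_elim (auto simp: R nonneg)
  qed measurable
qed

text \<open>
  Otherwise a hyperplane separates the centroid strictly from the corner, and averaging the
  separating functional over the corner contradicts this.
\<close>

lemma centroid_mem: "(\<chi> i. expectation (\<lambda>x. x $ i)) \<in> D"
proof (rule ccontr)
  let ?b = "\<chi> i. expectation (\<lambda>x. x $ i)"
  assume "?b \<notin> D"
  then obtain a c where ac: "a \<bullet> ?b < c" "\<And>x. x \<in> D \<Longrightarrow> c < a \<bullet> x"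
    using separating_hyperplane_closed_point[OF convex compact_imp_closed[OF compact]] by blast
  have ax: "a \<bullet> x = (\<Sum>i\<in>UNIV. a $ i * x $ i)" for x by (simp add: inner_vec_def)
  have int: "integrable U (\<lambda>x. a \<bullet> x)" unfolding ax using integrable_coordinate by auto
  have "c \<le> expectation (\<lambda>x. a \<bullet> x)"
    using AE_U ac(2) by (intro integral_ge_const int) (auto elim!: eventually_mono intro: less_imp_le)
  also have "\<dots> = a \<bullet> ?b" unfolding ax using integrable_coordinate by simp
  finally show False using ac(1) by simp
qed

text \<open>
  The corner contains the box spanned by the origin and its centroid.
\<close>

lemma prod_expectation_le: "(\<Prod>i\<in>UNIV. expectation (\<lambda>x. x $ i)) \<le> measure lborel D"
proof -
  let ?b = "\<chi> i. expectation (\<lambda>x. x $ i)"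
  have b0: "0 \<le> ?b $ i" for i using nonneg[OF centroid_mem] .
  have sub: "cbox 0 ?b \<subseteq> D"
    using down[OF centroid_mem] by (auto simp: mem_box_cart)
  have "(\<Prod>i\<in>UNIV. expectation (\<lambda>x. x $ i)) = measure lborel (cbox 0 ?b)"
    using b0 by (subst content_cbox_cart) (auto simp: interval_ne_empty_cart)
  also have "\<dots> \<le> measure lborel D"
    using sub emeasure_D_finite by (intro measure_mono_fmeasurable) (auto simp: fmeasurable_def)
  finally show ?thesis .
qed

text \<open>
  Moving a slab of the corner down to the coordinate hyperplane keeps it inside the corner, so
  slabs of equal width lose mass with the distance from the hyperplane.
\<close>

lemma slab_translate_le:
  assumes "0 \<le> h"
  shows "measure U {x. h \<le> x $ i \<and> x $ i < h + s} \<le> measure U {x. x $ i < s}"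
proof -
  let ?A = "{x. h \<le> x $ i \<and> x $ i < h + s}"
  have "emeasure lborel (D \<inter> ?A) = emeasure (distr lborel borel ((+) (axis i h))) (D \<inter> ?A)"
    by (simp only: lborel_distr_plus)
  also have "\<dots> = emeasure lborel ((\<lambda>y. axis i h + y) -` (D \<inter> ?A))"
    by (subst emeasure_distr) auto
  also have "\<dots> \<le> emeasure lborel (D \<inter> {x. x $ i < s})"
  proof (rule emeasure_mono)
    show "(\<lambda>y. axis i h + y) -` (D \<inter> ?A) \<subseteq> D \<inter> {x. x $ i < s}"
    proof
      fix y assume "y \<in> (\<lambda>y. axis i h + y) -` (D \<inter> ?A)"
      then have y: "axis i h + y \<in> D" "0 \<le> y $ i" "y $ i < s" by (auto simp: axis_def)
      have "0 \<le> y $ j \<and> y $ j \<le> (axis i h + y) $ j" for j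
        using nonneg[OF y(1), of j] y(2) assms by (cases "j = i") (auto simp: axis_def)
      then show "y \<in> D \<inter> {x. x $ i < s}" using down[OF y(1)] y(3) by auto
    qed
  qed auto
  finally have "measure U ?A * measure lborel D \<le> measure U {x. x $ i < s} * measure lborel D"
    by (simp add: emeasure_lborel_D_Int)
  then show ?thesis using measure_pos by simp
qed

text \<open>
  The interval \<open>[0, r)\<close> is covered by at most \<open>r/s + 1\<close> intervals of length \<open>s\<close>, none of which has
  more mass than \<open>[0, s)\<close>.
\<close>

lemma slab_linear_growth:
  assumes "0 < s" "0 \<le> r"
  shows "measure U {x. x $ i < r} \<le> (r / s + 1) * measure U {x. x $ i < s}"
proof -
  let ?F = "\<lambda>s. measure U {x. x $ i < s}"
  have F0: "?F 0 = 0"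
    using AE_U by (intro prob_eq_0[THEN iffD2]) (auto elim!: eventually_mono simp: not_less nonneg)
  have mult: "?F (real k * s) \<le> real k * ?F s" for k
  proof (induction k)
    case (Suc k)
    let ?S = "{x. real k * s \<le> x $ i \<and> x $ i < real k * s + s}"
    have "?F (real (Suc k) * s) = measure U ({x. x $ i < real k * s} \<union> ?S)"
      using assms by (intro arg_cong[of _ _ "measure U"]) (auto simp: algebra_simps)
    also have "\<dots> \<le> ?F (real k * s) + measure U ?S" by (intro measure_Un_le) auto
    also have "measure U ?S \<le> ?F s" using assms by (intro slab_translate_le) simp
    finally show ?case using Suc by (simp add: algebra_simps)
  qed (simp add: F0)
  define k where "k = nat \<lceil>r / s\<rceil>"
  have k: "r / s \<le> real k" "real k \<le> r / s + 1"
    using assms by (auto simp: k_def)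
  have "?F r \<le> ?F (real k * s)"
    using k(1) assms by (intro finite_measure_mono) (auto simp: divide_le_eq)
  also have "\<dots> \<le> real k * ?F s" by (rule mult)
  also have "\<dots> \<le> (r / s + 1) * ?F s" using k by (intro mult_right_mono) auto
  finally show ?thesis .
qed

text \<open>
  A coordinate with a small second moment must have some density at 0. If the slab of width \<open>s\<close>
  were too light, then by linear growth all the slabs \<open>[0, r)\<close> would be light, and the survival
  function would stay so large that the second moment exceeds 1/2. In the limit \<open>s \<rightarrow> 0\<close> this
  argument gives the density \<open>sqrt (2/3)\<close>, attained by a uniformly distributed coordinate; the
  smaller value 4/5 leaves room for a definite range of \<open>s\<close>.
\<close>

lemma slab_lower_bound:
  assumes m2: "(\<integral>\<^sup>+x. ennreal ((x $ i)\<^sup>2) \<partial>U) \<le> ennreal (1 / 2)" and s: "0 \<le> s" "s \<le> 1 / 100"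
  shows "4 / 5 * s \<le> measure U {x. x $ i < s}"
proof (rule ccontr)
  let ?F = "\<lambda>s. measure U {x. x $ i < s}"
  \<comment> \<open>This is \<open>5 / 4 - 1 / 100\<close>, the point up to which the linear lower bound \<open>G\<close> for the survival
    function is nonnegative. Integrating \<open>2 * r\<close> against that bound gives \<open>4 / 15 * ?T ^ 3\<close>,
    about 0.508.\<close>
  let ?T = "124 / 100 :: real"
  assume "\<not> ?thesis"
  then have F: "?F s < 4 / 5 * s" by simp
  have s0: "0 < s"
  proof (rule ccontr)
    assume "\<not> 0 < s"
    then show False using F s measure_nonneg[of U "{x. x $ i < s}"] by simp
  qed
  have G: "ennreal (4 / 5 * (?T - r)) \<le> emeasure U {x. r \<le> x $ i}" if "0 \<le> r" for r
  proof -
    have "?F r \<le> (r / s + 1) * ?F s" by (rule slab_linear_growth[OF s0 that])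
    also have "\<dots> \<le> (r / s + 1) * (4 / 5 * s)" using F that s0 by (intro mult_left_mono) auto
    also have "\<dots> = 4 / 5 * (r + s)" using s0 by (simp add: field_simps)
    finally have "4 / 5 * (?T - r) \<le> 1 - ?F r" using s by simp
    also have "1 - ?F r = measure U {x. r \<le> x $ i}"
      using prob_compl[of "{x. x $ i < r}"]
          by (simp add: Compl_eq_Diff_UNIV[symmetric] Collect_neg_eq[symmetric] not_less)
    finally show ?thesis by (simp add: emeasure_eq_measure ennreal_leI)
  qed
  have sq: "(\<integral>\<^sup>+r. ennreal (2 * r) * indicator {0..} r * indicator {x. r \<le> x $ i} x \<partial>lborel)
      = ennreal ((x $ i)\<^sup>2)"
    if "0 \<le> x $ i" for x
  proof -
    have "(\<integral>\<^sup>+r. ennreal (2 * r) * indicator {0..} r * indicator {x. r \<le> x $ i} x \<partial>lborel)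
       = (\<integral>\<^sup>+r. ennreal (2 * r) * indicator {0..x $ i} r \<partial>lborel)"
      by (intro nn_integral_cong) (auto split: split_indicator)
    also have "\<dots> = ennreal ((x $ i)\<^sup>2 - 0\<^sup>2)"
      using that by (intro nn_integral_FTC_Icc) (auto intro!: derivative_eq_intros)
    finally show ?thesis by simp
  qed
  have "ennreal (?T ^ 3 * (4 / 15)) = ennreal ((4 / 5 * ?T * ?T\<^sup>2 - 8 / 15 * ?T ^ 3) - (4 / 5 * ?T *
      0\<^sup>2 - 8 / 15 * 0 ^ 3))"
    by (simp add: power2_eq_square power3_eq_cube)
  also have "\<dots> = (\<integral>\<^sup>+r. ennreal (2 * r * (4 / 5 * (?T - r))) * indicator {0..?T} r \<partial>lborel)"
    by (intro nn_integral_FTC_Icc[symmetric])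
      (auto intro!: derivative_eq_intros mult_left_mono simp: algebra_simps power2_eq_square)
  also have "\<dots> \<le> (\<integral>\<^sup>+r. ennreal (2 * r) * indicator {0..} r * emeasure U {x. r \<le> x $ i} \<partial>lborel)"
  proof (intro nn_integral_mono)
    fix r :: real
    show "ennreal (2 * r * (4 / 5 * (?T - r))) * indicator {0..?T} r
        \<le> ennreal (2 * r) * indicator {0..} r * emeasure U {x. r \<le> x $ i}"
    proof (cases "r \<in> {0..?T}")
      case True
      then have "ennreal (2 * r * (4 / 5 * (?T - r))) = ennreal (2 * r) * ennreal (4 / 5 * (?T - r))"
        by (intro ennreal_mult) auto
      also have "\<dots> \<le> ennreal (2 * r) * emeasure U {x. r \<le> x $ i}"
        using True by (intro mult_left_mono G) auto
      finally show ?thesis using True by simp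
    qed simp
  qed
  also have "\<dots> = (\<integral>\<^sup>+r. (\<integral>\<^sup>+x. ennreal (2 * r) * indicator {0..} r * indicator {x. r \<le> x $ i} x \<partial>U)
      \<partial>lborel)"
    by (intro nn_integral_cong) (simp add: nn_integral_cmult)
  also have "\<dots> = (\<integral>\<^sup>+x. (\<integral>\<^sup>+r. ennreal (2 * r) * indicator {0..} r * indicator {x. r \<le> x $ i} x
      \<partial>lborel) \<partial>U)"
    by (rule pair_sigma_finite.Fubini') (auto intro!: pair_sigma_finite.intro
        sigma_finite_measure_axioms lborel.sigma_finite_measure_axioms)
  also have "\<dots> = (\<integral>\<^sup>+x. ennreal ((x $ i)\<^sup>2) \<partial>U)"
    by (rule nn_integral_cong_AE, rule eventually_mono[OF AE_U], rule sq, rule nonneg)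
  also have "\<dots> \<le> ennreal (1 / 2)" by (rule m2)
  finally have "?T ^ 3 * (4 / 15) \<le> 1 / 2" by (subst (asm) ennreal_le_iff) auto
  then show False by (simp add: power3_eq_cube)
qed

lemma slab_intersection_bound:
  obtains C where "0 \<le> C" "\<And>i j s s'. i \<noteq> j \<Longrightarrow> 0 \<le> s \<Longrightarrow> 0 \<le> s' \<Longrightarrow>
    measure U ({x. x $ i < s} \<inter> {x. x $ j < s'}) \<le> C * (s * s')"
proof -
  obtain R where R: "1 \<le> R" "\<And>x i. x \<in> D \<Longrightarrow> x $ i \<le> R" using bounded_coordinates by blast
  have "measure U ({x. x $ i < s} \<inter> {x. x $ j < s'}) \<le> R ^ CARD('n) / measure lborel D * (s * s')"
    if ij: "i \<noteq> j" and s: "0 \<le> s" "0 \<le> s'" for i j s s'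
  proof -
    let ?v = "\<chi> k. if k = i then s else if k = j then s' else R"
    let ?A = "{x. x $ i < s} \<inter> {x. x $ j < s'}"
    have sub: "D \<inter> ?A \<subseteq> cbox 0 ?v"
      using R(2) nonneg by (auto simp: mem_box_cart intro: less_imp_le)
    have "measure lborel (D \<inter> ?A) \<le> measure lborel (cbox 0 ?v)"
      using sub by (intro measure_mono_fmeasurable) (auto simp: fmeasurable_cbox)
    also have "\<dots> = (\<Prod>k\<in>UNIV. ?v $ k)"
      using R(1) s by (subst content_cbox_cart) (auto simp: interval_ne_empty_cart)
    also have "\<dots> = s * s' * (\<Prod>k\<in>UNIV - {i} - {j}. R)"
    proof -
      have "(\<Prod>k\<in>UNIV. ?v $ k) = ?v $ i * (?v $ j * (\<Prod>k\<in>UNIV - {i} - {j}. ?v $ k))"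
        using ij by (subst prod.remove[of UNIV i]) (auto simp: prod.remove[of "UNIV - {i}" j])
      also have "(\<Prod>k\<in>UNIV - {i} - {j}. ?v $ k) = (\<Prod>k\<in>UNIV - {i} - {j}. R)"
        by (intro prod.cong) auto
      finally show ?thesis using ij by simp
    qed
    also have "\<dots> \<le> s * s' * R ^ CARD('n)"
      using R(1) s by (intro mult_left_mono) (auto intro!: power_increasing card_mono)
    finally show ?thesis using measure_pos by (simp add: measure_U divide_right_mono field_simps)
  qed
  then show ?thesis using that[of "R ^ CARD('n) / measure lborel D"] R(1) measure_pos by auto
qed

text \<open>
  The \<open>n\<close>-th root \<open>u\<close> of the tail is concave along the ray through \<open>a\<close> with value 1 at the origin,
  so it lies below its tangent there. The slope of the tangent is controlled by the slab
  probabilities: a point fails to be above \<open>t a\<close> when it lies in one of the slabs of width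
  \<open>t a\<^sub>i\<close>, and for small \<open>t\<close> the overlaps of the slabs are of second order.
\<close>

lemma tail_le:
  assumes slab: "\<And>i s. 0 \<le> s \<Longrightarrow> s \<le> \<delta> \<Longrightarrow> c * s \<le> measure U {x. x $ i < s}"
    and d: "0 < \<delta>" and c: "0 \<le> c" and a: "\<And>i. 0 \<le> a $ i"
  shows "tail a \<le> (max 0 (1 - c * (\<Sum>i\<in>UNIV. a $ i) / real CARD('n))) ^ CARD('n)"
proof (cases "tail a = 0")
  case False
  define n where "n = CARD('n)"
  have n: "0 < n" by (simp add: n_def)
  define u where "u = root n (tail a)"
  have u: "0 < u" "u ^ n = tail a"
    using False tail_nonneg[of a] n by (auto simp: u_def real_root_pow_pos2[OF n])
  obtain C where C: "0 \<le> C" "\<And>i j s s'. i \<noteq> j \<Longrightarrow> 0 \<le> s \<Longrightarrow> 0 \<le> s' \<Longrightarrow>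
    measure U ({x. x $ i < s} \<inter> {x. x $ j < s'}) \<le> C * (s * s')"
    using slab_intersection_bound by blast
  define S where "S = (\<Sum>i\<in>UNIV. a $ i)"
  have aS: "a $ i \<le> S" for i unfolding S_def using a by (intro member_le_sum) auto
  have S0: "0 \<le> S" using a by (simp add: S_def sum_nonneg)
  define C' where "C' = (real n)\<^sup>2 * (C * (S * S))"
  have C'0: "0 \<le> C'" using C(1) S0 by (simp add: C'_def)
  have key: "real n * (u - 1) + c * S \<le> t * C'" if t: "0 < t" "t < 1" "t * S \<le> \<delta>" for t
  proof -
    let ?A = "\<lambda>i. {x. x $ i < t * a $ i}"
    have "1 + real n * (t * (u - 1)) \<le> (1 + t * (u - 1)) ^ n"
    proof (rule Bernoulli_inequality)
      have "-1 \<le> - t" using t by simp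
      also have "- t \<le> t * (u - 1)" using t u by (simp add: algebra_simps)
      finally show "-1 \<le> t * (u - 1)" .
    qed
    also have "\<dots> = ((1 - t) + t * u) ^ n" by (simp add: algebra_simps)
    also have "\<dots> \<le> tail (t *\<^sub>R a)"
      unfolding n_def using u a t by (intro tail_concave_root) (auto simp: n_def)
    also have "\<dots> = 1 - measure U (\<Union>i. ?A i)"
    proof -
      have "{x. \<forall>i. (t *\<^sub>R a) $ i \<le> x $ i} = space U - (\<Union>i. ?A i)"
        by (auto simp flip: not_le)
      then show ?thesis unfolding tail_def using prob_compl[of "\<Union>i. ?A i"] by simp
    qed
    also have "\<dots> \<le> 1 - ((\<Sum>i\<in>UNIV. measure U (?A i)) - (real n)\<^sup>2 * (C * ((t * S) * (t * S))))"
    proof -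
      have "(\<Sum>i\<in>UNIV. measure U (?A i)) - (real (card (UNIV::'n set)))\<^sup>2 * (C * ((t * S) * (t * S))) \<le>
          measure U (\<Union>i. ?A i)"
      proof (rule bonferroni_lower)
        fix i j :: 'n assume "i \<noteq> j"
        then have "measure U (?A i \<inter> ?A j) \<le> C * ((t * a $ i) * (t * a $ j))"
          using a t by (intro C(2)) auto
        also have "\<dots> \<le> C * ((t * S) * (t * S))"
          using a t aS C(1) S0 by (intro mult_left_mono mult_mono) auto
        finally show "measure U (?A i \<inter> ?A j) \<le> C * ((t * S) * (t * S))" .
      qed (use C(1) in auto)
      then show ?thesis by (simp add: n_def)
    qed
    also have "\<dots> \<le> 1 - ((\<Sum>i\<in>UNIV. c * (t * a $ i)) - (real n)\<^sup>2 * (C * ((t * S) * (t * S))))"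
    proof -
      have "c * (t * a $ i) \<le> measure U (?A i)" for i
      proof (rule slab)
        have "t * a $ i \<le> t * S" using t aS by simp
        then show "t * a $ i \<le> \<delta>" using t by linarith
      qed (use a t in auto)
      then have "(\<Sum>i\<in>UNIV. c * (t * a $ i)) \<le> (\<Sum>i\<in>UNIV. measure U (?A i))" by (intro sum_mono)
      then show ?thesis by simp
    qed
    also have "\<dots> = 1 - t * (c * S - t * C')"
      by (simp add: S_def C'_def sum_distrib_left sum_distrib_right algebra_simps flip: sum_distrib_left)
    finally have "t * (real n * (u - 1) + c * S) \<le> t * (t * C')" by (simp add: algebra_simps)
    then show ?thesis using t by simp
  qed
  have "real n * (u - 1) + c * S \<le> 0"
  proof (rule ccontr)
    define e where "e = real n * (u - 1) + c * S"
    assume "\<not> real n * (u - 1) + c * S \<le> 0"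
    then have e: "0 < e" by (simp add: e_def)
    \<comment> \<open>Small enough for the slab bound to apply, and for the error term to be at most half of the
      supposed excess.\<close>
    define t where "t = min (1 / 2) (min (\<delta> / (S + 1)) (e / (2 * (C' + 1))))"
    have t: "0 < t" "t < 1" using d S0 e C'0 by (auto simp: t_def)
    have "t * S \<le> \<delta> / (S + 1) * (S + 1)" using t S0 d by (intro mult_mono) (auto simp: t_def)
    then have "t * S \<le> \<delta>" using S0 by simp
    then have "e \<le> t * C'" using key[OF t] by (simp add: e_def)
    also have "\<dots> \<le> e / (2 * (C' + 1)) * (C' + 1)" using t e C'0 by (intro mult_mono) (auto simp: t_def)
    also have "\<dots> = e / 2" using C'0 by (simp add: field_simps)
    finally show False using e by simp
  qed
  then have "u \<le> 1 - c * S / real n" using n by (simp add: field_simps)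
  then have "u ^ n \<le> (max 0 (1 - c * S / real n)) ^ n" using u(1) by (intro power_mono) auto
  then show ?thesis using u(2) by (simp add: n_def S_def)
qed (simp add: tail_nonneg)

end

section \<open>Even moments under a tail bound\<close>

text \<open>
  The average of \<open>(\<Sum>i\<in>S. \<plusminus> y i) ^ (2 * k) / fact (2 * k)\<close> over all choices of signs: the part of
  the multinomial expansion in which all exponents are even. As a power series coefficient of a
  product of hyperbolic cosines (in the square root of the variable) it satisfies a convolution
  recursion when a coordinate is added.
\<close>

definition even_part :: "'i set \<Rightarrow> ('i \<Rightarrow> real) \<Rightarrow> nat \<Rightarrow> real" where
  "even_part S y k = fps_nth (\<Prod>i\<in>S. Abs_fps (\<lambda>j. y i ^ (2 * j) / fact (2 * j))) k"

lemma even_part_empty: "even_part {} y k = (if k = 0 then 1 else 0)"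
  by (simp add: even_part_def)

lemma even_part_insert:
  "finite S \<Longrightarrow> i \<notin> S \<Longrightarrow>
    even_part (insert i S) y k = (\<Sum>j=0..k. y i ^ (2 * j) / fact (2 * j) * even_part S y (k - j))"
  by (simp add: even_part_def fps_mult_nth)

lemma even_part_nonneg: "finite S \<Longrightarrow> 0 \<le> even_part S y k"
proof (induction S arbitrary: k rule: finite_induct)
  case (insert i S)
  then show ?case by (auto simp: even_part_insert intro!: sum_nonneg mult_nonneg_nonneg)
qed (simp add: even_part_empty)

lemma even_part_scale: "finite S \<Longrightarrow> even_part S (\<lambda>i. c * y i) k = c ^ (2 * k) * even_part S y k"
proof (induction S arbitrary: k rule: finite_induct)
  case (insert i S)
  have "c ^ (2 * k) = c ^ (2 * j) * c ^ (2 * (k - j))" if "j \<le> k" for j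
    using that by (simp flip: power_add add: algebra_simps)
  then show ?case using insert
    by (auto simp: even_part_insert sum_distrib_left power_mult_distrib intro!: sum.cong)
qed (simp add: even_part_empty)

lemma even_part_mono_abs:
  "finite S \<Longrightarrow> (\<And>i. i \<in> S \<Longrightarrow> \<bar>y i\<bar> \<le> \<bar>z i\<bar>) \<Longrightarrow> even_part S y k \<le> even_part S z k"
proof (induction S arbitrary: k rule: finite_induct)
  case (insert i S)
  have "y i ^ (2 * j) \<le> z i ^ (2 * j)" for j
    using power_mono[of "\<bar>y i\<bar>" "\<bar>z i\<bar>" "2 * j"] insert.prems by (simp add: power_even_abs)
  then show ?case using insert
    by (auto simp: even_part_insert intro!: sum_mono mult_mono divide_right_mono even_part_nonneg)
qed (simp add: even_part_empty)

lemma even_part_measurable [measurable (raw)]: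
  assumes "finite S" and [measurable]: "\<And>i. (\<lambda>w. X w i) \<in> borel_measurable M"
  shows "(\<lambda>w. even_part S (X w) k) \<in> borel_measurable M"
  using assms(1)
proof (induction S arbitrary: k rule: finite_induct)
  case (insert i S)
  note insert(3)[measurable]
  from insert show ?case by (simp add: even_part_insert)
qed (simp add: even_part_empty)

text \<open>
  The hockey-stick identity in the form in which the convolution recursion produces it. With
  natural subtraction, \<open>(0 + k - 1) choose k\<close> is 1 for \<open>k = 0\<close> and 0 otherwise, as is required for
  the empty index set.
\<close>

lemma sum_choose_card:
  "(\<Sum>j=0..k. (s + (k - j) - 1) choose (k - j)) = (Suc s + k - 1) choose k"
proof -
  have "(\<Sum>j=0..k. (s + (k - j) - 1) choose (k - j)) = (\<Sum>l=0..k. (s + l - 1) choose l)"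
    by (subst sum.atLeastAtMost_rev) simp
  also have "\<dots> = (s + k) choose k"
  proof (cases s)
    case 0
    have "(\<Sum>l=0..k. (0 + l - 1) choose l) = (\<Sum>l\<in>{0}. (0 + l - 1) choose l)"
      by (rule sum.mono_neutral_right) auto
    then show ?thesis using 0 by simp
  next
    case (Suc r)
    then show ?thesis using sum_choose_lower[of r k] by (simp add: atLeast0AtMost)
  qed
  finally show ?thesis by simp
qed

text \<open>
  The bound is the value for independent standard exponential variables, for which each
  \<open>y i ^ (2 * j) / fact (2 * j)\<close> has expectation 1. Coordinates are integrated out one at a time:
  a power of \<open>X i\<close> is written as an integral over thresholds \<open>s \<le> X i\<close>, and such a threshold
  becomes the new \<open>i\<close>-th component of \<open>b\<close>, while the factor \<open>exp (- s)\<close> from the induction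
  hypothesis makes the integral over \<open>s\<close> equal to 1. The restriction to points above \<open>b\<close> is
  there to carry the thresholds of the coordinates that are still to be integrated out.
\<close>

lemma nn_integral_even_part_le:
  fixes X :: "'w \<Rightarrow> 'i \<Rightarrow> real"
  assumes "sigma_finite_measure M" and I: "finite I"
    and [measurable]: "\<And>i. (\<lambda>w. X w i) \<in> borel_measurable M"
    and tail: "\<And>b. (\<And>i. 0 \<le> b i) \<Longrightarrow>
      emeasure M {w \<in> space M. \<forall>i\<in>I. b i \<le> X w i} \<le> ennreal (exp (- (\<Sum>i\<in>I. b i)))"
    and "S \<subseteq> I" "\<And>i. 0 \<le> b i" "\<And>i. i \<in> S \<Longrightarrow> b i = 0"
  shows "(\<integral>\<^sup>+w. ennreal (even_part S (X w) k) * indicator {w \<in> space M. \<forall>i\<in>I. b i \<le> X w i} w \<partial>M)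
      \<le> ennreal (real ((card S + k - 1) choose k) * exp (- (\<Sum>i\<in>I. b i)))"
proof -
  interpret sigma_finite_measure M by fact
  have "finite S" using assms(5) I by (rule finite_subset)
  then show ?thesis using assms(5-)
  proof (induction S arbitrary: b k rule: finite_induct)
    case empty
    have [measurable]: "{w \<in> space M. \<forall>i\<in>I. b i \<le> X w i} \<in> sets M"
      using I by measurable
    show ?case using tail[of b] empty by (cases "k = 0") (auto simp: even_part_empty)
  next
    case (insert i S)
    let ?A = "\<lambda>b. {w \<in> space M. \<forall>i\<in>I. b i \<le> X w i}"
    have [measurable]: "?A b \<in> sets M" for b using I by measurable
    have em [measurable]: "(\<lambda>w. even_part S (X w) l) \<in> borel_measurable M" for l
      using insert.hyps by measurable
    define C where "C l = real ((card S + l - 1) choose l) * exp (- (\<Sum>i\<in>I. b i))" for l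
    have C0: "0 \<le> C l" for l by (simp add: C_def)
    have term_le: "(\<integral>\<^sup>+w. ennreal (X w i ^ (2 * j) / fact (2 * j) * even_part S (X w) l) * indicator
        (?A b) w \<partial>M) \<le> ennreal (C l)" for j l
    proof (cases j)
      case 0
      have "(\<integral>\<^sup>+w. ennreal (even_part S (X w) l) * indicator (?A b) w \<partial>M) \<le> ennreal (C l)"
        unfolding C_def using insert.prems by (intro insert.IH) auto
      then show ?thesis using 0 by simp
    next
      case (Suc j')
      \<comment> \<open>The density \<open>s ^ m / fact m\<close> below integrates to the even power \<open>2 * j\<close> over
        \<open>fact (2 * j)\<close>.\<close>
      define m where "m = 2 * j' + 1"
      have m: "2 * j = Suc m" by (simp add: m_def Suc)
      let ?w = "\<lambda>s. ennreal (s ^ m / fact m) * indicator {0..} s"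
      have pw: "(\<integral>\<^sup>+s. ?w s * indicator {s. s \<le> x} s \<partial>lborel) = ennreal (x ^ (2 * j) / fact (2 * j))"
          if "0 \<le> x" for x
      proof -
        have "(\<integral>\<^sup>+s. ?w s * indicator {s. s \<le> x} s \<partial>lborel)
            = (\<integral>\<^sup>+s. ennreal (s ^ m / fact m) * indicator {0..x} s \<partial>lborel)"
          by (intro nn_integral_cong) (auto split: split_indicator)
        also have "\<dots> = ennreal (x ^ Suc m / fact (Suc m) - 0 ^ Suc m / fact (Suc m))"
        proof (rule nn_integral_FTC_Icc)
          fix s :: real
          show "((\<lambda>s. s ^ Suc m / fact (Suc m)) has_real_derivative s ^ m / fact m) (at s)"
            by (rule DERIV_cong[OF DERIV_cdivide[OF DERIV_pow]]) (simp del: of_nat_Suc)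
        qed (use that in auto)
        finally show ?thesis by (simp add: m)
      qed
      have "(\<integral>\<^sup>+w. ennreal (X w i ^ (2 * j) / fact (2 * j) * even_part S (X w) l) * indicator (?A b) w \<partial>M)
         = (\<integral>\<^sup>+w. (\<integral>\<^sup>+s. ?w s * (ennreal (even_part S (X w) l) * indicator (?A (b(i := s))) w) \<partial>lborel) \<partial>M)"
      proof (rule nn_integral_cong)
        fix w assume w: "w \<in> space M"
        have ind: "indicator {s. s \<le> X w i} s * indicator (?A b) w
            = (indicator (?A (b(i := s))) w :: ennreal)" if "0 \<le> s" for s
        proof -
          have i: "b i = 0" "i \<in> I" using insert.prems by auto
          have "(\<forall>l\<in>I. (b(i := s)) l \<le> X w l) \<longleftrightarrow> s \<le> X w i \<and> (\<forall>l\<in>I. b l \<le> X w l)"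
          proof (intro iffI conjI ballI)
            assume h: "\<forall>l\<in>I. (b(i := s)) l \<le> X w l"
            then have si: "(b(i := s)) i \<le> X w i" using i(2) by blast
            then show "s \<le> X w i" by simp
            fix l assume "l \<in> I"
            then have "(b(i := s)) l \<le> X w l" using h by blast
            then show "b l \<le> X w l" using si i(1) that by (cases "l = i") auto
          qed auto
          then show ?thesis using w by (auto simp: indicator_def)
        qed
        have "ennreal (X w i ^ (2 * j) / fact (2 * j) * even_part S (X w) l) * indicator (?A b) w
           = (\<integral>\<^sup>+s. ?w s * indicator {s. s \<le> X w i} s \<partial>lborel) * (ennreal (even_part S (X w) l) *
               indicator (?A b) w)"
        proof (cases "w \<in> ?A b")
          case True
          then have "0 \<le> X w i" using insert.prems by force
          have "ennreal (X w i ^ (2 * j) / fact (2 * j) * even_part S (X w) l)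
              = ennreal (X w i ^ (2 * j) / fact (2 * j)) * ennreal (even_part S (X w) l)"
            by (rule ennreal_mult') simp
          then show ?thesis unfolding pw[OF \<open>0 \<le> X w i\<close>] by (simp only: mult.assoc)
        qed simp
        also have "\<dots> = (\<integral>\<^sup>+s. ?w s * indicator {s. s \<le> X w i} s * (ennreal (even_part S (X w) l) *
            indicator (?A b) w) \<partial>lborel)"
          by (rule nn_integral_multc[symmetric]) measurable
        also have "\<dots> = (\<integral>\<^sup>+s. ?w s * (ennreal (even_part S (X w) l) * indicator (?A (b(i := s))) w)
            \<partial>lborel)"
        proof (rule nn_integral_cong)
          fix s :: real
          show "?w s * indicator {s. s \<le> X w i} s * (ennreal (even_part S (X w) l) * indicator (?A b) w)
            = ?w s * (ennreal (even_part S (X w) l) * indicator (?A (b(i := s))) w)"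
          proof (cases "0 \<le> s")
            case True
            show ?thesis unfolding ind[OF True, symmetric] by (simp only: ac_simps)
          qed simp
        qed
        finally show "ennreal (X w i ^ (2 * j) / fact (2 * j) * even_part S (X w) l) * indicator (?A b) w
          = (\<integral>\<^sup>+s. ?w s * (ennreal (even_part S (X w) l) * indicator (?A (b(i := s))) w) \<partial>lborel)" .
      qed
      also have "\<dots> = (\<integral>\<^sup>+s. (\<integral>\<^sup>+w. ?w s * (ennreal (even_part S (X w) l) * indicator (?A (b(i := s)))
          w) \<partial>M) \<partial>lborel)"
      proof (rule pair_sigma_finite.Fubini')
        show "pair_sigma_finite lborel M"
          by (intro pair_sigma_finite.intro lborel.sigma_finite_measure_axioms) fact
        have "{p \<in> space (lborel \<Otimes>\<^sub>M M). \<forall>k\<in>I. (b(i := fst p)) k \<le> X (snd p) k} \<in> sets (lborel \<Otimes>\<^sub>M M)"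
          unfolding fun_upd_def using I by measurable
        then have [measurable]: "(\<lambda>p. indicator {p \<in> space (lborel \<Otimes>\<^sub>M M). \<forall>k\<in>I. (b(i := fst p)) k \<le> X
            (snd p) k} p :: ennreal)
             \<in> borel_measurable (lborel \<Otimes>\<^sub>M M)" by measurable
        have "(\<lambda>p. ?w (fst p) * (ennreal (even_part S (X (snd p)) l) *
          indicator {p \<in> space (lborel \<Otimes>\<^sub>M M). \<forall>k\<in>I. (b(i := fst p)) k \<le> X (snd p) k} p)) \<in>
              borel_measurable (lborel \<Otimes>\<^sub>M M)"
          by measurable
        also have "?this \<longleftrightarrow> (\<lambda>(s, w). ?w s * (ennreal (even_part S (X w) l) * indicator (?A (b(i :=
            s))) w)) \<in> borel_measurable (lborel \<Otimes>\<^sub>M M)"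
          by (rule measurable_cong) (auto simp: space_pair_measure indicator_def)
        finally show "(\<lambda>(s, w). ?w s * (ennreal (even_part S (X w) l) * indicator (?A (b(i := s))) w))
            \<in> borel_measurable (lborel \<Otimes>\<^sub>M M)" .
      qed
      also have "\<dots> \<le> (\<integral>\<^sup>+s. ennreal (C l / fact m) * (ennreal (s ^ m * exp (- s)) * indicator {0..} s)
          \<partial>lborel)"
      proof (rule nn_integral_mono)
        fix s :: real
        show "(\<integral>\<^sup>+w. ?w s * (ennreal (even_part S (X w) l) * indicator (?A (b(i := s))) w) \<partial>M)
           \<le> ennreal (C l / fact m) * (ennreal (s ^ m * exp (- s)) * indicator {0..} s)"
        proof (cases "0 \<le> s")
          case True
          have sm: "(\<Sum>k\<in>I. (b(i := s)) k) = s + (\<Sum>k\<in>I. b k)"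
            using insert.prems I by (simp add: sum.remove[of I i])
          have "(\<integral>\<^sup>+w. ?w s * (ennreal (even_part S (X w) l) * indicator (?A (b(i := s))) w) \<partial>M)
             = ?w s * (\<integral>\<^sup>+w. ennreal (even_part S (X w) l) * indicator (?A (b(i := s))) w \<partial>M)"
            by (rule nn_integral_cmult) measurable
          also have "\<dots> \<le> ?w s * ennreal (real ((card S + l - 1) choose l) * exp (- (\<Sum>k\<in>I. (b(i := s)) k)))"
            using insert.prems insert.hyps True by (intro mult_left_mono insert.IH) auto
          also have "real ((card S + l - 1) choose l) * exp (- (\<Sum>k\<in>I. (b(i := s)) k)) = C l * exp (- s)"
            unfolding sm C_def by (simp add: mult.assoc mult_exp_exp)
          also have "?w s * ennreal (C l * exp (- s))
              = ennreal (C l / fact m) * (ennreal (s ^ m * exp (- s)) * indicator {0..} s)"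
            using True C0[of l] by (simp add: ennreal_mult[symmetric] field_simps)
          finally show ?thesis .
        qed simp
      qed
      also have "\<dots> = ennreal (C l / fact m) * (\<integral>\<^sup>+s. ennreal (s ^ m * exp (- s)) * indicator {0..} s
          \<partial>lborel)"
        by (rule nn_integral_cmult) measurable
      also have "\<dots> = ennreal (C l)"
        unfolding nn_intergal_power_times_exp_Ici using C0[of l] by (simp add: ennreal_mult[symmetric])
      finally show ?thesis .
    qed
    have "(\<integral>\<^sup>+w. ennreal (even_part (insert i S) (X w) k) * indicator (?A b) w \<partial>M)
       = (\<integral>\<^sup>+w. (\<Sum>j=0..k. ennreal (X w i ^ (2 * j) / fact (2 * j) * even_part S (X w) (k - j)) *
           indicator (?A b) w) \<partial>M)"
      using insert.hyps by (intro nn_integral_cong)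
        (simp add: even_part_insert sum_distrib_right[symmetric] even_part_nonneg sum_ennreal)
    also have "\<dots> = (\<Sum>j=0..k. \<integral>\<^sup>+w. ennreal (X w i ^ (2 * j) / fact (2 * j) * even_part S (X w) (k -
        j)) * indicator (?A b) w \<partial>M)"
      by (rule nn_integral_sum) measurable
    also have "\<dots> \<le> (\<Sum>j=0..k. ennreal (C (k - j)))" by (intro sum_mono term_le)
    also have "\<dots> = ennreal (\<Sum>j=0..k. C (k - j))" by (simp add: sum_ennreal C0)
    also have "(\<Sum>j=0..k. C (k - j)) = real (\<Sum>j=0..k. (card S + (k - j) - 1) choose (k - j)) * exp (-
        (\<Sum>i\<in>I. b i))"
      by (simp add: C_def sum_distrib_right)
    also note sum_choose_card
    finally show ?case using insert.hyps by simp
  qed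
qed

lemma nn_integral_gamma_shift:
  assumes "0 \<le> b"
  shows "(\<integral>\<^sup>+r. ennreal ((max 0 (r - b)) ^ n * exp (- r) / fact n) * indicator {b..} r \<partial>lborel)
      = ennreal (exp (- b))"
proof -
  have "(\<integral>\<^sup>+r. ennreal ((max 0 (r - b)) ^ n * exp (- r) / fact n) * indicator {b..} r \<partial>lborel)
     = (\<integral>\<^sup>+r. ennreal ((max 0 (b + 1 * r - b)) ^ n * exp (- (b + 1 * r)) / fact n) * indicator {b..}
         (b + 1 * r) \<partial>lborel)"
    by (subst nn_integral_real_affine[of _ 1 b]) auto
  also have "\<dots> = (\<integral>\<^sup>+r. ennreal (exp (- b) / fact n) * (ennreal (r ^ n * exp (- r)) * indicator {0..}
      r) \<partial>lborel)"
    by (intro nn_integral_cong) (auto simp: ennreal_mult[symmetric] mult_exp_exp max_def mult.commute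
        split: split_indicator)
  also have "\<dots> = ennreal (exp (- b) / fact n) * (\<integral>\<^sup>+r. ennreal (r ^ n * exp (- r)) * indicator {0..} r
      \<partial>lborel)"
    by (rule nn_integral_cmult) measurable
  also have "\<dots> = ennreal (exp (- b))"
    unfolding nn_intergal_power_times_exp_Ici by (simp add: ennreal_mult[symmetric])
  finally show ?thesis .
qed

context convex_corner
begin

text \<open>
  A tail of the form \<open>(1 - c \<Sum>a\<^sub>i) ^ n\<close> becomes purely exponential when the random point is
  multiplied by an independent Gamma variable of parameter \<open>n + 1\<close>. For the rescaled point the
  product bound applies, and since the even part is homogeneous of degree \<open>2 * k\<close>, undoing the
  rescaling costs exactly one Gamma moment.
\<close>

theorem even_part_moment_le:
  assumes m2: "\<And>i. (\<integral>\<^sup>+x. ennreal ((x $ i)\<^sup>2) \<partial>U) \<le> ennreal (1 / 2)"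
  defines "n \<equiv> CARD('n)"
  shows "(\<integral>\<^sup>+x. ennreal (even_part UNIV (\<lambda>i. x $ i) k) \<partial>U)
    \<le> ennreal (fact n / fact (n + 2 * k) * (5 / 4 * real n) ^ (2 * k) * real ((n + k - 1) choose k))"
proof -
  have n: "0 < n" by (simp add: n_def)
  \<comment> \<open>The factor that normalizes the exponential tail of the rescaled point to rate 1.\<close>
  define c where "c = 4 / 5 / real n"
  have c: "0 < c" using n by (simp add: c_def)
  \<comment> \<open>The density of the Gamma distribution with parameter \<open>n + 1\<close>.\<close>
  define f where "f r = ennreal (r ^ n * exp (- r) / fact n) * indicator {0..} r" for r :: real
  have [measurable]: "f \<in> borel_measurable borel" unfolding f_def by measurable
  define G where "G = density lborel f"
  have fint: "(\<integral>\<^sup>+r. f r * ennreal (r ^ m) \<partial>lborel) = ennreal (fact (n + m) / fact n)" for m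
  proof -
    have "(\<integral>\<^sup>+r. f r * ennreal (r ^ m) \<partial>lborel)
       = (\<integral>\<^sup>+r. ennreal (1 / fact n) * (ennreal (r ^ (n + m) * exp (- r)) * indicator {0..} r) \<partial>lborel)"
      by (intro nn_integral_cong) (auto simp: f_def ennreal_mult[symmetric] power_add field_simps
          split: split_indicator)
    also have "\<dots> = ennreal (1 / fact n) * (\<integral>\<^sup>+r. ennreal (r ^ (n + m) * exp (- r)) * indicator {0..} r
        \<partial>lborel)"
      by (rule nn_integral_cmult) measurable
    finally show ?thesis unfolding nn_intergal_power_times_exp_Ici by (simp add: ennreal_mult[symmetric])
  qed
  interpret G: prob_space G
  proof
    show "emeasure G (space G) = 1"
      using fint[of 0] by (simp add: G_def emeasure_density)
  qed
  interpret GU: pair_sigma_finite G U by standard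
  have [measurable_cong, simp]: "sets G = sets borel" by (simp add: G_def)
  have [simp]: "space G = UNIV" by (simp add: G_def)
  define X where "X p i = c * (fst p * snd p $ i)" for p :: "real \<times> (real ^ 'n)" and i
  have Xm [measurable]: "(\<lambda>p. X p i) \<in> borel_measurable (G \<Otimes>\<^sub>M U)" for i
    unfolding X_def by measurable
  have tl: "emeasure (G \<Otimes>\<^sub>M U) {p \<in> space (G \<Otimes>\<^sub>M U). \<forall>i\<in>UNIV. b i \<le> X p i} \<le> ennreal (exp (- (\<Sum>i\<in>UNIV.
      b i)))"
    if b: "\<And>i. 0 \<le> b i" for b
  proof -
    let ?A = "{p \<in> space (G \<Otimes>\<^sub>M U). \<forall>i\<in>UNIV. b i \<le> X p i}"
    define B where "B = (\<Sum>i\<in>UNIV. b i)"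
    have B0: "0 \<le> B" using b by (simp add: B_def sum_nonneg)
    have Am: "?A \<in> sets (G \<Otimes>\<^sub>M U)" by (rule sets.sets_Collect_finite_All) (use finite in measurable)
    have "emeasure (G \<Otimes>\<^sub>M U) ?A = (\<integral>\<^sup>+r. emeasure U (Pair r -` ?A) \<partial>G)"
      by (rule emeasure_pair_measure_alt[OF Am])
    also have "\<dots> = (\<integral>\<^sup>+r. f r * emeasure U (Pair r -` ?A) \<partial>lborel)"
    proof -
      have "(\<lambda>r. emeasure U (Pair r -` ?A)) \<in> borel_measurable G"
        using Am by (rule measurable_emeasure_Pair)
      then show ?thesis unfolding G_def by (subst nn_integral_density) (auto simp: G_def[symmetric])
    qed
    also have "\<dots> \<le> (\<integral>\<^sup>+r. ennreal ((max 0 (r - B)) ^ n * exp (- r) / fact n) * indicator {B..} r \<partial>lborel)"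
    proof (rule nn_integral_mono_AE, rule AE_mp[OF AE_lborel_singleton[of 0]], rule AE_I2, rule impI)
      fix r :: real assume "r \<noteq> 0"
      show "f r * emeasure U (Pair r -` ?A) \<le> ennreal ((max 0 (r - B)) ^ n * exp (- r) / fact n) *
          indicator {B..} r"
      proof (cases "0 < r")
        case True
        define a where "a = (\<chi> i. b i / (c * r))"
        have "Pair r -` ?A = {x. \<forall>i. a $ i \<le> x $ i}"
          using True c by (auto simp: space_pair_measure X_def a_def field_simps)
        then have "emeasure U (Pair r -` ?A) = ennreal (tail a)"
          by (simp add: tail_def emeasure_eq_measure)
        also have "tail a \<le> (max 0 (1 - 4 / 5 * (\<Sum>i\<in>UNIV. a $ i) / real CARD('n))) ^ CARD('n)"
        proof (rule tail_le[of "1 / 100"])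
          show "4 / 5 * s \<le> measure U {x. x $ i < s}" if "0 \<le> s" "s \<le> 1 / 100" for i s
            using slab_lower_bound[OF m2 that] .
          show "0 \<le> a $ i" for i using b True c by (simp add: a_def)
        qed auto
        also have "(\<Sum>i\<in>UNIV. a $ i) = B / (c * r)"
          by (simp add: a_def B_def sum_divide_distrib)
        also have "4 / 5 * (B / (c * r)) / real CARD('n) = B / r"
          using n True by (simp add: c_def n_def)
        finally have e: "emeasure U (Pair r -` ?A) \<le> ennreal ((max 0 (1 - B / r)) ^ n)"
          by (simp add: n_def ennreal_leI)
        have "f r * emeasure U (Pair r -` ?A) \<le> f r * ennreal ((max 0 (1 - B / r)) ^ n)"
          by (intro mult_left_mono e) simp
        also have "\<dots> = ennreal ((r * max 0 (1 - B / r)) ^ n * exp (- r) / fact n)"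
          using True by (simp add: f_def ennreal_mult[symmetric] power_mult_distrib)
        also have "r * max 0 (1 - B / r) = max 0 (r - B)"
          using True by (auto simp: max_def field_simps)
        also have "ennreal ((max 0 (r - B)) ^ n * exp (- r) / fact n)
           = ennreal ((max 0 (r - B)) ^ n * exp (- r) / fact n) * indicator {B..} r"
          using n by (auto simp: indicator_def max_def)
        finally show ?thesis .
      qed (use \<open>r \<noteq> 0\<close> in \<open>simp add: f_def\<close>)
    qed
    also have "\<dots> = ennreal (exp (- B))" by (rule nn_integral_gamma_shift[OF B0])
    finally show ?thesis by (simp add: B_def)
  qed
  have "(\<integral>\<^sup>+p. ennreal (even_part UNIV (X p) k) * indicator {p \<in> space (G \<Otimes>\<^sub>M U). \<forall>i\<in>UNIV. 0 \<le> X p i}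
      p \<partial>(G \<Otimes>\<^sub>M U))
     \<le> ennreal (real ((card (UNIV::'n set) + k - 1) choose k) * exp (- (\<Sum>i\<in>(UNIV::'n set). 0)))"
    using tl by (intro nn_integral_even_part_le) (auto intro: GU.P.sigma_finite_measure_axioms)
  then have up: "(\<integral>\<^sup>+p. ennreal (even_part UNIV (X p) k) * indicator {p \<in> space (G \<Otimes>\<^sub>M U). \<forall>i\<in>UNIV. 0
      \<le> X p i} p \<partial>(G \<Otimes>\<^sub>M U))
     \<le> ennreal (real ((n + k - 1) choose k))" by (simp add: n_def)
  define E where "E = (\<integral>\<^sup>+x. ennreal (even_part UNIV (\<lambda>i. x $ i) k) \<partial>U)"
  have [measurable]: "(\<lambda>x::real^'n. even_part UNIV (\<lambda>i. x $ i) k) \<in> borel_measurable borel"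
    by measurable
  have "ennreal (fact (n + 2 * k) / fact n * c ^ (2 * k)) * E
     = ennreal (c ^ (2 * k)) * (\<integral>\<^sup>+r. f r * ennreal (r ^ (2 * k)) \<partial>lborel) * E"
    using c by (simp add: fint ennreal_mult'[symmetric] mult.commute)
  also have "\<dots> = (\<integral>\<^sup>+r. f r * (ennreal ((c * r) ^ (2 * k)) * E) \<partial>lborel)"
  proof -
    have rw: "ennreal ((c * r) ^ (2 * k)) = ennreal (c ^ (2 * k)) * ennreal (r ^ (2 * k))" for r
      by (simp add: power_mult_distrib ennreal_mult')
    have "(\<integral>\<^sup>+r. f r * (ennreal ((c * r) ^ (2 * k)) * E) \<partial>lborel)
       = (\<integral>\<^sup>+r. ennreal (c ^ (2 * k)) * (f r * ennreal (r ^ (2 * k))) * E \<partial>lborel)"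
      unfolding rw by (intro nn_integral_cong) (simp only: ac_simps)
    also have "\<dots> = (\<integral>\<^sup>+r. ennreal (c ^ (2 * k)) * (f r * ennreal (r ^ (2 * k))) \<partial>lborel) * E"
      by (rule nn_integral_multc) measurable
    also have "(\<integral>\<^sup>+r. ennreal (c ^ (2 * k)) * (f r * ennreal (r ^ (2 * k))) \<partial>lborel)
       = ennreal (c ^ (2 * k)) * (\<integral>\<^sup>+r. f r * ennreal (r ^ (2 * k)) \<partial>lborel)"
      by (rule nn_integral_cmult) measurable
    finally show ?thesis ..
  qed
  also have "\<dots> = (\<integral>\<^sup>+r. ennreal ((c * r) ^ (2 * k)) * E \<partial>G)"
    unfolding G_def by (subst nn_integral_density) auto
  also have "\<dots> = (\<integral>\<^sup>+r. (\<integral>\<^sup>+x. ennreal (even_part UNIV (X (r, x)) k) \<partial>U) \<partial>G)"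
  proof (rule nn_integral_cong)
    fix r
    have "(\<integral>\<^sup>+x. ennreal (even_part UNIV (X (r, x)) k) \<partial>U)
        = (\<integral>\<^sup>+x. ennreal ((c * r) ^ (2 * k)) * ennreal (even_part UNIV (\<lambda>i. x $ i) k) \<partial>U)"
      unfolding X_def by (simp add: mult.assoc[symmetric] even_part_scale ennreal_mult even_part_nonneg)
    then show "ennreal ((c * r) ^ (2 * k)) * E = (\<integral>\<^sup>+x. ennreal (even_part UNIV (X (r, x)) k) \<partial>U)"
      by (simp add: nn_integral_cmult E_def)
  qed
  also have "\<dots> = (\<integral>\<^sup>+r. (\<integral>\<^sup>+x. ennreal (even_part UNIV (X (r, x)) k) * indicator {p \<in> space (G \<Otimes>\<^sub>M U).
      \<forall>i\<in>UNIV. 0 \<le> X p i} (r, x) \<partial>U) \<partial>G)"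
  proof (rule nn_integral_cong_AE)
    have "AE r in G. 0 \<le> r" unfolding G_def by (subst AE_density) (auto simp: f_def indicator_def)
    then show "AE r in G. (\<integral>\<^sup>+x. ennreal (even_part UNIV (X (r, x)) k) \<partial>U)
       = (\<integral>\<^sup>+x. ennreal (even_part UNIV (X (r, x)) k) * indicator {p \<in> space (G \<Otimes>\<^sub>M U). \<forall>i\<in>UNIV. 0 \<le> X
           p i} (r, x) \<partial>U)"
    proof (rule eventually_mono)
      fix r :: real assume "0 \<le> r"
      then show "(\<integral>\<^sup>+x. ennreal (even_part UNIV (X (r, x)) k) \<partial>U)
       = (\<integral>\<^sup>+x. ennreal (even_part UNIV (X (r, x)) k) * indicator {p \<in> space (G \<Otimes>\<^sub>M U). \<forall>i\<in>UNIV. 0 \<le> X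
           p i} (r, x) \<partial>U)"
        using c by (intro nn_integral_cong_AE eventually_mono[OF AE_U])
          (auto simp: indicator_def space_pair_measure X_def nonneg)
    qed
  qed
  also have "\<dots> = (\<integral>\<^sup>+p. ennreal (even_part UNIV (X p) k) * indicator {p \<in> space (G \<Otimes>\<^sub>M U). \<forall>i\<in>UNIV. 0
      \<le> X p i} p \<partial>(G \<Otimes>\<^sub>M U))"
    by (rule nn_integral_fst) measurable
  also note up
  finally have fin: "ennreal (fact (n + 2 * k) / fact n * c ^ (2 * k)) * E \<le> ennreal (real ((n + k -
      1) choose k))" .
  define q where "q = fact (n + 2 * k) / fact n * c ^ (2 * k)"
  have q: "0 < q" using c by (simp add: q_def)
  have "E = ennreal (1 / q) * (ennreal q * E)" using q
      by (simp add: mult.assoc[symmetric] ennreal_mult[symmetric])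
  also have "\<dots> \<le> ennreal (1 / q) * ennreal (real ((n + k - 1) choose k))"
    using fin by (intro mult_left_mono) (auto simp: q_def)
  also have "\<dots> = ennreal (1 / q * real ((n + k - 1) choose k))" using q
      by (simp add: ennreal_mult[symmetric])
  also have "1 / q = fact n / fact (n + 2 * k) * (5 / 4 * real n) ^ (2 * k)"
    using n by (simp add: q_def c_def power_divide power_mult_distrib field_simps)
  finally show ?thesis by (simp add: E_def)
qed

end

section \<open>Moments of isotropic unconditional bodies\<close>

lemma coord_reflection_nth: "coord_reflection i x $ j = (if j = i then - x $ j else x $ j)"
  by (simp add: coord_reflection_def)

lemma coord_reflection_involution [simp]: "coord_reflection i (coord_reflection i x) = x"
  by (simp add: vec_eq_iff coord_reflection_nth)

lemma coord_reflection_measurable [measurable]: "coord_reflection i \<in> borel \<rightarrow>\<^sub>M borel"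
proof (rule borel_measurable_continuous_onI)
  have "(\<lambda>x. \<chi> j. if j = i then - x $ j else x $ j) = (\<lambda>x. \<chi> j. (if j = i then - 1 else 1 :: real) * x $ j)"
    by (auto simp: fun_eq_iff vec_eq_iff)
  then show "continuous_on UNIV (coord_reflection i)"
    unfolding coord_reflection_def by (simp only:) (intro continuous_intros)
qed

lemma nn_integral_coord_reflection:
  fixes f :: "real ^ 'n \<Rightarrow> ennreal"
  assumes [measurable]: "f \<in> borel_measurable borel"
  shows "(\<integral>\<^sup>+x. f (coord_reflection i x) \<partial>lborel) = (\<integral>\<^sup>+x. f x \<partial>lborel)"
proof -
  define c where "c b = (if b = axis i 1 then - 1 else 1 :: real)" for b :: "real ^ 'n"
  have T: "(\<lambda>x. 0 + (\<Sum>j\<in>Basis. (c j * (x \<bullet> j)) *\<^sub>R j)) = coord_reflection i"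
  proof (rule ext)
    fix x :: "real ^ 'n"
    have "0 + (\<Sum>j\<in>Basis. (c j * (x \<bullet> j)) *\<^sub>R j) = (\<Sum>j\<in>Basis. (coord_reflection i x \<bullet> j) *\<^sub>R j)"
      by (simp, rule sum.cong)
        (auto simp: Basis_vec_def c_def coord_reflection_nth inner_axis axis_eq_axis)
    then show "0 + (\<Sum>j\<in>Basis. (c j * (x \<bullet> j)) *\<^sub>R j) = coord_reflection i x"
      by (simp only: euclidean_representation)
  qed
  have one: "(\<Prod>j\<in>Basis. \<bar>c j\<bar>) = 1" by (rule prod.neutral) (simp add: c_def)
  have "lborel = density (distr lborel borel (coord_reflection i)) (\<lambda>_. ennreal (\<Prod>j\<in>Basis. \<bar>c j\<bar>))"
    unfolding T[symmetric] by (rule lborel_affine_euclidean) (simp add: c_def)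
  then have "(lborel :: (real ^ 'n) measure) = distr lborel borel (coord_reflection i)"
    unfolding one by (simp add: density_1)
  then have "(\<integral>\<^sup>+x. f x \<partial>lborel) = (\<integral>\<^sup>+x. f x \<partial>distr lborel borel (coord_reflection i))" by simp
  also have "\<dots> = (\<integral>\<^sup>+x. f (coord_reflection i x) \<partial>lborel)"
    by (rule nn_integral_distr) auto
  finally show ?thesis ..
qed

text \<open>
  Averaging the binomial expansion over the sign of \<open>a\<close> leaves the even powers.
\<close>

lemma even_binomial_sum:
  fixes a b :: real
  shows "((a + b) ^ (2 * k) + (- a + b) ^ (2 * k)) / 2
    = fact (2 * k) * (\<Sum>j=0..k. a ^ (2 * j) / fact (2 * j) * (b ^ (2 * (k - j)) / fact (2 * (k - j))))"
proof -
  let ?g = "\<lambda>l. real ((2 * k) choose l) * a ^ l * b ^ (2 * k - l)"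
  have "(a + b) ^ (2 * k) + (- a + b) ^ (2 * k) = (\<Sum>l\<le>2 * k. ?g l + (- 1) ^ l * ?g l)"
    unfolding binomial_ring sum.distrib by (simp add: power_minus[of a] mult.assoc mult.left_commute)
  also have "\<dots> = (\<Sum>l\<in>(\<lambda>j. 2 * j) ` {0..k}. 2 * ?g l)"
  proof (rule sum.mono_neutral_cong_right)
    show "\<forall>l\<in>{..2 * k} - (\<lambda>j. 2 * j) ` {0..k}. ?g l + (- 1) ^ l * ?g l = 0"
    proof
      fix l assume l: "l \<in> {..2 * k} - (\<lambda>j. 2 * j) ` {0..k}"
      have "odd l"
      proof
        assume "even l"
        then obtain j where "l = 2 * j" by (elim evenE)
        then show False using l by auto
      qed
      then show "?g l + (- 1) ^ l * ?g l = 0" by simp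
    qed
  qed auto
  also have "\<dots> = (\<Sum>j=0..k. 2 * ?g (2 * j))"
    by (subst sum.reindex) (auto simp: inj_on_def)
  also have "\<dots> = 2 * (fact (2 * k) * (\<Sum>j=0..k. a ^ (2 * j) / fact (2 * j) * (b ^ (2 * (k - j)) / fact
      (2 * (k - j)))))"
    unfolding sum_distrib_left
  proof (rule sum.cong)
    fix j assume "j \<in> {0..k}"
    then have j: "2 * j \<le> 2 * k" "2 * k - 2 * j = 2 * (k - j)" by auto
    show "2 * ?g (2 * j) = 2 * (fact (2 * k) * (a ^ (2 * j) / fact (2 * j) * (b ^ (2 * (k - j)) / fact
        (2 * (k - j)))))"
      unfolding binomial_fact[OF j(1)] j(2) by simp
  qed simp
  finally show ?thesis by simp
qed

text \<open>
  Averages over the reflections in the coordinates of \<open>S\<close>, one coordinate at a time. The weight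
  \<open>h\<close> absorbs the even powers of the coordinates already treated; they are invariant under the
  remaining reflections. All terms being even powers, the argument stays within nonnegative
  integrals.
\<close>

lemma nn_integral_sum_power_even_part:
  fixes h :: "real ^ 'n \<Rightarrow> ennreal" and \<theta> :: "'n \<Rightarrow> real"
  assumes "finite S" "h \<in> borel_measurable borel" "\<And>i x. i \<in> S \<Longrightarrow> h (coord_reflection i x) = h x"
  shows "(\<integral>\<^sup>+x. h x * ennreal ((\<Sum>i\<in>S. \<theta> i * x $ i) ^ (2 * k)) \<partial>lborel)
    = (\<integral>\<^sup>+x. h x * ennreal (fact (2 * k) * even_part S (\<lambda>i. \<theta> i * x $ i) k) \<partial>lborel)"
  using assms
proof (induction S arbitrary: h k rule: finite_induct)
  case empty
  then show ?case by (cases "k = 0") (auto simp: even_part_empty power_0_left)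
next
  case (insert i S)
  note [measurable] = insert.prems(1)
  let ?s = "\<lambda>x. \<Sum>i\<in>S. \<theta> i * x $ i"
  let ?c = "\<lambda>x j. (\<theta> i * x $ i) ^ (2 * j) / fact (2 * j)"
  have em [measurable]: "(\<lambda>x. even_part S (\<lambda>i. \<theta> i * x $ i) l) \<in> borel_measurable borel" for l
    using insert.hyps by measurable
  have sr: "?s (coord_reflection i x) = ?s x" for x
    using insert.hyps by (intro sum.cong) (auto simp: coord_reflection_nth)
  let ?f = "\<lambda>e x. h x * ennreal ((e * (\<theta> i * x $ i) + ?s x) ^ (2 * k))"
  have e0: "0 \<le> (y::real) ^ (2 * k)" for y k by (simp add: zero_le_even_power)
  have "(\<integral>\<^sup>+x. h x * ennreal ((\<Sum>i\<in>insert i S. \<theta> i * x $ i) ^ (2 * k)) \<partial>lborel) = (\<integral>\<^sup>+x. ?f 1 x \<partial>lborel)"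
    using insert.hyps by simp
  also have "(\<integral>\<^sup>+x. ?f 1 x \<partial>lborel) = (\<integral>\<^sup>+x. ennreal (1 / 2) * (?f 1 x + ?f (- 1) x) \<partial>lborel)"
  proof -
    have "(\<integral>\<^sup>+x. ?f 1 x \<partial>lborel) = (\<integral>\<^sup>+x. ?f 1 (coord_reflection i x) \<partial>lborel)"
      by (rule nn_integral_coord_reflection[symmetric]) measurable
    also have "\<dots> = (\<integral>\<^sup>+x. ?f (- 1) x \<partial>lborel)"
      unfolding sr using insert.prems by (simp add: coord_reflection_nth)
    finally have eq: "(\<integral>\<^sup>+x. ?f 1 x \<partial>lborel) = (\<integral>\<^sup>+x. ?f (- 1) x \<partial>lborel)" .
    have "(\<integral>\<^sup>+x. ennreal (1 / 2) * (?f 1 x + ?f (- 1) x) \<partial>lborel)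
      = ennreal (1 / 2) * ((\<integral>\<^sup>+x. ?f 1 x \<partial>lborel) + (\<integral>\<^sup>+x. ?f (- 1) x \<partial>lborel))"
      by (subst nn_integral_cmult, measurable) (subst nn_integral_add, measurable)
    also have "\<dots> = (ennreal (1 / 2) * 2) * (\<integral>\<^sup>+x. ?f 1 x \<partial>lborel)"
      unfolding eq[symmetric] by (simp only: mult_2[symmetric] mult.assoc)
    also have "ennreal (1 / 2) * 2 = 1"
    proof -
      have "ennreal (1 / 2) * 2 = ennreal (1 / 2) * ennreal 2" by (simp only: ennreal_numeral)
      also have "\<dots> = ennreal (1 / 2 * 2)" by (rule ennreal_mult[symmetric]) auto
      finally show ?thesis by simp
    qed
    finally show ?thesis by simp
  qed
  also have "\<dots> = (\<integral>\<^sup>+x. (\<Sum>j=0..k. (h x * ennreal (fact (2 * k) / fact (2 * (k - j)) * ?c x j)) *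
      ennreal (?s x ^ (2 * (k - j)))) \<partial>lborel)"
  proof (rule nn_integral_cong)
    fix x
    have "ennreal (1 / 2) * (?f 1 x + ?f (- 1) x)
      = h x * ennreal (((\<theta> i * x $ i + ?s x) ^ (2 * k) + (- (\<theta> i * x $ i) + ?s x) ^ (2 * k)) / 2)"
    proof -
      have "ennreal (((\<theta> i * x $ i + ?s x) ^ (2 * k) + (- (\<theta> i * x $ i) + ?s x) ^ (2 * k)) / 2)
        = ennreal (1 / 2) * (ennreal ((\<theta> i * x $ i + ?s x) ^ (2 * k)) + ennreal ((- (\<theta> i * x $ i) + ?s
            x) ^ (2 * k)))"
        by (subst ennreal_plus[symmetric, OF e0 e0], subst ennreal_mult[symmetric]) (auto intro:
            add_nonneg_nonneg e0)
      then show ?thesis by (simp only: distrib_left mult_1_left mult_minus_left ac_simps)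
    qed
    also have "\<dots> = h x * ennreal (\<Sum>j=0..k. fact (2 * k) / fact (2 * (k - j)) * ?c x j * ?s x ^ (2 * (k
        - j)))"
      unfolding even_binomial_sum sum_distrib_left by (simp add: field_simps)
    also have "\<dots> = h x * (\<Sum>j=0..k. ennreal (fact (2 * k) / fact (2 * (k - j)) * ?c x j * ?s x ^ (2 *
        (k - j))))"
      by (subst sum_ennreal) (auto intro!: mult_nonneg_nonneg divide_nonneg_nonneg e0)
    also have "\<dots> = (\<Sum>j=0..k. (h x * ennreal (fact (2 * k) / fact (2 * (k - j)) * ?c x j)) * ennreal
        (?s x ^ (2 * (k - j))))"
      unfolding sum_distrib_left
      by (intro sum.cong refl, subst ennreal_mult'[of "_ * _"]) (auto simp: mult.assoc intro!:
          mult_nonneg_nonneg divide_nonneg_nonneg e0)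
    finally show "ennreal (1 / 2) * (?f 1 x + ?f (- 1) x)
      = (\<Sum>j=0..k. (h x * ennreal (fact (2 * k) / fact (2 * (k - j)) * ?c x j)) * ennreal (?s x ^ (2 *
          (k - j))))" .
  qed
  also have "\<dots> = (\<Sum>j=0..k. \<integral>\<^sup>+x. (h x * ennreal (fact (2 * k) / fact (2 * (k - j)) * ?c x j)) *
      ennreal (?s x ^ (2 * (k - j))) \<partial>lborel)"
    by (rule nn_integral_sum) measurable
  also have "\<dots> = (\<Sum>j=0..k. \<integral>\<^sup>+x. (h x * ennreal (fact (2 * k) / fact (2 * (k - j)) * ?c x j))
      * ennreal (fact (2 * (k - j)) * even_part S (\<lambda>i. \<theta> i * x $ i) (k - j)) \<partial>lborel)"
  proof (rule sum.cong[OF refl], rule insert.IH)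
    fix j
    show "(\<lambda>x. h x * ennreal (fact (2 * k) / fact (2 * (k - j)) * ?c x j)) \<in> borel_measurable borel"
        by measurable
    fix l x assume "l \<in> S"
    then show "h (coord_reflection l x) * ennreal (fact (2 * k) / fact (2 * (k - j)) * ?c
        (coord_reflection l x) j)
        = h x * ennreal (fact (2 * k) / fact (2 * (k - j)) * ?c x j)"
      using insert.prems(2)[of l x] insert.hyps by (auto simp: coord_reflection_nth)
  qed
  also have "\<dots> = (\<integral>\<^sup>+x. (\<Sum>j=0..k. (h x * ennreal (fact (2 * k) / fact (2 * (k - j)) * ?c x j))
      * ennreal (fact (2 * (k - j)) * even_part S (\<lambda>i. \<theta> i * x $ i) (k - j))) \<partial>lborel)"
    by (rule nn_integral_sum[symmetric]) measurable
  also have "\<dots> = (\<integral>\<^sup>+x. h x * ennreal (fact (2 * k) * even_part (insert i S) (\<lambda>i. \<theta> i * x $ i) k) \<partial>lborel)"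
  proof (rule nn_integral_cong)
    fix x
    have "(\<Sum>j=0..k. (h x * ennreal (fact (2 * k) / fact (2 * (k - j)) * ?c x j))
      * ennreal (fact (2 * (k - j)) * even_part S (\<lambda>i. \<theta> i * x $ i) (k - j)))
      = (\<Sum>j=0..k. h x * ennreal (fact (2 * k) * (?c x j * even_part S (\<lambda>i. \<theta> i * x $ i) (k - j))))"
    proof (rule sum.cong[OF refl])
      fix j
      have "ennreal (fact (2 * k) / fact (2 * (k - j)) * ?c x j) * ennreal (fact (2 * (k - j)) *
          even_part S (\<lambda>i. \<theta> i * x $ i) (k - j))
        = ennreal (fact (2 * k) / fact (2 * (k - j)) * ?c x j * (fact (2 * (k - j)) * even_part S (\<lambda>i.
            \<theta> i * x $ i) (k - j)))"
        using insert.hyps by (intro ennreal_mult[symmetric] mult_nonneg_nonneg divide_nonneg_nonneg e0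
            even_part_nonneg) auto
      also have "fact (2 * k) / fact (2 * (k - j)) * ?c x j * (fact (2 * (k - j)) * even_part S (\<lambda>i. \<theta>
          i * x $ i) (k - j))
        = fact (2 * k) * (?c x j * even_part S (\<lambda>i. \<theta> i * x $ i) (k - j))" by simp
      finally show "(h x * ennreal (fact (2 * k) / fact (2 * (k - j)) * ?c x j))
        * ennreal (fact (2 * (k - j)) * even_part S (\<lambda>i. \<theta> i * x $ i) (k - j))
        = h x * ennreal (fact (2 * k) * (?c x j * even_part S (\<lambda>i. \<theta> i * x $ i) (k - j)))"
        by (simp only: mult.assoc)
    qed
    also have "\<dots> = h x * ennreal (fact (2 * k) * even_part (insert i S) (\<lambda>i. \<theta> i * x $ i) k)"
      using insert.hyps unfolding sum_distrib_left[symmetric] even_part_insert[OF insert.hyps]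
      by (subst sum_ennreal) (auto simp: sum_distrib_left intro!: mult_nonneg_nonneg
          divide_nonneg_nonneg e0 even_part_nonneg)
    finally show "(\<Sum>j=0..k. (h x * ennreal (fact (2 * k) / fact (2 * (k - j)) * ?c x j))
      * ennreal (fact (2 * (k - j)) * even_part S (\<lambda>i. \<theta> i * x $ i) (k - j)))
      = h x * ennreal (fact (2 * k) * even_part (insert i S) (\<lambda>i. \<theta> i * x $ i) k)" .
  qed
  finally show ?case .
qed

lemma AE_coordinate_nonzero: "AE x::real^'n in lborel. x $ i \<noteq> 0"
proof -
  have "{x::real^'n. x $ i = 0} \<in> null_sets lebesgue"
    using negligible_standard_hyperplane_cart[of i] by (simp add: negligible_iff_null_sets)
  then have "{x::real^'n. x $ i = 0} \<in> null_sets lborel"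
    by (subst (asm) null_sets_completion_iff) simp_all
  then show ?thesis by (rule AE_I') auto
qed

lemma nn_integral_orthant:
  fixes h :: "real ^ 'n \<Rightarrow> ennreal"
  assumes "finite S" "h \<in> borel_measurable borel" "\<And>i x. h (coord_reflection i x) = h x"
  shows "(\<integral>\<^sup>+x. h x \<partial>lborel) = 2 ^ card S * (\<integral>\<^sup>+x. h x * indicator {x. \<forall>i\<in>S. 0 \<le> x $ i} x \<partial>lborel)"
  using assms(1)
proof (induction S rule: finite_induct)
  case (insert i S)
  note [measurable] = assms(2)
  have [measurable]: "{x::real^'n. \<forall>i\<in>S. 0 \<le> x $ i} \<in> sets borel" for S
    unfolding Ball_def by (intro borel_closed closed_Collect_all closed_Collect_imp open_Collect_const
        closed_Collect_le continuous_intros)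
  let ?g = "\<lambda>x. h x * indicator {x. \<forall>i\<in>S. 0 \<le> x $ i} x"
  let ?p = "\<lambda>x. ?g x * indicator {x. 0 \<le> x $ i} x"
  let ?m = "\<lambda>x. ?g x * indicator {x. x $ i < 0} x"
  have gr: "?g (coord_reflection i x) = ?g x" for x
    using insert.hyps assms(3) by (auto simp: indicator_def coord_reflection_nth)
  have "(\<integral>\<^sup>+x. ?g x \<partial>lborel) = (\<integral>\<^sup>+x. ?p x + ?m x \<partial>lborel)"
    by (intro nn_integral_cong) (auto simp: indicator_def)
  also have "\<dots> = (\<integral>\<^sup>+x. ?p x \<partial>lborel) + (\<integral>\<^sup>+x. ?m x \<partial>lborel)"
    by (rule nn_integral_add) measurable
  also have "(\<integral>\<^sup>+x. ?m x \<partial>lborel) = (\<integral>\<^sup>+x. ?m (coord_reflection i x) \<partial>lborel)"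
    by (rule nn_integral_coord_reflection[symmetric]) measurable
  also have "\<dots> = (\<integral>\<^sup>+x. ?p x \<partial>lborel)"
    unfolding gr by (rule nn_integral_cong_AE, rule AE_mp[OF AE_coordinate_nonzero[of i]], rule AE_I2)
      (auto simp: indicator_def coord_reflection_nth)
  also have "(\<integral>\<^sup>+x. ?p x \<partial>lborel) + (\<integral>\<^sup>+x. ?p x \<partial>lborel) = 2 * (\<integral>\<^sup>+x. ?p x \<partial>lborel)"
    by (simp add: mult_2)
  also have "?p = (\<lambda>x. h x * indicator {x. \<forall>i\<in>insert i S. 0 \<le> x $ i} x)"
    by (auto simp: fun_eq_iff indicator_def)
  finally show ?case using insert by (simp add: mult.assoc mult.left_commute)
qed simp

text \<open>
  Change the coordinates of \<open>x\<close> into those of \<open>y\<close> one at a time: the changed point is a convex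
  combination of the current point and its reflection.
\<close>

lemma unconditional_solid:
  assumes "convex K" "unconditional K" "x \<in> K" "\<And>i. \<bar>y $ i\<bar> \<le> \<bar>x $ i\<bar>"
  shows "y \<in> K"
proof -
  have "(\<chi> i. if i \<in> S then y $ i else x $ i) \<in> K" if "finite S" for S
    using that
  proof (induction S rule: finite_induct)
    case (insert i S)
    let ?z = "\<chi> i. if i \<in> S then y $ i else x $ i"
    have zi: "?z $ i = x $ i" using insert by simp
    have refl: "coord_reflection i ?z \<in> K" using insert.IH assms(2) unfolding unconditional_def by blast
    \<comment> \<open>The weight of the reflected point; if \<open>x $ i = 0\<close>, then \<open>y $ i = 0\<close> and any weight serves.\<close>
    define t where "t = (if x $ i = 0 then 0 else (1 - y $ i / x $ i) / 2)"
    have "\<bar>y $ i / x $ i\<bar> \<le> 1" if "x $ i \<noteq> 0" using assms(4)[of i] that unfolding abs_divide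
        by (simp add: divide_le_eq)
    then have "- 1 \<le> y $ i / x $ i" "y $ i / x $ i \<le> 1" if "x $ i \<noteq> 0" using that by linarith+
    then have t: "0 \<le> t" "t \<le> 1" by (auto simp: t_def)
    have "y $ i = (1 - t) * x $ i + t * (- x $ i)"
      using assms(4)[of i] by (auto simp: t_def field_simps)
    then have "(\<chi> j. if j \<in> insert i S then y $ j else x $ j)
        = (1 - t) *\<^sub>R ?z + t *\<^sub>R coord_reflection i ?z"
      using insert.hyps zi by (auto simp: vec_eq_iff coord_reflection_nth algebra_simps)
    also have "\<dots> \<in> K" using assms(1) insert.IH refl t by (intro convexD) auto
    finally show ?case .
  qed (use assms(3) in simp)
  from this[of UNIV] show ?thesis by simp
qed

lemma even_part_abs_cong:
  assumes "finite S" "\<And>i. i \<in> S \<Longrightarrow> \<bar>y i\<bar> = \<bar>z i\<bar>"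
  shows "even_part S y k = even_part S z k"
  using assms by (intro antisym even_part_mono_abs) auto

text \<open>
  Half of the work is the bound 1/2 for the squared isotropic constant. It combines three facts
  about the orthant part of the body: all coordinates have the same second moment, each second
  moment is at most twice the squared mean, and the box below the centroid has at most the volume
  \<open>2 ^ (- n)\<close> of the orthant part.
\<close>

theorem isotropic_unconditional_moment_le:
  fixes K :: "(real ^ 'n) set" and \<theta> :: "real ^ 'n"
  assumes iso: "isotropic K" and unc: "unconditional K"
  defines "n \<equiv> CARD('n)"
  shows "(\<integral>\<^sup>+x. ennreal ((x \<bullet> \<theta>) ^ (2 * k)) * indicator K x \<partial>lborel)
    \<le> ennreal (fact (2 * k) * infnorm \<theta> ^ (2 * k) *
        (fact n / fact (n + 2 * k) * (5 / 4 * real n) ^ (2 * k) * real ((n + k - 1) choose k)))"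
proof -
  have body: "compact K" "convex K" using iso by (auto simp: isotropic_def convex_body_def)
  have [measurable]: "K \<in> sets borel" using body by (intro borel_compact)
  have refl_mem: "coord_reflection i x \<in> K \<longleftrightarrow> x \<in> K" for i x
  proof -
    have "coord_reflection i ` K = K" using unc by (simp add: unconditional_def)
    then show ?thesis by (metis coord_reflection_involution imageI)
  qed
  have fin: "emeasure lborel K < \<infinity>" using body by (intro emeasure_compact_finite)
  have "measure lborel K = 1"
    using iso by (simp add: isotropic_def)
  then have vol: "emeasure lborel K = 1"
    using fin by (simp add: emeasure_eq_ennreal_measure less_top)
  define D where "D = K \<inter> {x. \<forall>i. 0 \<le> x $ i}"
  have oc: "closed {x::real^'n. \<forall>i. 0 \<le> x $ i}"
    by (intro closed_Collect_all closed_Collect_le continuous_intros)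
  have [measurable]: "D \<in> sets borel" unfolding D_def using borel_closed[OF oc] by measurable
  have KD: "(\<integral>\<^sup>+x. h x * indicator K x \<partial>lborel) = ennreal (2 ^ n) * (\<integral>\<^sup>+x. h x * indicator D x \<partial>lborel)"
    if [measurable]: "h \<in> borel_measurable borel" and "\<And>i x. h (coord_reflection i x) = h x" for h
  proof -
    have "(\<integral>\<^sup>+x. h x * indicator K x \<partial>lborel)
      = 2 ^ card (UNIV::'n set) * (\<integral>\<^sup>+x. h x * indicator K x * indicator {x. \<forall>i\<in>UNIV. 0 \<le> x $ i} x \<partial>lborel)"
      using that by (intro nn_integral_orthant) (auto simp: indicator_def refl_mem)
    also have "(\<integral>\<^sup>+x. h x * indicator K x * indicator {x. \<forall>i\<in>UNIV. 0 \<le> x $ i} x \<partial>lborel)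
        = (\<integral>\<^sup>+x. h x * indicator D x \<partial>lborel)"
      by (intro nn_integral_cong) (auto simp: indicator_def D_def)
    also have "(2::ennreal) ^ card (UNIV::'n set) = ennreal (2 ^ n)"
      by (simp add: n_def ennreal_power[symmetric])
    finally show ?thesis .
  qed
  have volD: "emeasure lborel D = ennreal ((1 / 2) ^ n)"
  proof -
    have "emeasure lborel D \<le> emeasure lborel K" by (intro emeasure_mono) (auto simp: D_def)
    then have "emeasure lborel D < \<infinity>" using fin by (rule le_less_trans)
    then obtain r where r: "emeasure lborel D = ennreal r" "0 \<le> r" by (cases "emeasure lborel D") auto
    have "1 = ennreal (2 ^ n) * emeasure lborel D" using KD[of "\<lambda>_. 1"] vol by simp
    also have "\<dots> = ennreal (2 ^ n * r)" using r by (simp add: ennreal_mult)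
    finally have "2 ^ n * r = 1" using r(2)
        by (metis ennreal_1 ennreal_inj mult_nonneg_nonneg zero_le_numeral zero_le_one zero_le_power)
    then have "r = (1 / 2) ^ n" by (simp add: field_simps power_divide)
    then show ?thesis using r by simp
  qed
  interpret convex_corner D
  proof
    show "compact D" unfolding D_def using body(1) oc by (rule compact_Int_closed)
    have "convex {x::real^'n. \<forall>i. 0 \<le> x $ i}"
      by (rule convexI) (auto intro!: add_nonneg_nonneg mult_nonneg_nonneg)
    then show "convex D" unfolding D_def using body(2) by (intro convex_Int)
    show "0 \<le> x $ i" if "x \<in> D" for x i using that by (simp add: D_def)
    show "x \<in> D" if "y \<in> D" "\<And>i. 0 \<le> x $ i \<and> x $ i \<le> y $ i" for x y
    proof -
      have "\<bar>x $ i\<bar> \<le> \<bar>y $ i\<bar>" for i using that(2)[of i] by simp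
      then have "x \<in> K" using that(1) unconditional_solid[OF body(2) unc, of y x] by (simp add: D_def)
      then show ?thesis using that by (simp add: D_def)
    qed
    show "emeasure lborel D \<noteq> 0" using volD by simp
  qed
  have UK: "(\<integral>\<^sup>+x. h x \<partial>U) = (\<integral>\<^sup>+x. h x * indicator K x \<partial>lborel)"
    if [measurable]: "h \<in> borel_measurable borel" and "\<And>i x. h (coord_reflection i x) = h x" for h
  proof -
    have "(\<integral>\<^sup>+x. h x \<partial>U) = (\<integral>\<^sup>+x. h x * indicator D x \<partial>lborel) / ennreal ((1 / 2) ^ n)"
      unfolding U_def by (subst nn_integral_uniform_measure) (auto simp: volD)
    also have "\<dots> = (\<integral>\<^sup>+x. h x * indicator D x \<partial>lborel) * ennreal (2 ^ n)"
      by (simp add: divide_ennreal_def inverse_ennreal power_one_over)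
    also have "\<dots> = (\<integral>\<^sup>+x. h x * indicator K x \<partial>lborel)" using KD[OF that] by (simp add: mult.commute)
    finally show ?thesis .
  qed
  obtain L where L: "\<And>\<theta>. \<theta> \<in> sphere 0 1 \<Longrightarrow> (LINT x:K|lebesgue. (x \<bullet> \<theta>)\<^sup>2) = L\<^sup>2"
    using iso unfolding isotropic_def by blast
  have second: "(\<integral>\<^sup>+x. ennreal ((x $ i)\<^sup>2) \<partial>U) = ennreal (L\<^sup>2)" for i
  proof -
    have "(LINT x:K|lebesgue. (x \<bullet> axis i 1)\<^sup>2) = L\<^sup>2" by (rule L) (simp add: norm_axis_1)
    then have "(LINT x|lebesgue. indicator K x *\<^sub>R (x $ i)\<^sup>2) = L\<^sup>2"
      by (simp add: set_lebesgue_integral_def inner_axis)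
    then have I: "(LINT x|lborel. indicator K x *\<^sub>R (x $ i)\<^sup>2) = L\<^sup>2"
      by (subst (asm) integral_completion) simp_all
    have "set_integrable lborel K (\<lambda>x. (x $ i)\<^sup>2)"
      using body(1) unfolding set_integrable_def
      by (intro borel_integrable_compact) (auto intro!: continuous_intros)
    then have "(\<integral>\<^sup>+x. ennreal (indicator K x *\<^sub>R (x $ i)\<^sup>2) \<partial>lborel) = ennreal (L\<^sup>2)"
      unfolding I[symmetric] set_integrable_def by (intro nn_integral_eq_integral) auto
    moreover have "(\<integral>\<^sup>+x. ennreal ((x $ i)\<^sup>2) \<partial>U) = (\<integral>\<^sup>+x. ennreal (indicator K x *\<^sub>R (x $ i)\<^sup>2) \<partial>lborel)"
      by (subst UK) (auto simp: coord_reflection_nth indicator_def intro!: nn_integral_cong)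
    ultimately show ?thesis by simp
  qed
  define m where "m i = expectation (\<lambda>x. x $ i)" for i
  have m0: "0 \<le> m i" for i unfolding m_def
    by (rule integral_nonneg_AE, rule eventually_mono[OF AE_U], rule nonneg)
  have mi: "L\<^sup>2 \<le> 2 * (m i)\<^sup>2" for i
  proof -
    have "(\<integral>\<^sup>+x. ennreal (x $ i) \<partial>U) = ennreal (m i)"
      unfolding m_def by (rule nn_integral_eq_integral[OF integrable_coordinate], rule
          eventually_mono[OF AE_U], rule nonneg)
    then have "ennreal (L\<^sup>2) \<le> 2 * (ennreal (m i))\<^sup>2"
      using second_moment_le[of i] second[of i] by simp
    also have "\<dots> = ennreal (2 * (m i)\<^sup>2)"
      using m0 by (simp add: ennreal_mult ennreal_power)
    finally show ?thesis using m0 by (subst (asm) ennreal_le_iff) auto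
  qed
  have "(L\<^sup>2) ^ n = (\<Prod>i\<in>(UNIV::'n set). L\<^sup>2)" by (simp add: n_def)
  also have "\<dots> \<le> (\<Prod>i\<in>UNIV. 2 * (m i)\<^sup>2)" by (intro prod_mono) (auto simp: mi)
  also have "\<dots> = 2 ^ n * (\<Prod>i\<in>UNIV. m i)\<^sup>2" by (simp add: prod.distrib n_def prod_power_distrib)
  also have "\<dots> \<le> 2 ^ n * ((1 / 2) ^ n)\<^sup>2"
  proof -
    have "(\<Prod>i\<in>UNIV. m i) \<le> (1 / 2) ^ n"
      using prod_expectation_le volD unfolding m_def measure_def by simp
    then show ?thesis using m0 by (intro mult_left_mono power_mono prod_nonneg) auto
  qed
  also have "\<dots> = (1 / 2) ^ n" by (simp add: power2_eq_square power_mult_distrib[symmetric]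
      mult.assoc[symmetric])
  finally have "L\<^sup>2 \<le> 1 / 2"
    by (subst (asm) power_mono_iff) (simp_all add: n_def)
  then have m2: "(\<integral>\<^sup>+x. ennreal ((x $ i)\<^sup>2) \<partial>U) \<le> ennreal (1 / 2)" for i
    unfolding second by (rule ennreal_leI)
  let ?M = "infnorm \<theta>"
  have M0: "0 \<le> ?M" by (simp add: infnorm_pos_le)
  have em [measurable]: "(\<lambda>x::real^'n. even_part UNIV (\<lambda>i. x $ i) k) \<in> borel_measurable borel"
    "(\<lambda>x::real^'n. even_part UNIV (\<lambda>i. \<theta> $ i * x $ i) k) \<in> borel_measurable borel"
    by measurable
  have "(\<integral>\<^sup>+x. ennreal ((x \<bullet> \<theta>) ^ (2 * k)) * indicator K x \<partial>lborel)
     = (\<integral>\<^sup>+x. indicator K x * ennreal ((\<Sum>i\<in>UNIV. \<theta> $ i * x $ i) ^ (2 * k)) \<partial>lborel)"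
    by (intro nn_integral_cong) (simp add: inner_vec_def mult.commute)
  also have "\<dots> = (\<integral>\<^sup>+x. indicator K x * ennreal (fact (2 * k) * even_part UNIV (\<lambda>i. \<theta> $ i * x $ i) k)
      \<partial>lborel)"
    by (rule nn_integral_sum_power_even_part) (auto simp: indicator_def refl_mem)
  also have "\<dots> \<le> (\<integral>\<^sup>+x. ennreal (fact (2 * k) * ?M ^ (2 * k)) * (ennreal (even_part UNIV (\<lambda>i. x $ i)
      k) * indicator K x) \<partial>lborel)"
  proof (rule nn_integral_mono)
    fix x :: "real ^ 'n"
    have "even_part UNIV (\<lambda>i. \<theta> $ i * x $ i) k \<le> even_part UNIV (\<lambda>i. ?M * x $ i) k"
      using M0 component_le_infnorm_cart[of \<theta>]
      by (intro even_part_mono_abs) (auto simp: abs_mult intro!: mult_right_mono)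
    also have "\<dots> = ?M ^ (2 * k) * even_part UNIV (\<lambda>i. x $ i) k" by (simp add: even_part_scale)
    finally have "fact (2 * k) * even_part UNIV (\<lambda>i. \<theta> $ i * x $ i) k \<le> (fact (2 * k) * ?M ^ (2 * k))
        * even_part UNIV (\<lambda>i. x $ i) k"
      by (simp add: mult.assoc)
    then have "ennreal (fact (2 * k) * even_part UNIV (\<lambda>i. \<theta> $ i * x $ i) k)
       \<le> ennreal (fact (2 * k) * ?M ^ (2 * k)) * ennreal (even_part UNIV (\<lambda>i. x $ i) k)"
      using M0 by (subst ennreal_mult[symmetric]) (auto intro!: ennreal_leI even_part_nonneg)
    then show "indicator K x * ennreal (fact (2 * k) * even_part UNIV (\<lambda>i. \<theta> $ i * x $ i) k)
      \<le> ennreal (fact (2 * k) * ?M ^ (2 * k)) * (ennreal (even_part UNIV (\<lambda>i. x $ i) k) * indicator K x)"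
      by (simp add: indicator_def)
  qed
  also have "\<dots> = ennreal (fact (2 * k) * ?M ^ (2 * k)) * (\<integral>\<^sup>+x. ennreal (even_part UNIV (\<lambda>i. x $ i) k)
      * indicator K x \<partial>lborel)"
    by (rule nn_integral_cmult) measurable
  also have "(\<integral>\<^sup>+x. ennreal (even_part UNIV (\<lambda>i. x $ i) k) * indicator K x \<partial>lborel)
      = (\<integral>\<^sup>+x. ennreal (even_part UNIV (\<lambda>i. x $ i) k) \<partial>U)"
  proof (rule UK[symmetric])
    show "ennreal (even_part UNIV (\<lambda>j. coord_reflection i x $ j) k)
        = ennreal (even_part UNIV (\<lambda>j. x $ j) k)" for i and x :: "real ^ 'n"
      by (rule arg_cong[of _ _ ennreal], rule even_part_abs_cong) (auto simp: coord_reflection_nth)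
  qed measurable
  also have "ennreal (fact (2 * k) * ?M ^ (2 * k)) * (\<integral>\<^sup>+x. ennreal (even_part UNIV (\<lambda>i. x $ i) k) \<partial>U)
     \<le> ennreal (fact (2 * k) * ?M ^ (2 * k)) * ennreal (fact n / fact (n + 2 * k) * (5 / 4 * real n) ^
         (2 * k) * real ((n + k - 1) choose k))"
    unfolding n_def by (intro mult_left_mono even_part_moment_le m2) simp
  also have "\<dots> = ennreal (fact (2 * k) * ?M ^ (2 * k) * (fact n / fact (n + 2 * k) * (5 / 4 * real n)
      ^ (2 * k) * real ((n + k - 1) choose k)))"
    using M0 by (intro ennreal_mult[symmetric]) auto
  finally show ?thesis .
qed

section \<open>Integration against the cone measure\<close>

definition gauge_fun :: "'a::euclidean_space set \<Rightarrow> 'a \<Rightarrow> real" where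
  "gauge_fun K x = Inf {r. 0 < r \<and> (1 / r) *\<^sub>R x \<in> K}"

text \<open>
  The gauge describes the body by its dilates and turns the cone measure into the image of
  Lebesgue measure on the body under radial projection to the boundary.
\<close>

locale origin_body =
  fixes K :: "'a::euclidean_space set"
  assumes compact: "compact K" and convex: "convex K" and zero_interior: "0 \<in> interior K"
begin

abbreviation "g \<equiv> gauge_fun K"

lemma K_borel [measurable]: "K \<in> sets borel"
  using compact by (intro borel_compact)

lemma zero_mem: "0 \<in> K"
  using zero_interior interior_subset by blast

lemma scale_mem: "x \<in> K \<Longrightarrow> 0 \<le> r \<Longrightarrow> r \<le> 1 \<Longrightarrow> r *\<^sub>R x \<in> K"
  using convexD[OF convex zero_mem, of x "1 - r" r] by simp

lemma gauge_set_nonempty: "{r. 0 < r \<and> (1 / r) *\<^sub>R x \<in> K} \<noteq> {}"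
proof -
  obtain e where e: "0 < e" "ball 0 e \<subseteq> K"
    using zero_interior mem_interior by blast
  have "norm ((e / (2 * (norm x + 1))) *\<^sub>R x) < e"
  proof -
    have eq: "norm ((e / (2 * N)) *\<^sub>R x) = e / 2 * (norm x / N)" if "0 < N" for N
      using e that by simp
    have "norm ((e / (2 * (norm x + 1))) *\<^sub>R x) = e / 2 * (norm x / (norm x + 1))"
      by (rule eq) (simp add: add_nonneg_pos)
    also have "\<dots> \<le> e / 2 * 1" using e by (intro mult_left_mono) (simp_all add: pos_divide_le_eq
        add_nonneg_pos)
    also have "\<dots> < e" using e by simp
    finally show ?thesis .
  qed
  then have "(1 / (2 * (norm x + 1) / e)) *\<^sub>R x \<in> K" using e by auto
  moreover have "0 < 2 * (norm x + 1) / e" using e by (simp add: add_nonneg_pos)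
  ultimately show ?thesis by blast
qed

lemma gauge_set_bdd: "bdd_below {r. 0 < r \<and> (1 / r) *\<^sub>R x \<in> K}"
  by (rule bdd_belowI[of _ 0]) auto

lemma gauge_nonneg: "0 \<le> g x"
  unfolding gauge_fun_def by (rule cInf_greatest[OF gauge_set_nonempty]) auto

text \<open>
  By closedness the infimum defining the gauge is attained, so the sublevel sets are the dilates.
\<close>

lemma gauge_le_iff:
  assumes r: "0 < r"
  shows "g x \<le> r \<longleftrightarrow> (1 / r) *\<^sub>R x \<in> K"
proof
  assume "(1 / r) *\<^sub>R x \<in> K"
  then show "g x \<le> r" unfolding gauge_fun_def using r gauge_set_bdd by (intro cInf_lower) auto
next
  assume gr: "g x \<le> r"
  have above: "(1 / s) *\<^sub>R x \<in> K" if s: "r < s" for s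
  proof -
    have "g x < s" using gr s by simp
    then obtain q where q: "0 < q" "(1 / q) *\<^sub>R x \<in> K" "q < s"
      unfolding gauge_fun_def using cInf_less_iff[OF gauge_set_nonempty gauge_set_bdd] by blast
    have "(q / s) *\<^sub>R ((1 / q) *\<^sub>R x) \<in> K" using q by (intro scale_mem[of "(1 / q) *\<^sub>R x"]) (auto
        simp del: scaleR_scaleR)
    then show ?thesis using q by simp
  qed
  have "(\<lambda>n. (1 / (r + 1 / real (Suc n))) *\<^sub>R x) \<longlonglongrightarrow> (1 / (r + 0)) *\<^sub>R x"
    using r by (intro tendsto_intros LIMSEQ_Suc lim_1_over_n) auto
  moreover have "(1 / (r + 1 / real (Suc n))) *\<^sub>R x \<in> K" for n
    by (rule above) simp
  ultimately show "(1 / r) *\<^sub>R x \<in> K"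
    using closed_sequentially[OF compact_imp_closed[OF compact]] by fastforce
qed

lemma gauge_le_1_iff: "g x \<le> 1 \<longleftrightarrow> x \<in> K"
  using gauge_le_iff[of 1 x] by simp

lemma gauge_pos: "x \<noteq> 0 \<Longrightarrow> 0 < g x"
proof -
  assume x: "x \<noteq> 0"
  obtain B where B: "0 < B" "\<And>y. y \<in> K \<Longrightarrow> norm y \<le> B"
    using compact_imp_bounded[OF compact] by (auto simp: bounded_pos)
  have "norm x / B \<le> g x"
    unfolding gauge_fun_def
  proof (rule cInf_greatest[OF gauge_set_nonempty])
    fix r assume "r \<in> {r. 0 < r \<and> (1 / r) *\<^sub>R x \<in> K}"
    then have r: "0 < r" "(1 / r) *\<^sub>R x \<in> K" by auto
    have "norm x / r \<le> B" using B(2)[OF r(2)] r(1) by simp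
    then show "norm x / B \<le> r" using B(1) r(1) by (simp add: field_simps)
  qed
  moreover have "0 < norm x / B" using x B by simp
  ultimately show ?thesis by linarith
qed

lemma gauge_measurable [measurable]: "g \<in> borel_measurable borel"
proof (rule borel_measurable_iff_le[THEN iffD2], rule allI)
  fix a :: real
  consider "a < 0" | "a = 0" | "0 < a" by linarith
  then have "{x. g x \<le> a} \<in> sets borel"
  proof cases
    case 1
    then have "{x. g x \<le> a} = {}" using gauge_nonneg by (auto simp: not_le intro: less_le_trans)
    then show ?thesis by simp
  next
    case 2
    have "g 0 \<le> 0"
    proof (rule field_le_epsilon)
      fix e :: real assume "0 < e"
      then show "g 0 \<le> 0 + e" using gauge_le_iff[of e 0] zero_mem by simp
    qed
    then have "{x. g x \<le> a} = {0}" using 2 gauge_pos by (auto simp: not_le[symmetric])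
    then show ?thesis by simp
  next
    case 3
    then have "{x. g x \<le> a} = (\<lambda>x. (1 / a) *\<^sub>R x) -` K \<inter> space borel"
      using gauge_le_iff by auto
    also have "\<dots> \<in> sets borel" by (rule measurable_sets[of _ borel borel]) auto
    finally show ?thesis .
  qed
  then show "{w \<in> space borel. g w \<le> a} \<in> sets borel" by simp
qed

lemma frontier_subset: "frontier K \<subseteq> K"
  using compact compact_imp_closed frontier_subset_closed by blast

lemma normalize_frontier:
  assumes "x \<noteq> 0"
  shows "(1 / g x) *\<^sub>R x \<in> frontier K"
proof -
  let ?y = "(1 / g x) *\<^sub>R x"
  have gp: "0 < g x" by (rule gauge_pos[OF assms])
  have "?y \<in> K" using gauge_le_iff[OF gp, of x] by simp
  moreover have "?y \<notin> interior K"
  proof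
    assume "?y \<in> interior K"
    then obtain e where e: "0 < e" "ball ?y e \<subseteq> K" using mem_interior by blast
    \<comment> \<open>An interior point could be moved outwards by \<open>e / 2\<close> within the body, which contradicts
      the minimality of the gauge.\<close>
    define s where "s = 1 + e / (2 * norm ?y)"
    have ny: "0 < norm ?y" using assms gp by simp
    have "0 < e / (2 * norm ?y)" using e(1) ny by (intro divide_pos_pos mult_pos_pos) auto
    then have s: "1 < s" unfolding s_def by linarith
    have move: "dist y ((1 + e / (2 * norm y)) *\<^sub>R y) = e / 2" if "y \<noteq> 0" for y :: 'a
    proof -
      have "y - (1 + e / (2 * norm y)) *\<^sub>R y = (- (e / (2 * norm y))) *\<^sub>R y" by (simp add: algebra_simps)
      then have "dist y ((1 + e / (2 * norm y)) *\<^sub>R y) = \<bar>- (e / (2 * norm y))\<bar> * norm y"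
        by (simp only: dist_norm norm_scaleR)
      then show ?thesis using that e by simp
    qed
    have "?y \<noteq> 0" using ny by (simp only: zero_less_norm_iff not_False_eq_True)
    then have "dist ?y (s *\<^sub>R ?y) = e / 2" unfolding s_def by (rule move)
    then have "s *\<^sub>R ?y \<in> K" using e by (intro subsetD[OF e(2)]) simp
    then have "(1 / (g x / s)) *\<^sub>R x \<in> K" by simp
    then have "g x \<le> g x / s" using gp s by (subst gauge_le_iff) auto
    then show False using gp s by (simp add: field_simps)
  qed
  ultimately show ?thesis using closure_subset by (auto simp: frontier_def)
qed

lemma frontier_nonzero: "y \<in> frontier K \<Longrightarrow> y \<noteq> 0"
  using zero_interior by (auto simp: frontier_def)

lemma gauge_frontier:
  assumes y: "y \<in> frontier K" and r: "0 < r"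
  shows "g (r *\<^sub>R y) = r"
proof (rule antisym)
  have yK: "y \<in> K" using y frontier_subset by blast
  then show "g (r *\<^sub>R y) \<le> r" using r by (simp add: gauge_le_iff)
  show "r \<le> g (r *\<^sub>R y)"
  proof (rule ccontr)
    define s where "s = g (r *\<^sub>R y)"
    assume "\<not> r \<le> g (r *\<^sub>R y)"
    then have sr: "s < r" by (simp add: s_def)
    have s0: "0 < s" unfolding s_def using r frontier_nonzero[OF y] by (intro gauge_pos) simp
    let ?z = "(1 / s) *\<^sub>R (r *\<^sub>R y)"
    have z: "?z \<in> K" using gauge_le_iff[OF s0, of "r *\<^sub>R y"] by (simp add: s_def)
    have "y = (1 - s / r) *\<^sub>R 0 + (s / r) *\<^sub>R ?z" using s0 r by simp
    moreover have "0 < s / r" "s / r < 1" using s0 sr r by auto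
    moreover have "?z \<noteq> 0" using s0 r frontier_nonzero[OF y] by simp
    ultimately have "y \<in> open_segment 0 ?z" unfolding in_segment by metis
    then have "y \<in> interior K"
      using in_interior_closure_convex_segment[OF convex zero_interior, of ?z] z closure_subset by blast
    then show False using y by (simp add: frontier_def)
  qed
qed

text \<open>
  The value at 0 is an arbitrary boundary point, so that the map sends the whole space into the
  boundary; the origin is a null set.
\<close>

definition proj :: "'a \<Rightarrow> 'a" where
  "proj x = (if x = 0 then (1 / g (SOME b. b \<in> Basis)) *\<^sub>R (SOME b. b \<in> Basis) else (1 / g x) *\<^sub>R x)"

lemma proj_frontier: "proj x \<in> frontier K"
proof -
  have "(SOME b::'a. b \<in> Basis) \<in> Basis" by (rule someI_ex) (simp add: ex_in_conv)
  then show ?thesis unfolding proj_def by (auto intro!: normalize_frontier)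
qed

lemma proj_measurable [measurable]: "proj \<in> borel \<rightarrow>\<^sub>M restrict_space borel (frontier K)"
proof (rule measurable_restrict_space2)
  show "proj \<in> space borel \<rightarrow> frontier K" using proj_frontier by auto
  show "proj \<in> borel \<rightarrow>\<^sub>M borel" unfolding proj_def[abs_def] by measurable
qed

text \<open>
  Away from the origin, the cone over \<open>B\<close> consists of the points of the body that are projected
  into \<open>B\<close>. In particular the cone over a Borel set is Borel.
\<close>

lemma emeasure_cone:
  assumes B: "B \<in> sets (restrict_space borel (frontier K))"
  shows "emeasure lebesgue {r *\<^sub>R x | r x. x \<in> B \<and> 0 \<le> r \<and> r \<le> 1} = emeasure lborel (K \<inter> proj -` B)"
proof -
  let ?C = "{r *\<^sub>R x | r x. x \<in> B \<and> 0 \<le> r \<and> r \<le> 1}" and ?A = "K \<inter> proj -` B"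
  have Bf: "B \<subseteq> frontier K" using sets.sets_into_space[OF B] by (simp add: space_restrict_space)
  have "proj -` B \<inter> space borel \<in> sets borel" by (rule measurable_sets[OF proj_measurable B])
  then have Am [measurable]: "?A \<in> sets borel" by simp
  have iff: "x \<in> ?C \<longleftrightarrow> x \<in> ?A" if x: "x \<noteq> 0" for x
  proof
    assume "x \<in> ?C"
    then obtain r y where ry: "x = r *\<^sub>R y" "y \<in> B" "0 \<le> r" "r \<le> 1" by blast
    then have r: "0 < r" using x by (cases "r = 0") auto
    have y: "y \<in> frontier K" using ry Bf by blast
    have gx: "g x = r" using gauge_frontier[OF y r] ry by simp
    have "x \<in> K" using gx ry gauge_le_1_iff[of x] by simp
    moreover have "proj x = y" using x gx r ry by (simp add: proj_def)
    ultimately show "x \<in> ?A" using ry by simp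
  next
    assume A: "x \<in> ?A"
    have "x = g x *\<^sub>R proj x" using x gauge_pos[OF x] by (simp add: proj_def)
    moreover have "0 \<le> g x" "g x \<le> 1" using gauge_nonneg gauge_le_1_iff A by auto
    ultimately show "x \<in> ?C" using A by blast
  qed
  have split: "?C = (?A - {0}) \<union> (?C \<inter> {0})" using iff by blast
  have "?C \<inter> {0} \<in> sets borel" by (cases "0 \<in> ?C") auto
  then have "(?A - {0}) \<union> (?C \<inter> {0}) \<in> sets borel"
    by (intro sets.Un sets.Diff Am borel_singleton) auto
  then have Cm: "?C \<in> sets borel"
    by (rule subst[OF split[symmetric], of "\<lambda>X. X \<in> sets borel"])
  then have "emeasure lebesgue ?C = emeasure lborel ?C" by simp
  also have "\<dots> = emeasure lborel ?A"
  proof (rule emeasure_eq_AE)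
    show "AE x in lborel. x \<in> ?C \<longleftrightarrow> x \<in> ?A"
      by (rule AE_mp[OF AE_lborel_singleton[of 0]], rule AE_I2, rule impI, rule iff)
  qed (simp_all only: sets_lborel Cm Am)
  finally show ?thesis .
qed

text \<open>
  The set function in the definition of the cone measure agrees on the Borel sets of the boundary
  with the measure on the right; this also shows that it is countably additive.
\<close>

lemma cone_measure_eq:
  assumes vol: "emeasure lborel K = 1"
  shows "cone_measure K = distr (density lborel (indicator K)) (restrict_space borel (frontier K)) proj"
proof -
  let ?R = "restrict_space borel (frontier K)"
  let ?N = "distr (density lborel (indicator K)) ?R proj"
  have sp: "space ?R = frontier K" by (simp add: space_restrict_space)
  have "emeasure lebesgue K = 1" using vol by simp
  then have "cone_measure K = measure_of (frontier K) (sets ?R)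
      (\<lambda>B. emeasure lebesgue {r *\<^sub>R x | r x. x \<in> B \<and> 0 \<le> r \<and> r \<le> 1})"
    unfolding cone_measure_def by (simp add: divide_ennreal_def)
  also have "\<dots> = measure_of (frontier K) (sets ?R) (emeasure ?N)"
  proof (rule measure_of_eq)
    show "sets ?R \<subseteq> Pow (frontier K)" using sets.space_closed[of ?R] by (simp add: sp)
    fix B assume "B \<in> sigma_sets (frontier K) (sets ?R)"
    then have B: "B \<in> sets ?R" using sets.sigma_sets_eq[of ?R] by (simp add: sp)
    have "proj -` B \<inter> space borel \<in> sets borel" by (rule measurable_sets[OF proj_measurable B])
    then have pm [measurable]: "proj -` B \<in> sets borel" by simp
    have "emeasure ?N B = emeasure (density lborel (indicator K)) (proj -` B)"
      using B by (subst emeasure_distr) auto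
    also have "\<dots> = emeasure lborel (K \<inter> proj -` B)"
      by (subst emeasure_density) (auto simp: indicator_inter_arith[symmetric])
    finally show "emeasure lebesgue {r *\<^sub>R x | r x. x \<in> B \<and> 0 \<le> r \<and> r \<le> 1} = emeasure ?N B"
      using emeasure_cone[OF B] by simp
  qed
  also have "\<dots> = ?N" using measure_of_of_measure[of ?N] by (simp add: sp)
  finally show ?thesis .
qed

lemma nn_integral_cone_measure:
  assumes vol: "emeasure lborel K = 1" and [measurable]: "f \<in> borel_measurable borel"
  shows "(\<integral>\<^sup>+x. f x \<partial>cone_measure K) = (\<integral>\<^sup>+x. f (proj x) * indicator K x \<partial>lborel)"
proof -
  have pm: "proj \<in> borel \<rightarrow>\<^sub>M borel" unfolding proj_def[abs_def] by measurable
  have "(\<integral>\<^sup>+x. f x \<partial>cone_measure K) = (\<integral>\<^sup>+x. f (proj x) \<partial>density lborel (indicator K))"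
    unfolding cone_measure_eq[OF vol]
    by (rule nn_integral_distr) (auto intro!: measurable_restrict_space1)
  also have "\<dots> = (\<integral>\<^sup>+x. indicator K x * f (proj x) \<partial>lborel)"
    using measurable_compose[OF pm assms(2)] by (intro nn_integral_density) auto
  finally show ?thesis by (simp add: mult.commute)
qed

lemma inverse_power_integral:
  fixes s :: real
  assumes "0 < s" "s \<le> 1"
  shows "(\<integral>\<^sup>+r. ennreal (real p * (1 / r) ^ Suc p) * indicator {s..1} r \<partial>lborel)
      = ennreal ((1 / s) ^ p - 1)"
proof -
  have "(\<integral>\<^sup>+r. ennreal (real p * (1 / r) ^ Suc p) * indicator {s..1} r \<partial>lborel)
      = ennreal (- ((1 / 1) ^ p) - (- ((1 / s) ^ p)))"
  proof (rule nn_integral_FTC_Icc)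
    fix r :: real assume r: "r \<in> {s..1}"
    then have r0: "0 < r" using assms by auto
    show "((\<lambda>r. - ((1 / r) ^ p)) has_real_derivative real p * (1 / r) ^ Suc p) (at r)"
    proof (rule DERIV_cong[OF DERIV_minus[OF DERIV_power]])
      show "((\<lambda>r. 1 / r) has_real_derivative - ((1 / r)\<^sup>2)) (at r)"
        using r0 by (auto intro!: derivative_eq_intros simp: power2_eq_square)
      show "- (real p * (- ((1 / r)\<^sup>2) * (1 / r) ^ (p - Suc 0))) = real p * (1 / r) ^ Suc p"
        by (cases p) (simp_all add: power2_eq_square)
    qed
    show "0 \<le> real p * (1 / r) ^ Suc p" using r0 by simp
  qed (use assms in auto)
  then show ?thesis by simp
qed

text \<open>
  For \<open>x\<close> in the body, the value of \<open>h\<close> at the projection of \<open>x\<close> is \<open>h x\<close> divided by the \<open>p\<close>-th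
  power of the gauge. Writing the inverse of this power as 1 plus an integral over \<open>r\<close> between the
  gauge and 1 and exchanging the integrals leaves the integrals of \<open>h\<close> over the dilates of the body by \<open>r\<close>,
  which are \<open>r ^ (n + p)\<close> times the integral over the body, by homogeneity.
\<close>

lemma nn_integral_cone_homogeneous:
  fixes h :: "'a \<Rightarrow> real"
  assumes vol: "emeasure lborel K = 1" and [measurable]: "h \<in> borel_measurable borel"
    and h0: "\<And>x. 0 \<le> h x" and hom: "\<And>r x. 0 < r \<Longrightarrow> h (r *\<^sub>R x) = r ^ p * h x"
  shows "(\<integral>\<^sup>+x. ennreal (h x) \<partial>cone_measure K)
    = ennreal (1 + real p / real DIM('a)) * (\<integral>\<^sup>+x. ennreal (h x) * indicator K x \<partial>lborel)"
proof -
  let ?n = "DIM('a)"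
  let ?w = "\<lambda>r. ennreal (real p * (1 / r) ^ Suc p)"
  let ?H = "\<lambda>x. ennreal (h x)"
  define J where "J = (\<integral>\<^sup>+x. ?H x * indicator K x \<partial>lborel)"
  have "(\<integral>\<^sup>+x. ?H x \<partial>cone_measure K) = (\<integral>\<^sup>+x. ?H (proj x) * indicator K x \<partial>lborel)"
    by (rule nn_integral_cone_measure[OF vol]) measurable
  also have "\<dots> = (\<integral>\<^sup>+x. ?H x * indicator K x
      + (\<integral>\<^sup>+r. ?H x * (?w r * indicator {0<..1} r * indicator {r. g x \<le> r} r) \<partial>lborel) \<partial>lborel)"
  proof (rule nn_integral_cong_AE, rule AE_mp[OF AE_lborel_singleton[of 0]], rule AE_I2, rule impI)
    fix x :: 'a assume x: "x \<noteq> 0"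
    have gp: "0 < g x" by (rule gauge_pos[OF x])
    have rint: "(\<integral>\<^sup>+r. ?H x * (?w r * indicator {0<..1} r * indicator {r. g x \<le> r} r) \<partial>lborel)
       = ?H x * (\<integral>\<^sup>+r. ?w r * indicator {g x..1} r \<partial>lborel)"
    proof -
      have "(\<integral>\<^sup>+r. ?H x * (?w r * indicator {0<..1} r * indicator {r. g x \<le> r} r) \<partial>lborel)
         = (\<integral>\<^sup>+r. ?H x * (?w r * indicator {g x..1} r) \<partial>lborel)"
        using gp by (intro nn_integral_cong) (auto simp: indicator_def)
      also have "\<dots> = ?H x * (\<integral>\<^sup>+r. ?w r * indicator {g x..1} r \<partial>lborel)"
        by (rule nn_integral_cmult) measurable
      finally show ?thesis .
    qed
    show "?H (proj x) * indicator K x = ?H x * indicator K x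
      + (\<integral>\<^sup>+r. ?H x * (?w r * indicator {0<..1} r * indicator {r. g x \<le> r} r) \<partial>lborel)"
    proof (cases "x \<in> K")
      case True
      then have g1: "g x \<le> 1" by (simp add: gauge_le_1_iff)
      have "(1 / g x) ^ p \<ge> 1" using gp g1 by (intro one_le_power) simp
      then have "?H x * 1 + ?H x * ennreal ((1 / g x) ^ p - 1) = ?H x * ennreal ((1 / g x) ^ p)"
        unfolding distrib_left[symmetric]
            by (subst ennreal_1[symmetric], subst ennreal_plus[symmetric]) auto
      also have "\<dots> = ?H (proj x)"
        using x gp h0 by (simp add: proj_def hom ennreal_mult[symmetric] mult.commute)
      finally show ?thesis unfolding rint inverse_power_integral[OF gp g1] using True by simp
    next
      case False
      then have "1 < g x" using gauge_le_1_iff[of x] by simp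
      then have "(\<integral>\<^sup>+r. ?w r * indicator {g x..1} r \<partial>lborel) = 0" by simp
      then show ?thesis unfolding rint using False by simp
    qed
  qed
  also have "\<dots> = J + (\<integral>\<^sup>+x. (\<integral>\<^sup>+r. ?H x * (?w r * indicator {0<..1} r * indicator {r. g x \<le> r} r)
      \<partial>lborel) \<partial>lborel)"
    unfolding J_def by (rule nn_integral_add) measurable
  also have "(\<integral>\<^sup>+x. (\<integral>\<^sup>+r. ?H x * (?w r * indicator {0<..1} r * indicator {r. g x \<le> r} r) \<partial>lborel) \<partial>lborel)
     = (\<integral>\<^sup>+r. (\<integral>\<^sup>+x. ?H x * (?w r * indicator {0<..1} r * indicator {r. g x \<le> r} r) \<partial>lborel) \<partial>lborel)"
  proof (rule pair_sigma_finite.Fubini')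
    show "pair_sigma_finite (lborel::real measure) (lborel::'a measure)" by standard
    have "(\<lambda>p. ?H (snd p) * (?w (fst p) * indicator {0<..1} (fst p) * indicator {q. g (snd q) \<le> fst q} p))
      \<in> borel_measurable (lborel \<Otimes>\<^sub>M lborel)" by measurable
    then show "(\<lambda>(r, x). ?H x * (?w r * indicator {0<..1} r * indicator {r. g x \<le> r} r)) \<in>
        borel_measurable (lborel \<Otimes>\<^sub>M lborel)"
      by (simp add: case_prod_beta' indicator_def)
  qed
  also have "\<dots> = (\<integral>\<^sup>+r. J * (ennreal (real p * r ^ (?n - 1)) * indicator {0..1} r) \<partial>lborel)"
  proof (rule nn_integral_cong_AE, rule AE_mp[OF AE_lborel_singleton[of 0]], rule AE_I2, rule impI)
    fix r :: real assume "r \<noteq> 0"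
    show "(\<integral>\<^sup>+x. ?H x * (?w r * indicator {0<..1} r * indicator {r. g x \<le> r} r) \<partial>lborel)
       = J * (ennreal (real p * r ^ (?n - 1)) * indicator {0..1} r)"
    proof (cases "r \<in> {0<..1}")
      case True
      then have r: "0 < r" "r \<le> 1" by auto
      have "(\<integral>\<^sup>+x. ?H x * (?w r * indicator {0<..1} r * indicator {r. g x \<le> r} r) \<partial>lborel)
         = (\<integral>\<^sup>+x. ?w r * (?H x * indicator K ((1 / r) *\<^sub>R x)) \<partial>lborel)"
        using r True by (intro nn_integral_cong) (auto simp: indicator_def gauge_le_iff mult.commute)
      also have "\<dots> = ?w r * (\<integral>\<^sup>+x. ?H x * indicator K ((1 / r) *\<^sub>R x) \<partial>lborel)"
        by (rule nn_integral_cmult) measurable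
      also have "(\<integral>\<^sup>+x. ?H x * indicator K ((1 / r) *\<^sub>R x) \<partial>lborel)
         = ennreal (r ^ ?n) * (\<integral>\<^sup>+x. ?H (r *\<^sub>R x) * indicator K ((1 / r) *\<^sub>R (r *\<^sub>R x)) \<partial>lborel)"
        by (rule nn_integral_lborel_scaleR[OF _ r(1)]) measurable
      also have "(\<integral>\<^sup>+x. ?H (r *\<^sub>R x) * indicator K ((1 / r) *\<^sub>R (r *\<^sub>R x)) \<partial>lborel)
         = (\<integral>\<^sup>+x. ennreal (r ^ p) * (?H x * indicator K x) \<partial>lborel)"
        using r h0 by (intro nn_integral_cong) (simp add: hom ennreal_mult mult.assoc)
      also have "\<dots> = ennreal (r ^ p) * J" unfolding J_def by (rule nn_integral_cmult) measurable
      also have "?w r * (ennreal (r ^ ?n) * (ennreal (r ^ p) * J))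
          = (?w r * ennreal (r ^ ?n) * ennreal (r ^ p)) * J"
        by (simp only: ac_simps)
      also have "?w r * ennreal (r ^ ?n) * ennreal (r ^ p)
          = ennreal (real p * (1 / r) ^ Suc p * r ^ ?n * r ^ p)"
        using r by (simp add: ennreal_mult[symmetric])
      also have "real p * (1 / r) ^ Suc p * r ^ ?n * r ^ p = real p * r ^ (?n - 1)"
      proof -
        have "r ^ ?n = r * r ^ (?n - 1)" using DIM_positive[where 'a='a] by (simp add: power_eq_if)
        then show ?thesis using r by (simp add: field_simps)
      qed
      finally show ?thesis using r by (simp add: mult.commute)
    qed (use \<open>r \<noteq> 0\<close> in \<open>auto simp: indicator_def\<close>)
  qed
  also have "\<dots> = J * (\<integral>\<^sup>+r. ennreal (real p * r ^ (?n - 1)) * indicator {0..1} r \<partial>lborel)"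
    by (rule nn_integral_cmult) measurable
  also have "(\<integral>\<^sup>+r. ennreal (real p * r ^ (?n - 1)) * indicator {0..1} r \<partial>lborel)
     = ennreal (real p / real ?n * 1 ^ ?n - real p / real ?n * 0 ^ ?n)"
  proof (rule nn_integral_FTC_Icc)
    fix r :: real
    show "((\<lambda>r. real p / real ?n * r ^ ?n) has_real_derivative real p * r ^ (?n - 1)) (at r)"
      by (rule DERIV_cong[OF DERIV_cmult[OF DERIV_pow]]) simp
  qed auto
  also have "ennreal (real p / real ?n * 1 ^ ?n - real p / real ?n * 0 ^ ?n) = ennreal (real p / real ?n)"
    by (simp add: power_0_left)
  also have "J + J * ennreal (real p / real ?n) = ennreal (1 + real p / real ?n) * J"
    by (subst ennreal_plus) (auto simp: distrib_left distrib_right mult.commute)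
  finally show ?thesis by (simp add: J_def)
qed

end

section \<open>The estimate of the psi2-norm\<close>

lemma unconditional_zero_interior:
  fixes K :: "(real ^ 'n) set"
  assumes "convex K" "unconditional K" "interior K \<noteq> {}"
  shows "0 \<in> interior K"
proof -
  obtain x where "x \<in> interior K" using assms(3) by blast
  then obtain e where e: "0 < e" "ball x e \<subseteq> K" using mem_interior by blast
  have "z \<in> K" if z: "z \<in> ball 0 e" for z
  proof -
    have mem: "x + z \<in> K" "x - z \<in> K" using z e(2) by (auto simp: subset_iff dist_norm)
    have "z - x \<in> K" by (rule unconditional_solid[OF assms(1,2) mem(2)]) (simp add: abs_minus_commute)
    then have "(1 / 2) *\<^sub>R (x + z) + (1 / 2) *\<^sub>R (z - x) \<in> K"
      using mem assms(1) by (intro convexD) auto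
    moreover have "(1 / 2) *\<^sub>R (x + z) + (1 / 2) *\<^sub>R (z - x) = z"
      by (simp add: vec_eq_iff field_simps)
    ultimately show ?thesis by simp
  qed
  then show ?thesis using e(1) mem_interior by blast
qed

lemma power_mult_fact_le: "real n ^ j * fact (n + m - 1) \<le> fact (n + m - 1 + j)"
proof (induction j)
  case (Suc j)
  have "real n ^ Suc j * fact (n + m - 1) = real n * (real n ^ j * fact (n + m - 1))" by simp
  also have "\<dots> \<le> real (n + m - 1 + Suc j) * fact (n + m - 1 + j)"
    using Suc by (intro mult_mono) auto
  also have "\<dots> = fact (n + m - 1 + Suc j)" by simp
  finally show ?case .
qed simp

text \<open>
  The product of the first three factors equals
  \<open>fact (n + m - 1) / fact (n + 2 * m - 1) / fact m\<close>, and the quotient of the first two factorials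
  is the reciprocal of a product of \<open>m\<close> numbers that are at least \<open>n\<close>.
\<close>

lemma moment_factor_le:
  assumes n: "0 < n" and m: "0 < m"
  shows "(1 + real (2 * m) / real n) * (fact n / fact (n + 2 * m)) * real ((n + m - 1) choose m) *
      real n ^ m
    \<le> 1 / fact m"
proof -
  obtain n' where n': "n = Suc n'" using n by (cases n) auto
  obtain q where q: "n + 2 * m = Suc q" using m by (cases "n + 2 * m") auto
  have fn: "fact n = real n * fact n'" "fact (n + 2 * m) = (real n + 2 * real m) * fact q"
    unfolding q using arg_cong[OF q, of real] by (simp_all add: n')
  have ch: "real ((n + m - 1) choose m) = fact (n + m - 1) / (fact m * fact n')"
    using binomial_fact[of m "n + m - 1", where 'a = real] by (simp add: n')
  have "(1 + real (2 * m) / real n) * (fact n / fact (n + 2 * m)) * real ((n + m - 1) choose m) * real n ^ m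
    = real n ^ m * fact (n + m - 1) / fact q / fact m"
    unfolding fn ch using n by (simp add: divide_simps)
  also have "\<dots> \<le> 1 / fact m"
  proof -
    have "n + m - 1 + m = q" using q n by simp
    then have "real n ^ m * fact (n + m - 1) \<le> fact q" using power_mult_fact_le[of n m m] by simp
    then show ?thesis by (intro divide_right_mono) auto
  qed
  finally show ?thesis .
qed

lemma central_binomial_Suc_le: "real ((2 * Suc m) choose Suc m) \<le> 4 * real ((2 * m) choose m)"
proof -
  have "real ((2 * Suc m) choose Suc m) = real ((2 * m) choose m) * ((2 * (2 * real m + 1)) / (real m + 1))"
  proof -
    have cb: "real ((2 * l) choose l) = fact (2 * l) / (fact l * fact l)" for l
      by (simp add: binomial_fact)
    have "(fact (2 * Suc m) :: real) = 2 * (real m + 1) * (2 * real m + 1) * fact (2 * m)"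
      by (simp add: algebra_simps)
    moreover have "(fact (Suc m) :: real) = (real m + 1) * fact m" by (simp add: algebra_simps)
    ultimately show ?thesis unfolding cb by (simp add: divide_simps) (simp add: algebra_simps)
  qed
  also have "\<dots> \<le> real ((2 * m) choose m) * 4"
    by (intro mult_left_mono) (auto simp: divide_le_eq)
  finally show ?thesis by simp
qed

text \<open>
  The exact value is \<open>(1 - 4 * 25 / 144) powr (- 1 / 2) - 1\<close>, roughly 0.81. It suffices to keep
  the first term and to dominate the others by a geometric series.
\<close>

lemma central_binomial_series_le_1:
  "(\<Sum>k. ennreal (real ((2 * Suc k) choose Suc k) * (25 / 144) ^ Suc k)) \<le> 1"
proof -
  let ?b = "\<lambda>m. real ((2 * m) choose m) * (25 / 144) ^ m"
  \<comment> \<open>The first two terms are \<open>2 * (25 / 144) = 25 / 72\<close> and \<open>6 * (25 / 144)\<^sup>2 = 3750 / 20736\<close>;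
    the ratio of consecutive terms is at most \<open>4 * (25 / 144) = 25 / 36\<close>.\<close>
  let ?d = "\<lambda>k. if k = 0 then 25 / 72 else (3750 / 20736) * (25 / 36) ^ (k - 1) :: real"
  have step: "?b (Suc m) \<le> 25 / 36 * ?b m" for m
  proof -
    have "?b (Suc m) \<le> 4 * real ((2 * m) choose m) * (25 / 144) ^ Suc m"
      by (intro mult_right_mono central_binomial_Suc_le) simp
    then show ?thesis by simp
  qed
  have two: "?b (Suc (Suc k)) \<le> (3750 / 20736) * (25 / 36) ^ k" for k
  proof (induction k)
    case 0
    show ?case by (simp add: binomial_fact fact_numeral power2_eq_square)
  next
    case (Suc k)
    have "?b (Suc (Suc (Suc k))) \<le> 25 / 36 * ?b (Suc (Suc k))" by (rule step)
    also have "\<dots> \<le> 25 / 36 * ((3750 / 20736) * (25 / 36) ^ k)" using Suc by (intro mult_left_mono) auto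
    finally show ?case by (simp add: mult.left_commute)
  qed
  have "?b (Suc k) \<le> ?d k" for k
    using two[of "k - 1"] by (cases k) auto
  then have "(\<Sum>k. ennreal (?b (Suc k))) \<le> (\<Sum>k. ennreal (?d k))"
    by (intro suminf_le ennreal_leI) auto
  also have "(\<lambda>k. (3750 / 20736) * (25 / 36) ^ k :: real) sums ((3750 / 20736) * (1 / (1 - 25 / 36)))"
    by (intro sums_mult geometric_sums) simp
  then have "(\<lambda>k. ?d (Suc k)) sums ((3750 / 20736) * (1 / (1 - 25 / 36)))" by simp
  then have "?d sums ((3750 / 20736) * (1 / (1 - 25 / 36)) + ?d 0)" by (rule sums_Suc)
  then have "(\<Sum>k. ennreal (?d k)) = ennreal ((3750 / 20736) * (1 / (1 - 25 / 36)) + ?d 0)"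
    by (subst suminf_ennreal2) (auto simp: sums_iff)
  also have "\<dots> \<le> 1" by simp
  finally show ?thesis .
qed

theorem proposition3p1:
  fixes K :: "(real ^ 'n) set" and \<theta> :: "real ^ 'n"
  assumes "isotropic K" and "unconditional K"
  shows "psi2_norm (cone_measure K) (\<lambda>x. x \<bullet> \<theta>)
           \<le> ennreal (3 * sqrt (real CARD('n)) * infnorm \<theta>)"
proof -
  define n where "n = CARD('n)"
  define M where "M = infnorm \<theta>"
  have n: "0 < n" by (simp add: n_def)
  have M: "0 \<le> M" by (simp add: M_def infnorm_pos_le)
  have body: "compact K" "convex K" "interior K \<noteq> {}"
    using assms(1) by (auto simp: isotropic_def convex_body_def)
  interpret origin_body K
    using body unconditional_zero_interior[OF body(2) assms(2) body(3)] by unfold_locales auto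
  have vol: "emeasure lborel K = 1"
  proof -
    have "measure lborel K = 1" using assms(1) by (simp add: isotropic_def)
    then show ?thesis using emeasure_compact_finite[OF body(1)]
      by (simp add: emeasure_eq_ennreal_measure less_top)
  qed
  have cm: "f \<in> borel_measurable (cone_measure K)"
      if "f \<in> borel_measurable borel" for f :: "real ^ 'n \<Rightarrow> ennreal"
    unfolding cone_measure_eq[OF vol] using that by (simp add: measurable_restrict_space1)
  have admissible: "psi2_norm (cone_measure K) (\<lambda>x. x \<bullet> \<theta>) \<le> ennreal c"
    if c: "0 < c" "3 * sqrt (real n) * M \<le> c" for c
  proof -
    let ?a = "\<lambda>k x. (x \<bullet> \<theta>) ^ (2 * Suc k) / (c ^ (2 * Suc k) * fact (Suc k))"
    have a0: "0 \<le> ?a k x" for k x by (intro divide_nonneg_nonneg mult_nonneg_nonneg) (auto simp: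
        zero_le_even_power simp del: power_Suc)
    have expand: "ennreal (exp ((\<bar>x \<bullet> \<theta>\<bar> / c)\<^sup>2) - 1) = (\<Sum>k. ennreal (?a k x))" for x
    proof -
      let ?z = "(\<bar>x \<bullet> \<theta>\<bar> / c)\<^sup>2"
      have "(\<lambda>k. ?z ^ Suc k /\<^sub>R fact (Suc k)) sums (exp ?z - 1)"
        using exp_converges[of ?z] by (subst sums_Suc_iff) simp
      also have "(\<lambda>k. ?z ^ Suc k /\<^sub>R fact (Suc k)) = (\<lambda>k. ?a k x)"
      proof (rule ext)
        fix k
        have "?z ^ Suc k = ((x \<bullet> \<theta>) / c) ^ (2 * Suc k)"
          unfolding power_mult by (simp add: power_divide)
        then show "?z ^ Suc k /\<^sub>R fact (Suc k) = ?a k x"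
          by (simp only: power_divide) (simp add: divide_inverse)
      qed
      finally show ?thesis using a0 by (subst suminf_ennreal2) (auto simp: sums_iff)
    qed
    have term_le: "(\<integral>\<^sup>+x. ennreal (?a k x) \<partial>cone_measure K) \<le> ennreal (real ((2 * Suc k) choose Suc k)
        * (25 / 144) ^ Suc k)" for k
    proof -
      define m where "m = Suc k"
      have m: "0 < m" by (simp add: m_def)
      define q where "q = 1 / (c ^ (2 * m) * fact m)"
      have q: "0 \<le> q" using c by (simp add: q_def)
      define B where "B = fact (2 * m) * M ^ (2 * m) *
        (fact n / fact (n + 2 * m) * (5 / 4 * real n) ^ (2 * m) * real ((n + m - 1) choose m))"
      have B: "0 \<le> B" using M by (simp add: B_def)
      have "(\<integral>\<^sup>+x. ennreal (?a k x) \<partial>cone_measure K)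
          = (\<integral>\<^sup>+x. ennreal q * ennreal ((x \<bullet> \<theta>) ^ (2 * m)) \<partial>cone_measure K)"
        using q by (intro nn_integral_cong, subst ennreal_mult[symmetric]) (auto simp: q_def m_def
            zero_le_even_power simp del: power_Suc fact_Suc)
      also have "\<dots> = ennreal q * (\<integral>\<^sup>+x. ennreal ((x \<bullet> \<theta>) ^ (2 * m)) \<partial>cone_measure K)"
        by (rule nn_integral_cmult, rule cm) measurable
      also have "(\<integral>\<^sup>+x. ennreal ((x \<bullet> \<theta>) ^ (2 * m)) \<partial>cone_measure K)
         = ennreal (1 + real (2 * m) / real DIM(real^'n)) * (\<integral>\<^sup>+x. ennreal ((x \<bullet> \<theta>) ^ (2 * m)) *
             indicator K x \<partial>lborel)"
        by (rule nn_integral_cone_homogeneous[OF vol]) (auto simp: zero_le_even_power power_mult_distrib)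
      also have "real DIM(real^'n) = real n" by (simp add: n_def)
      also have "ennreal q * (ennreal (1 + real (2 * m) / real n) * (\<integral>\<^sup>+x. ennreal ((x \<bullet> \<theta>) ^ (2 * m))
          * indicator K x \<partial>lborel))
         \<le> ennreal q * (ennreal (1 + real (2 * m) / real n) * ennreal B)"
        using isotropic_unconditional_moment_le[OF assms, of \<theta> m] unfolding B_def n_def M_def
        by (intro mult_left_mono) auto
      also have "\<dots> = ennreal (q * ((1 + real (2 * m) / real n) * B))"
        using q B by (simp add: ennreal_mult)
      also have "\<dots> \<le> ennreal (real ((2 * m) choose m) * (25 / 144) ^ m)"
      proof (rule ennreal_leI)
        \<comment> \<open>Together with the factor \<open>(5 / 4)\<^sup>2 = 25 / 16\<close> from the moment bound, the constant 3
          gives the ratio \<open>25 / 16 / 9 = 25 / 144\<close>.\<close>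
        have Mc: "(M / c) ^ (2 * m) \<le> (1 / (9 * real n)) ^ m"
        proof -
          have "(3 * sqrt (real n) * M)\<^sup>2 \<le> c\<^sup>2" using c M by (intro power_mono) auto
          then have "9 * real n * M\<^sup>2 \<le> c\<^sup>2" by (simp add: power_mult_distrib)
          then have "(M / c)\<^sup>2 \<le> 1 / (9 * real n)" using c n by (simp add: power_divide field_simps)
          then show ?thesis unfolding power_mult by (intro power_mono) auto
        qed
        let ?F = "(1 + real (2 * m) / real n) * (fact n / fact (n + 2 * m)) * real ((n + m - 1) choose m)"
        have "q * ((1 + real (2 * m) / real n) * B)
          = (M / c) ^ (2 * m) * (fact (2 * m) / fact m * (25 / 16 * real n) ^ m * (?F * real n ^ m))"
        proof -
          have "(5 / 4 * real n) ^ (2 * m) = (25 / 16 * real n) ^ m * real n ^ m"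
            by (simp add: power_mult power_mult_distrib[symmetric] power2_eq_square mult.assoc)
          then show ?thesis by (simp add: q_def B_def power_divide ac_simps)
        qed
        also have "\<dots> \<le> (1 / (9 * real n)) ^ m * (fact (2 * m) / fact m * (25 / 16 * real n) ^ m * (1 /
            fact m))"
          using moment_factor_le[OF n m] Mc M c by (intro mult_mono) auto
        also have "\<dots> = (1 / (9 * real n) * (25 / 16 * real n)) ^ m * (fact (2 * m) / (fact m * fact m))"
        proof -
          have "a ^ m * (u / v * b ^ m * (1 / v)) = (a * b) ^ m * (u / (v * v))" for a b u v :: real
            by (simp add: power_mult_distrib)
          then show ?thesis .
        qed
        also have "1 / (9 * real n) * (25 / 16 * real n) = 25 / 144" using n by simp
        also have "fact (2 * m) / (fact m * fact m) = real ((2 * m) choose m)"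
          by (simp add: binomial_fact)
        finally show "q * ((1 + real (2 * m) / real n) * B) \<le> real ((2 * m) choose m) * (25 / 144) ^ m"
          by (simp add: mult.commute)
      qed
      finally show ?thesis by (simp add: m_def)
    qed
    have "(\<integral>\<^sup>+x. ennreal (exp ((\<bar>x \<bullet> \<theta>\<bar> / c)\<^sup>2) - 1) \<partial>cone_measure K)
       = (\<integral>\<^sup>+x. (\<Sum>k. ennreal (?a k x)) \<partial>cone_measure K)" unfolding expand ..
    also have "\<dots> = (\<Sum>k. \<integral>\<^sup>+x. ennreal (?a k x) \<partial>cone_measure K)"
      by (rule nn_integral_suminf, rule cm) measurable
    also have "\<dots> \<le> (\<Sum>k. ennreal (real ((2 * Suc k) choose Suc k) * (25 / 144) ^ Suc k))"
      by (intro suminf_le term_le) auto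
    also have "\<dots> \<le> 1" by (rule central_binomial_series_le_1)
    finally have "(\<integral>\<^sup>+x. ennreal (exp ((\<bar>x \<bullet> \<theta>\<bar> / c)\<^sup>2) - 1) \<partial>cone_measure K) \<le> 1" .
    then show ?thesis unfolding psi2_norm_def using c(1) by (intro INF_lower) simp
  qed
  \<comment> \<open>The scale \<open>3 * sqrt n * M\<close> itself is not positive when \<open>\<theta> = 0\<close>; slightly larger scales cover
    all cases.\<close>
  show ?thesis
  proof (rule ennreal_le_epsilon)
    fix e :: real assume e: "0 < e"
    have nonneg: "0 \<le> 3 * sqrt (real n) * M" using M by simp
    have "psi2_norm (cone_measure K) (\<lambda>x. x \<bullet> \<theta>) \<le> ennreal (3 * sqrt (real n) * M + e)"
      by (rule admissible[OF add_nonneg_pos[OF nonneg e]]) (use e in simp)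
    then show "psi2_norm (cone_measure K) (\<lambda>x. x \<bullet> \<theta>) \<le> ennreal (3 * sqrt (real CARD('n)) * infnorm \<theta>)
        + ennreal e"
      using e nonneg unfolding n_def M_def by (subst ennreal_plus[symmetric]) auto
  qed
qed

end
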